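(* Let $n\ge 3$ and $1\le p<q\le n$, let $\mathcal{H}$ be a Hilbert space, and let $T=(T_1,\ldots,T_n)\in\mathcal{T}^n_{p,q}(\mathcal{H})$. Then there exist a Hilbert space $\mathcal{E}$ and an isometry $\Pi:\mathcal{H}\to H^2_{\mathcal{E}}(\mathbb{D}^{n-1})$ such that \[ \Pi T_i^*=\begin{cases} M_{z_i}^*\Pi & \text{if } 1\le i<q,\ i\ne p,\\ M_{\Phi_i}^*\Pi & \text{if } i=p,q,\\ M_{z_{i-1}}^*\Pi & \text{if } q<i\le n,\end{cases} \] where $\Phi_p$ and $\Phi_q$ in $H^\infty_{\mathcal{B}(\mathcal{E})}(\mathbb{D}^{n-1})$ are inner polynomials in $z_p$ of degree at most one and \[ \Phi_p(\boldsymbol{z})\Phi_q(\boldsymbol{z})=\Phi_q(\boldsymbol{z})\Phi_p(\boldsymbol{z})=z_pI_{\mathcal{E}} \] for all $\boldsymbol{z}=(z_1,\ldots,z_{n-1})\in\mathbb{D}^{n-1}$. In particular, $(T_1,\ldots,T_n)$ dilates to the tuple of commuting isometries \[ (M_{z_1},\dots,M_{z_{p-1}},M_{\Phi_p},M_{z_{p+1}},\dots,M_{z_{q-1}},M_{\Phi_q},M_{z_q},\dots,M_{z_{n-1}}) \] on $H^2_{\mathcal{E}}(\mathbb{D}^{n-1})$ via the isometry $\Pi:\mathcal{H}\to H^2_{\mathcal{E}}(\mathbb{D}^{n-1})$.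
   Context: $\mathcal{B}(\mathcal{H})$ is the algebra of bounded operators on the Hilbert space $\mathcal{H}$. $\mathcal{T}^m(\mathcal{H})$ is the set of $m$-tuples $(T_1,\ldots,T_m)$ of pairwise commuting contractions ($\|T_i\|\le1$) on $\mathcal{H}$. For $T\in\mathcal{T}^m(\mathcal{H})$ and $\boldsymbol{k}\in\mathbb{Z}_+^m$ write $T^{\boldsymbol{k}}=T_1^{k_1}\cdots T_m^{k_m}$, $T^{*\boldsymbol{k}}=T_1^{*k_1}\cdots T_m^{*k_m}$, $|\boldsymbol{k}|=\sum_i k_i$, and \[ \mathbb{S}_m^{-1}(T,T^* )=\sum_{\boldsymbol{k}\in\{0,1\}^m}(-1)^{|\boldsymbol{k}|}T^{\boldsymbol{k}}T^{*\boldsymbol{k}}. \] Let $\mathbb{S}_m(\mathcal{H})=\{T\in\mathcal{T}^m(\mathcal{H}):\mathbb{S}_m^{-1}(T,T^* )\ge0\}$. A tuple $T\in\mathcal{T}^m(\mathcal{H})$ is pure if $\|T_i^{*r}h\|\to0$ as $r\to\infty$ for all $h\in\mathcal{H}$ and all $i$. For $T\in\mathcal{T}^n(\mathcal{H})$, $\hat{T}_i\in\mathcal{T}^{n-1}(\mathcal{H})$ denotes the $(n-1)$-tuple obtained from $T$ by removing $T_i$. For $n\ge3$ and $1\le p<q\le n$, \[ \mathcal{T}^n_{p,q}(\mathcal{H})=\{T\in\mathcal{T}^n(\mathcal{H}):\hat{T}_p,\hat{T}_q\in\mathbb{S}_{n-1}(\mathcal{H})\text{ and }\hat{T}_p\text{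 is pure}\}. \] For a Hilbert space $\mathcal{E}$, $H^2_{\mathcal{E}}(\mathbb{D}^m)$ is the $\mathcal{E}$-valued Hardy space on the polydisc $\mathbb{D}^m$: analytic $f=\sum_{\boldsymbol{k}\in\mathbb{Z}_+^m}a_{\boldsymbol{k}}\boldsymbol{z}^{\boldsymbol{k}}$, $a_{\boldsymbol{k}}\in\mathcal{E}$, with $\|f\|^2=\sum\|a_{\boldsymbol{k}}\|^2<\infty$. $M_{z_i}$ is multiplication by $z_i$ on it. $H^\infty_{\mathcal{B}(\mathcal{E})}(\mathbb{D}^m)$ is the set of bounded $\mathcal{B}(\mathcal{E})$-valued analytic functions on $\mathbb{D}^m$; for $\Phi$ in it, $M_\Phi$ is multiplication by $\Phi$ on $H^2_{\mathcal{E}}(\mathbb{D}^m)$, and $\Phi$ is inner if $M_\Phi$ is an isometry. A tuple $T\in\mathcal{T}^n(\mathcal{H})$ dilates to an $n$-tuple of commuting isometries $V\in\mathcal{T}^n(\mathcal{K})$ via an isometry $\Pi:\mathcal{H}\to\mathcal{K}$ if $\Pi T_i^*=V_i^*\Pi$ for all $i=1,\ldots,n$. *)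

theory Defs
  imports "HOL-Analysis.Analysis"
begin

section \<open>Complex Hilbert spaces\<close>

text \<open>
  The norm, metric and topology are those of the underlying real inner product space
  (\<open>inner = Re cinner\<close>); \<open>cinner\<close> is linear in its first argument.
\<close>

class complex_inner = real_inner +
  fixes scaleC :: "complex \<Rightarrow> 'a \<Rightarrow> 'a"  (infixr \<open>*\<^sub>C\<close> 75)
    and cinner :: "'a \<Rightarrow> 'a \<Rightarrow> complex"
  assumes scaleC_add_right: "c *\<^sub>C (x + y) = c *\<^sub>C x + c *\<^sub>C y"
    and scaleC_add_left: "(c + d) *\<^sub>C x = c *\<^sub>C x + d *\<^sub>C x"
    and scaleC_scaleC: "c *\<^sub>C d *\<^sub>C x = (c * d) *\<^sub>C x"
    and scaleC_of_real: "complex_of_real r *\<^sub>C x = r *\<^sub>R x"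
    and cinner_commute: "cinner x y = cnj (cinner y x)"
    and cinner_add_left: "cinner (x + y) z = cinner x z + cinner y z"
    and cinner_scaleC_left: "cinner (c *\<^sub>C x) y = c * cinner x y"
    and Re_cinner: "Re (cinner x y) = inner x y"

class chilbert_space = complex_inner + complete_space

instantiation complex :: chilbert_space
begin
definition scaleC_complex :: "complex \<Rightarrow> complex \<Rightarrow> complex" where "scaleC_complex c x = c * x"
definition cinner_complex :: "complex \<Rightarrow> complex \<Rightarrow> complex" where "cinner_complex x y = x * cnj y"
instance
  by standard
    (auto simp: scaleC_complex_def cinner_complex_def algebra_simps scaleR_conv_of_real inner_complex_def)
end

lemma cinner_self: "cinner x x = complex_of_real ((norm (x::'a::complex_inner))\<^sup>2)"
proof (rule complex_eqI)
  show "Re (cinner x x) = Re (complex_of_real ((norm x)\<^sup>2))"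
    by (simp add: Re_cinner power2_norm_eq_inner)
  have "Im (cinner x x) = - Im (cinner x x)"
    using arg_cong[OF cinner_commute[of x x], of Im] by simp
  then show "Im (cinner x x) = Im (complex_of_real ((norm x)\<^sup>2))" by simp
qed

lemma norm_scaleC: "norm (c *\<^sub>C (x::'a::complex_inner)) = cmod c * norm x"
proof -
  have "cinner (c *\<^sub>C x) (c *\<^sub>C x) = (c * cnj c) * cinner x x"
    by (metis cinner_commute cinner_scaleC_left complex_cnj_mult mult.assoc)
  then have "complex_of_real ((norm (c *\<^sub>C x))\<^sup>2) = complex_of_real ((cmod c * norm x)\<^sup>2)"
    by (simp add: cinner_self complex_norm_square power_mult_distrib del: of_real_power)
  then have "(norm (c *\<^sub>C x))\<^sup>2 = (cmod c * norm x)\<^sup>2"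
    using of_real_eq_iff by blast
  then show ?thesis by simp
qed

lemma cmod_cinner_le: "cmod (cinner x y) \<le> (norm (x::'a::complex_inner))\<^sup>2 + (norm y)\<^sup>2"
proof -
  have re: "\<bar>Re (cinner u y)\<bar> \<le> norm u * norm y" for u
    by (simp add: Re_cinner Cauchy_Schwarz_ineq2)
  have "Im (cinner x y) = Re (cinner ((- \<i>) *\<^sub>C x) y)"
    by (simp add: cinner_scaleC_left)
  with re[of "(- \<i>) *\<^sub>C x"] have "\<bar>Im (cinner x y)\<bar> \<le> norm x * norm y"
    by (simp add: norm_scaleC)
  with re[of x] have "cmod (cinner x y) \<le> 2 * (norm x * norm y)"
    using cmod_le[of "cinner x y"] by linarith
  moreover have "0 \<le> (norm x - norm y)\<^sup>2" by simp
  ultimately show ?thesis by (simp add: power2_diff)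
qed


section \<open>The Hilbert space of square-summable sequences with entries in a Hilbert space\<close>

text \<open>
  This type serves as an ambient space for Hilbert spaces whose existence is asserted:
  they range over its closed complex subspaces.
\<close>

typedef (overloaded) 'a ell2 =
    "{x :: nat \<Rightarrow> 'a::complex_inner. summable (\<lambda>i. (norm (x i))\<^sup>2)}"
  morphisms ell2_nth Abs_ell2
  by (rule exI[of _ "\<lambda>_. 0"]) simp

setup_lifting type_definition_ell2

lemma ell2_summable: "summable (\<lambda>i. (norm (ell2_nth x i))\<^sup>2)"
  using ell2_nth[of x] by simp

lemma ell2_eqI: "(\<And>i. ell2_nth x i = ell2_nth y i) \<Longrightarrow> x = y"
  using ell2_nth_inject by blast

lemma summable_cinner:
  assumes "summable (\<lambda>i. (norm (x i :: 'a::complex_inner))\<^sup>2)" "summable (\<lambda>i. (norm (y i))\<^sup>2)"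
  shows "summable (\<lambda>i. cinner (x i) (y i))"
  by (rule summable_comparison_test'[OF summable_add[OF assms]]) (rule cmod_cinner_le)

lemma square_summable_add:
  assumes "summable (\<lambda>i. (norm (x i :: 'a::complex_inner))\<^sup>2)" "summable (\<lambda>i. (norm (y i))\<^sup>2)"
  shows "summable (\<lambda>i. (norm (x i + y i))\<^sup>2)"
proof (rule summable_comparison_test'[OF summable_mult[OF summable_add[OF assms], of 2]])
  fix i :: nat
  have "(norm (x i + y i))\<^sup>2 \<le> (norm (x i) + norm (y i))\<^sup>2"
    by (simp add: norm_triangle_ineq power_mono)
  moreover have "0 \<le> (norm (x i) - norm (y i))\<^sup>2" by simp
  ultimately show "norm ((norm (x i + y i))\<^sup>2) \<le> 2 * ((norm (x i))\<^sup>2 + (norm (y i))\<^sup>2)"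
    by (simp add: power2_diff power2_sum)
qed

instantiation ell2 :: (complex_inner) real_vector
begin

lift_definition zero_ell2 :: "'a ell2" is "\<lambda>_. 0" by simp
lift_definition plus_ell2 :: "'a ell2 \<Rightarrow> 'a ell2 \<Rightarrow> 'a ell2" is "\<lambda>x y i. x i + y i"
  by (rule square_summable_add)
lift_definition uminus_ell2 :: "'a ell2 \<Rightarrow> 'a ell2" is "\<lambda>x i. - x i" by simp
definition minus_ell2 :: "'a ell2 \<Rightarrow> 'a ell2 \<Rightarrow> 'a ell2" where "x - y = x + (- y)" for x y :: "'a ell2"
lift_definition scaleR_ell2 :: "real \<Rightarrow> 'a ell2 \<Rightarrow> 'a ell2" is "\<lambda>r x i. r *\<^sub>R x i"
  by (simp add: power_mult_distrib summable_mult)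

instance
proof
  fix x y z :: "'a ell2" and r s :: real
  show "x + y + z = x + (y + z)" by (rule ell2_eqI) (simp add: plus_ell2.rep_eq)
  show "x + y = y + x" by (rule ell2_eqI) (simp add: plus_ell2.rep_eq)
  show "0 + x = x" by (rule ell2_eqI) (simp add: plus_ell2.rep_eq zero_ell2.rep_eq)
  show "- x + x = 0"
    by (rule ell2_eqI) (simp add: plus_ell2.rep_eq zero_ell2.rep_eq uminus_ell2.rep_eq)
  show "x - y = x + - y" by (simp add: minus_ell2_def)
  show "r *\<^sub>R (x + y) = r *\<^sub>R x + r *\<^sub>R y"
    by (rule ell2_eqI) (simp add: plus_ell2.rep_eq scaleR_ell2.rep_eq scaleR_add_right)
  show "(r + s) *\<^sub>R x = r *\<^sub>R x + s *\<^sub>R x"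
    by (rule ell2_eqI) (simp add: plus_ell2.rep_eq scaleR_ell2.rep_eq scaleR_add_left)
  show "r *\<^sub>R s *\<^sub>R x = (r * s) *\<^sub>R x" by (rule ell2_eqI) (simp add: scaleR_ell2.rep_eq)
  show "1 *\<^sub>R x = x" by (rule ell2_eqI) (simp add: scaleR_ell2.rep_eq)
qed

end

instantiation ell2 :: (complex_inner) complex_inner
begin

lift_definition scaleC_ell2 :: "complex \<Rightarrow> 'a ell2 \<Rightarrow> 'a ell2" is "\<lambda>c x i. c *\<^sub>C x i"
  by (simp add: norm_scaleC power_mult_distrib summable_mult)
definition cinner_ell2 :: "'a ell2 \<Rightarrow> 'a ell2 \<Rightarrow> complex" where
  "cinner x y = (\<Sum>i. cinner (ell2_nth x i) (ell2_nth y i))" for x y :: "'a ell2"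
definition inner_ell2 :: "'a ell2 \<Rightarrow> 'a ell2 \<Rightarrow> real" where
  "inner x y = (\<Sum>i. inner (ell2_nth x i) (ell2_nth y i))" for x y :: "'a ell2"
definition norm_ell2 :: "'a ell2 \<Rightarrow> real" where
  "norm x = sqrt (inner x x)" for x :: "'a ell2"
definition sgn_ell2 :: "'a ell2 \<Rightarrow> 'a ell2" where
  "sgn x = inverse (norm x) *\<^sub>R x" for x :: "'a ell2"
definition dist_ell2 :: "'a ell2 \<Rightarrow> 'a ell2 \<Rightarrow> real" where
  "dist x y = norm (x - y)" for x y :: "'a ell2"
definition uniformity_ell2 :: "('a ell2 \<times> 'a ell2) filter" where
  "uniformity_ell2 = (INF e\<in>{0<..}. principal {(x, y). dist x y < e})"
definition open_ell2 :: "'a ell2 set \<Rightarrow> bool" where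
  "open_ell2 U = (\<forall>x\<in>U. eventually (\<lambda>(x', y). x' = x \<longrightarrow> y \<in> U) uniformity)"

lemma summable_cinner_ell2: "summable (\<lambda>i. cinner (ell2_nth x i) (ell2_nth y i))"
  by (rule summable_cinner[OF ell2_summable ell2_summable])

lemma summable_inner_ell2: "summable (\<lambda>i. inner (ell2_nth x i) (ell2_nth y i))"
  using summable_Re[OF summable_cinner_ell2[of x y]] by (simp add: Re_cinner)

instance
proof
  fix x y z :: "'a ell2" and r :: real and c d :: complex
  show "sgn x = inverse (norm x) *\<^sub>R x" by (simp add: sgn_ell2_def)
  show "dist x y = norm (x - y)" by (simp add: dist_ell2_def)
  show "(uniformity :: ('a ell2 \<times> 'a ell2) filter) = (INF e\<in>{0<..}. principal {(x, y). dist x y < e})"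
    by (simp add: uniformity_ell2_def)
  show "open U = (\<forall>x\<in>U. \<forall>\<^sub>F (x', y) in uniformity. x' = x \<longrightarrow> y \<in> U)" for U :: "'a ell2 set"
    by (simp add: open_ell2_def)
  show "inner x y = inner y x" by (simp add: inner_ell2_def inner_commute)
  show "inner (x + y) z = inner x z + inner y z"
    by (simp add: inner_ell2_def plus_ell2.rep_eq inner_add_left suminf_add[OF summable_inner_ell2 summable_inner_ell2])
  show "inner (r *\<^sub>R x) y = r * inner x y"
    by (simp add: inner_ell2_def scaleR_ell2.rep_eq suminf_mult[OF summable_inner_ell2])
  show "0 \<le> inner x x"
    unfolding inner_ell2_def by (rule suminf_nonneg[OF summable_inner_ell2]) simp
  show "inner x x = 0 \<longleftrightarrow> x = 0"
  proof
    assume "inner x x = 0"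
    then have "\<And>i. inner (ell2_nth x i) (ell2_nth x i) = 0"
      unfolding inner_ell2_def by (subst (asm) suminf_eq_zero_iff[OF summable_inner_ell2]) auto
    then show "x = 0" by (intro ell2_eqI) (simp add: zero_ell2.rep_eq)
  qed (simp add: inner_ell2_def zero_ell2.rep_eq)
  show "norm x = sqrt (inner x x)" by (simp add: norm_ell2_def)
  show "c *\<^sub>C (x + y) = c *\<^sub>C x + c *\<^sub>C y"
    by (rule ell2_eqI) (simp add: plus_ell2.rep_eq scaleC_ell2.rep_eq scaleC_add_right)
  show "(c + d) *\<^sub>C x = c *\<^sub>C x + d *\<^sub>C x"
    by (rule ell2_eqI) (simp add: plus_ell2.rep_eq scaleC_ell2.rep_eq scaleC_add_left)
  show "c *\<^sub>C d *\<^sub>C x = (c * d) *\<^sub>C x"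
    by (rule ell2_eqI) (simp add: scaleC_ell2.rep_eq scaleC_scaleC)
  show "complex_of_real r *\<^sub>C x = r *\<^sub>R x"
    by (rule ell2_eqI) (simp add: scaleC_ell2.rep_eq scaleR_ell2.rep_eq scaleC_of_real)
  have "cnj (cinner y x) = (\<Sum>i. cnj (cinner (ell2_nth y i) (ell2_nth x i)))"
    unfolding cinner_ell2_def
    by (rule bounded_linear.suminf[OF bounded_linear_cnj summable_cinner_ell2])
  then show "cinner x y = cnj (cinner y x)"
    by (simp add: cinner_ell2_def cinner_commute[symmetric])
  show "cinner (x + y) z = cinner x z + cinner y z"
    by (simp add: cinner_ell2_def plus_ell2.rep_eq cinner_add_left suminf_add[OF summable_cinner_ell2 summable_cinner_ell2])
  show "cinner (c *\<^sub>C x) y = c * cinner x y"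
    by (simp add: cinner_ell2_def scaleC_ell2.rep_eq cinner_scaleC_left suminf_mult[OF summable_cinner_ell2])
  have "Re (cinner x y) = (\<Sum>i. Re (cinner (ell2_nth x i) (ell2_nth y i)))"
    unfolding cinner_ell2_def by (rule bounded_linear.suminf[OF bounded_linear_Re summable_cinner_ell2])
  then show "Re (cinner x y) = inner x y" by (simp add: inner_ell2_def Re_cinner)
qed

end

lemma ell2_power2_norm: "(norm x)\<^sup>2 = (\<Sum>i. (norm (ell2_nth x i))\<^sup>2)"
  unfolding power2_norm_eq_inner inner_ell2_def ..

lemma ell2_nth_diff: "ell2_nth (x - y) i = ell2_nth x i - ell2_nth y i"
  unfolding minus_ell2_def plus_ell2.rep_eq uminus_ell2.rep_eq by simp

instance ell2 :: (chilbert_space) chilbert_space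
proof
  fix X :: "nat \<Rightarrow> 'a ell2"
  assume X: "Cauchy X"
  have part: "(\<Sum>i<K. (norm (ell2_nth x i))\<^sup>2) \<le> (norm x)\<^sup>2" for x :: "'a ell2" and K
    unfolding ell2_power2_norm by (rule sum_le_suminf[OF ell2_summable]) auto
  have coord: "norm (ell2_nth x i) \<le> norm x" for x :: "'a ell2" and i
  proof -
    have "(norm (ell2_nth x i))\<^sup>2 \<le> (\<Sum>j<Suc i. (norm (ell2_nth x j))\<^sup>2)"
      by (simp add: sum_nonneg)
    with part[where K = "Suc i"] have "(norm (ell2_nth x i))\<^sup>2 \<le> (norm x)\<^sup>2"
      using order_trans by blast
    then show ?thesis by (rule power2_le_imp_le) simp
  qed
  have "Cauchy (\<lambda>n. ell2_nth (X n) i)" for i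
  proof (rule CauchyI)
    fix e :: real assume "0 < e"
    then obtain M where M: "\<forall>m\<ge>M. \<forall>n\<ge>M. norm (X m - X n) < e"
      using CauchyD[OF X] by blast
    then show "\<exists>M. \<forall>m\<ge>M. \<forall>n\<ge>M. norm (ell2_nth (X m) i - ell2_nth (X n) i) < e"
      using coord by (metis ell2_nth_diff order_le_less_trans)
  qed
  then have "\<forall>i. \<exists>l. (\<lambda>n. ell2_nth (X n) i) \<longlonglongrightarrow> l"
    using Cauchy_convergent_iff convergent_def by blast
  then obtain l where l: "\<And>i. (\<lambda>n. ell2_nth (X n) i) \<longlonglongrightarrow> l i" by metis
  have key: "\<exists>M. \<forall>n\<ge>M. \<forall>K. (\<Sum>i<K. (norm (l i - ell2_nth (X n) i))\<^sup>2) \<le> e\<^sup>2" if e: "0 < e" for e :: real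
  proof -
    obtain M where M: "\<forall>m\<ge>M. \<forall>n\<ge>M. norm (X m - X n) < e"
      using CauchyD[OF X e] by blast
    have "(\<Sum>i<K. (norm (l i - ell2_nth (X n) i))\<^sup>2) \<le> e\<^sup>2" if n: "n \<ge> M" for n K
    proof (rule tendsto_upperbound[OF _ _ sequentially_bot])
      show "(\<lambda>m. \<Sum>i<K. (norm (ell2_nth (X m) i - ell2_nth (X n) i))\<^sup>2)
              \<longlonglongrightarrow> (\<Sum>i<K. (norm (l i - ell2_nth (X n) i))\<^sup>2)"
        by (intro tendsto_intros l)
      have "(\<Sum>i<K. (norm (ell2_nth (X m) i - ell2_nth (X n) i))\<^sup>2) \<le> e\<^sup>2" if "m \<ge> M" for m
      proof -
        have "(norm (X m - X n))\<^sup>2 \<le> e\<^sup>2"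
          using M n that by (simp add: less_imp_le power_mono)
        with part[of "X m - X n" K] show ?thesis by (simp add: ell2_nth_diff)
      qed
      then show "\<forall>\<^sub>F m in sequentially. (\<Sum>i<K. (norm (ell2_nth (X m) i - ell2_nth (X n) i))\<^sup>2) \<le> e\<^sup>2"
        using eventually_sequentially by blast
    qed
    then show ?thesis by blast
  qed
  have summ: "summable (\<lambda>i. (norm (l i - ell2_nth (X n) i))\<^sup>2)"
    if "\<forall>K. (\<Sum>i<K. (norm (l i - ell2_nth (X n) i))\<^sup>2) \<le> e\<^sup>2" for n e
    by (rule summableI_nonneg_bounded[where x = "e\<^sup>2"]) (use that in auto)
  obtain n0 where "\<forall>K. (\<Sum>i<K. (norm (l i - ell2_nth (X n0) i))\<^sup>2) \<le> 1\<^sup>2"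
    using key[of 1] by auto
  from square_summable_add[OF summ[OF this] ell2_summable[of "X n0"]]
  have "summable (\<lambda>i. (norm (l i))\<^sup>2)" by simp
  then have L: "ell2_nth (Abs_ell2 l) = l" by (simp add: Abs_ell2_inverse)
  have "X \<longlonglongrightarrow> Abs_ell2 l"
  proof (rule LIMSEQ_I)
    fix r :: real assume r: "0 < r"
    obtain M where M: "\<forall>n\<ge>M. \<forall>K. (\<Sum>i<K. (norm (l i - ell2_nth (X n) i))\<^sup>2) \<le> (r/2)\<^sup>2"
      using key[of "r/2"] r by auto
    have "norm (X n - Abs_ell2 l) < r" if n: "n \<ge> M" for n
    proof -
      have le: "\<forall>K. (\<Sum>i<K. (norm (l i - ell2_nth (X n) i))\<^sup>2) \<le> (r/2)\<^sup>2"
        using M n by simp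
      have "(norm (Abs_ell2 l - X n))\<^sup>2 \<le> (r/2)\<^sup>2"
        unfolding ell2_power2_norm ell2_nth_diff L
        by (rule suminf_le_const[OF summ[OF le]]) (rule le[rule_format])
      then have "norm (Abs_ell2 l - X n) \<le> r/2"
        by (rule power2_le_imp_le) (use r in simp)
      then show ?thesis using r by (simp add: norm_minus_commute)
    qed
    then show "\<exists>no. \<forall>n\<ge>no. norm (X n - Abs_ell2 l) < r" by blast
  qed
  then show "convergent X" by (rule convergentI)
qed


section \<open>Operators\<close>

definition closed_csubspace :: "'e::chilbert_space set \<Rightarrow> bool" where
  "closed_csubspace E \<longleftrightarrow> closed E \<and> 0 \<in> E \<and> (\<forall>x\<in>E. \<forall>y\<in>E. x + y \<in> E) \<and> (\<forall>c. \<forall>x\<in>E. c *\<^sub>C x \<in> E)"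

text \<open>
  A Hilbert space here is a closed subspace \<open>E\<close> of a type of class \<open>chilbert_space\<close> (with
  \<open>E = UNIV\<close> for the type itself). An operator on \<open>E\<close> is a function of which only the values
  on \<open>E\<close> matter; \<open>bounded_ops E\<close> is the algebra of bounded operators on \<open>E\<close>. The
  definition of \<open>onorm_on\<close> is that of \<open>onorm\<close> in the library, relativised to \<open>E\<close>.
\<close>

definition bounded_ops :: "'e::chilbert_space set \<Rightarrow> ('e \<Rightarrow> 'e) set" where
  "bounded_ops E = {A. (\<forall>x\<in>E. A x \<in> E) \<and> (\<forall>x\<in>E. \<forall>y\<in>E. A (x + y) = A x + A y) \<and>
     (\<forall>c. \<forall>x\<in>E. A (c *\<^sub>C x) = c *\<^sub>C A x) \<and> (\<exists>C. \<forall>x\<in>E. norm (A x) \<le> C * norm x)}"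

definition onorm_on :: "'e::chilbert_space set \<Rightarrow> ('e \<Rightarrow> 'e) \<Rightarrow> real" where
  "onorm_on E A = (SUP x\<in>E. norm (A x) / norm x)"

text \<open>
  The adjoint of an operator \<open>A\<close> on the Hilbert space with underlying set \<open>S\<close> and inner
  product \<open>ip\<close>. For bounded \<open>A\<close> the defining vector exists and is unique.
\<close>

definition adjoint_on :: "'a set \<Rightarrow> ('a \<Rightarrow> 'a \<Rightarrow> complex) \<Rightarrow> ('a \<Rightarrow> 'a) \<Rightarrow> 'a \<Rightarrow> 'a" where
  "adjoint_on S ip A y = (THE u. u \<in> S \<and> (\<forall>x\<in>S. ip (A x) y = ip x u))"

definition cadjoint :: "('h::chilbert_space \<Rightarrow> 'h) \<Rightarrow> 'h \<Rightarrow> 'h" where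
  "cadjoint A = adjoint_on UNIV cinner A"

definition positive_op :: "('h::chilbert_space \<Rightarrow> 'h) \<Rightarrow> bool" where
  "positive_op A \<longleftrightarrow> (\<forall>h. cinner (A h) h \<in> \<real>\<^sub>\<ge>\<^sub>0)"


section \<open>Tuples of commuting contractions\<close>

text \<open>
  An \<open>m\<close>-tuple is a function on \<open>nat\<close> of which only the values at \<open>1, \<dots>, m\<close> matter.
\<close>

definition commuting_contractions :: "nat \<Rightarrow> (nat \<Rightarrow> 'h::chilbert_space \<Rightarrow> 'h) set" where
  "commuting_contractions m = {T.
     (\<forall>i\<in>{1..m}. T i \<in> bounded_ops UNIV \<and> onorm (T i) \<le> 1) \<and>
     (\<forall>i\<in>{1..m}. \<forall>j\<in>{1..m}. T i \<circ> T j = T j \<circ> T i)}"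

text \<open>\<open>tuple_power m T k\<close> is the composition of \<open>T 1 ^^ k 1\<close>, \<open>\<dots>\<close>, \<open>T m ^^ k m\<close>, in this order.\<close>

definition tuple_power :: "nat \<Rightarrow> (nat \<Rightarrow> 'h \<Rightarrow> 'h) \<Rightarrow> (nat \<Rightarrow> nat) \<Rightarrow> 'h \<Rightarrow> 'h" where
  "tuple_power m T k = foldr (\<lambda>i A. (T i ^^ k i) \<circ> A) [1..<Suc m] id"

definition szego_inverse :: "nat \<Rightarrow> (nat \<Rightarrow> 'h::chilbert_space \<Rightarrow> 'h) \<Rightarrow> 'h \<Rightarrow> 'h" where
  "szego_inverse m T h = (\<Sum>k\<in>{1..m} \<rightarrow>\<^sub>E {0, 1}.
     (-1) ^ (\<Sum>i=1..m. k i) *\<^sub>R tuple_power m T k (tuple_power m (\<lambda>i. cadjoint (T i)) k h))"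

definition szego_tuples :: "nat \<Rightarrow> (nat \<Rightarrow> 'h::chilbert_space \<Rightarrow> 'h) set" where
  "szego_tuples m = {T \<in> commuting_contractions m. positive_op (szego_inverse m T)}"

definition pure_tuple :: "nat \<Rightarrow> (nat \<Rightarrow> 'h::chilbert_space \<Rightarrow> 'h) \<Rightarrow> bool" where
  "pure_tuple m T \<longleftrightarrow>
     (\<forall>i\<in>{1..m}. \<forall>h. (\<lambda>r. norm ((cadjoint (T i) ^^ r) h)) \<longlonglongrightarrow> 0)"

definition remove_entry :: "nat \<Rightarrow> (nat \<Rightarrow> 'b) \<Rightarrow> nat \<Rightarrow> 'b" where
  "remove_entry i T = (\<lambda>j. if j < i then T j else T (Suc j))"

definition Tpq :: "nat \<Rightarrow> nat \<Rightarrow> nat \<Rightarrow> (nat \<Rightarrow> 'h::chilbert_space \<Rightarrow> 'h) set" where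
  "Tpq n p q = {T \<in> commuting_contractions n.
     remove_entry p T \<in> szego_tuples (n - 1) \<and> remove_entry q T \<in> szego_tuples (n - 1) \<and>
     pure_tuple (n - 1) (remove_entry p T)}"


section \<open>The vector-valued Hardy space on the polydisc\<close>

definition polydisc :: "nat \<Rightarrow> (nat \<Rightarrow> complex) set" where
  "polydisc m = {1..m} \<rightarrow>\<^sub>E ball 0 1"

definition multi_indices :: "nat \<Rightarrow> (nat \<Rightarrow> nat) set" where
  "multi_indices m = {1..m} \<rightarrow>\<^sub>E UNIV"

definition monom_at :: "nat \<Rightarrow> (nat \<Rightarrow> complex) \<Rightarrow> (nat \<Rightarrow> nat) \<Rightarrow> complex" where
  "monom_at m z k = (\<Prod>i=1..m. z i ^ k i)"

definition has_coeffs :: "nat \<Rightarrow> ((nat \<Rightarrow> complex) \<Rightarrow> 'e::chilbert_space) \<Rightarrow> ((nat \<Rightarrow> nat) \<Rightarrow> 'e) \<Rightarrow> bool" where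
  "has_coeffs m f a \<longleftrightarrow>
     (\<forall>z\<in>polydisc m. ((\<lambda>k. monom_at m z k *\<^sub>C a k) has_sum f z) (multi_indices m))"

text \<open>
  Functions on the polydisc are represented by functions that vanish off the polydisc, so that
  the vector space operations are pointwise.
\<close>

definition hardy :: "'e::chilbert_space set \<Rightarrow> nat \<Rightarrow> ((nat \<Rightarrow> complex) \<Rightarrow> 'e) set" where
  "hardy E m = {f. (\<forall>z. z \<notin> polydisc m \<longrightarrow> f z = 0) \<and>
     (\<exists>a. (\<forall>k\<in>multi_indices m. a k \<in> E) \<and> has_coeffs m f a \<and>
          (\<lambda>k. (norm (a k))\<^sup>2) summable_on multi_indices m)}"

text \<open>The coefficients of a power series converging on the polydisc are unique.\<close>

definition coeffs_of :: "nat \<Rightarrow> ((nat \<Rightarrow> complex) \<Rightarrow> 'e::chilbert_space) \<Rightarrow> (nat \<Rightarrow> nat) \<Rightarrow> 'e" where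
  "coeffs_of m f = (THE a. a \<in> extensional (multi_indices m) \<and> has_coeffs m f a)"

definition hardy_inner ::
  "nat \<Rightarrow> ((nat \<Rightarrow> complex) \<Rightarrow> 'e::chilbert_space) \<Rightarrow> ((nat \<Rightarrow> complex) \<Rightarrow> 'e) \<Rightarrow> complex" where
  "hardy_inner m f g = (\<Sum>\<^sub>\<infinity>k\<in>multi_indices m. cinner (coeffs_of m f k) (coeffs_of m g k))"

definition hardy_norm :: "nat \<Rightarrow> ((nat \<Rightarrow> complex) \<Rightarrow> 'e::chilbert_space) \<Rightarrow> real" where
  "hardy_norm m f = sqrt (\<Sum>\<^sub>\<infinity>k\<in>multi_indices m. (norm (coeffs_of m f k))\<^sup>2)"

definition hardy_adjoint ::
  "'e::chilbert_space set \<Rightarrow> nat \<Rightarrow> (((nat \<Rightarrow> complex) \<Rightarrow> 'e) \<Rightarrow> ((nat \<Rightarrow> complex) \<Rightarrow> 'e)) \<Rightarrow>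
   ((nat \<Rightarrow> complex) \<Rightarrow> 'e) \<Rightarrow> ((nat \<Rightarrow> complex) \<Rightarrow> 'e)" where
  "hardy_adjoint E m = adjoint_on (hardy E m) (hardy_inner m)"

definition isometry_to_hardy ::
  "'e::chilbert_space set \<Rightarrow> nat \<Rightarrow> ('h::chilbert_space \<Rightarrow> (nat \<Rightarrow> complex) \<Rightarrow> 'e) \<Rightarrow> bool" where
  "isometry_to_hardy E m V \<longleftrightarrow>
     (\<forall>h. V h \<in> hardy E m) \<and>
     (\<forall>h g. V (h + g) = (\<lambda>z. V h z + V g z)) \<and>
     (\<forall>c h. V (c *\<^sub>C h) = (\<lambda>z. c *\<^sub>C V h z)) \<and>
     (\<forall>h. hardy_norm m (V h) = norm h)"

definition hardy_isometry ::
  "'e::chilbert_space set \<Rightarrow> nat \<Rightarrow> (((nat \<Rightarrow> complex) \<Rightarrow> 'e) \<Rightarrow> ((nat \<Rightarrow> complex) \<Rightarrow> 'e)) \<Rightarrow> bool" where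
  "hardy_isometry E m V \<longleftrightarrow>
     (\<forall>f\<in>hardy E m. V f \<in> hardy E m) \<and>
     (\<forall>f\<in>hardy E m. \<forall>g\<in>hardy E m. V (\<lambda>z. f z + g z) = (\<lambda>z. V f z + V g z)) \<and>
     (\<forall>c. \<forall>f\<in>hardy E m. V (\<lambda>z. c *\<^sub>C f z) = (\<lambda>z. c *\<^sub>C V f z)) \<and>
     (\<forall>f\<in>hardy E m. hardy_norm m (V f) = hardy_norm m f)"

definition mult_op ::
  "nat \<Rightarrow> ((nat \<Rightarrow> complex) \<Rightarrow> 'e \<Rightarrow> 'e::chilbert_space) \<Rightarrow>
   ((nat \<Rightarrow> complex) \<Rightarrow> 'e) \<Rightarrow> ((nat \<Rightarrow> complex) \<Rightarrow> 'e)" where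
  "mult_op m \<Phi> f = (\<lambda>z. if z \<in> polydisc m then \<Phi> z (f z) else 0)"

definition mult_coord ::
  "nat \<Rightarrow> nat \<Rightarrow> ((nat \<Rightarrow> complex) \<Rightarrow> 'e::chilbert_space) \<Rightarrow> ((nat \<Rightarrow> complex) \<Rightarrow> 'e)" where
  "mult_coord m i = mult_op m (\<lambda>z x. z i *\<^sub>C x)"

text \<open>
  Bounded analytic functions with values in the bounded operators on \<open>E\<close>: analyticity means
  that the function is the sum of a power series with operator coefficients, unconditionally
  convergent in operator norm at each point of the polydisc.
\<close>

definition Hinfty :: "'e::chilbert_space set \<Rightarrow> nat \<Rightarrow> ((nat \<Rightarrow> complex) \<Rightarrow> 'e \<Rightarrow> 'e) set" where
  "Hinfty E m = {\<Phi>.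
     (\<forall>z\<in>polydisc m. \<Phi> z \<in> bounded_ops E) \<and>
     (\<exists>C. \<forall>z\<in>polydisc m. onorm_on E (\<Phi> z) \<le> C) \<and>
     (\<exists>A. (\<forall>k\<in>multi_indices m. A k \<in> bounded_ops E) \<and>
        (\<forall>z\<in>polydisc m.
          ((\<lambda>F. onorm_on E (\<lambda>x. \<Phi> z x - (\<Sum>k\<in>F. monom_at m z k *\<^sub>C A k x))) \<longlongrightarrow> 0)
            (finite_subsets_at_top (multi_indices m))))}"

definition inner_function ::
  "'e::chilbert_space set \<Rightarrow> nat \<Rightarrow> ((nat \<Rightarrow> complex) \<Rightarrow> 'e \<Rightarrow> 'e) \<Rightarrow> bool" where
  "inner_function E m \<Phi> \<longleftrightarrow> \<Phi> \<in> Hinfty E m \<and> hardy_isometry E m (mult_op m \<Phi>)"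

definition polynomial_in_coord ::
  "'e::chilbert_space set \<Rightarrow> nat \<Rightarrow> nat \<Rightarrow> nat \<Rightarrow> ((nat \<Rightarrow> complex) \<Rightarrow> 'e \<Rightarrow> 'e) \<Rightarrow> bool" where
  "polynomial_in_coord E m p d \<Phi> \<longleftrightarrow>
     (\<exists>A. (\<forall>j\<le>d. A j \<in> bounded_ops E) \<and>
        (\<forall>z\<in>polydisc m. \<forall>x\<in>E. \<Phi> z x = (\<Sum>j\<le>d. z p ^ j *\<^sub>C A j x)))"

definition commuting_hardy_isometries ::
  "'e::chilbert_space set \<Rightarrow> nat \<Rightarrow> nat \<Rightarrow>
   (nat \<Rightarrow> ((nat \<Rightarrow> complex) \<Rightarrow> 'e) \<Rightarrow> ((nat \<Rightarrow> complex) \<Rightarrow> 'e)) \<Rightarrow> bool" where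
  "commuting_hardy_isometries E m n V \<longleftrightarrow>
     (\<forall>i\<in>{1..n}. hardy_isometry E m (V i)) \<and>
     (\<forall>i\<in>{1..n}. \<forall>j\<in>{1..n}. \<forall>f\<in>hardy E m. V i (V j f) = V j (V i f))"

text \<open>Dilation of an \<open>n\<close>-tuple to an \<open>n\<close>-tuple of commuting isometries on the Hardy space.\<close>

definition dilates_to_via ::
  "'e::chilbert_space set \<Rightarrow> nat \<Rightarrow> nat \<Rightarrow> (nat \<Rightarrow> 'h::chilbert_space \<Rightarrow> 'h) \<Rightarrow>
   (nat \<Rightarrow> ((nat \<Rightarrow> complex) \<Rightarrow> 'e) \<Rightarrow> ((nat \<Rightarrow> complex) \<Rightarrow> 'e)) \<Rightarrow>
   ('h \<Rightarrow> (nat \<Rightarrow> complex) \<Rightarrow> 'e) \<Rightarrow> bool" where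
  "dilates_to_via E m n T V \<Pi>\<^sub>0 \<longleftrightarrow>
     commuting_hardy_isometries E m n V \<and> isometry_to_hardy E m \<Pi>\<^sub>0 \<and>
     (\<forall>i\<in>{1..n}. \<forall>h. \<Pi>\<^sub>0 (cadjoint (T i) h) = hardy_adjoint E m (V i) (\<Pi>\<^sub>0 h))"

end

theory Submission
  imports Defs
begin

text \<open>
  Let \<open>R\<^sub>i\<close> be the adjoint of \<open>T\<^sub>i\<close> and let \<open>T'\<close> be the tuple of length \<open>n - 1\<close> in which \<open>T\<^sub>p\<close> is replaced
  by \<open>T\<^sub>p T\<^sub>q\<close> and \<open>T\<^sub>q\<close> is removed. The inverse Szego kernel is a product of commuting operators
  \<open>X \<mapsto> X - T\<^sub>i X T\<^sub>i\<^sup>*\<close>, and \<open>1 - T\<^sub>p T\<^sub>q T\<^sub>q\<^sup>* T\<^sub>p\<^sup>*\<close> can be written both as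
  \<open>(1 - T\<^sub>p T\<^sub>p\<^sup>*) + T\<^sub>p (1 - T\<^sub>q T\<^sub>q\<^sup>*) T\<^sub>p\<^sup>*\<close> and with \<open>p\<close> and \<open>q\<close> exchanged. Hence, if \<open>\<sigma>\<^sub>p\<close> and \<open>\<sigma>\<^sub>q\<close> denote
  the quadratic forms of the inverse Szego kernels of the tuples without \<open>T\<^sub>p\<close> and without \<open>T\<^sub>q\<close>,
  the form \<open>\<sigma>\<close> of \<open>T'\<close> satisfies
  \<open>\<sigma> h = \<sigma>\<^sub>q h + \<sigma>\<^sub>p (R\<^sub>p h) = \<sigma>\<^sub>q (R\<^sub>q h) + \<sigma>\<^sub>p h\<close>.
  The forms \<open>\<sigma>\<^sub>p\<close> and \<open>\<sigma>\<^sub>q\<close> are positive, so \<open>\<sigma>\<^sub>p h = (norm (d\<^sub>p h))^2\<close> and \<open>\<sigma>\<^sub>q h = (norm (d\<^sub>q h))^2\<close> for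
  linear maps \<open>d\<^sub>p\<close> and \<open>d\<^sub>q\<close> (\<open>positive_op_factor\<close>). Then \<open>v h = (d\<^sub>q h, d\<^sub>p (R\<^sub>p h))\<close> and
  \<open>w h = (d\<^sub>q (R\<^sub>q h), d\<^sub>p h)\<close> have the same norm, whose square is \<open>\<sigma> h\<close>.

  Two things follow. First, \<open>T'\<close> has a positive inverse Szego kernel and inherits purity
  from the tuple without \<open>T\<^sub>p\<close>, so \<open>h \<mapsto> \<Sum>\<^sub>k z^k v (R'^k h)\<close> is an isometry into the Hardy space
  that intertwines the adjoints of the entries of \<open>T'\<close> with the adjoints of the coordinate
  multiplications: the box sums of \<open>\<sigma> (R'^k h)\<close> telescope to \<open>(norm h)^2\<close>
  (\<open>sum_box_fold_diff_along\<close>, \<open>fold_diff_along_powers_tendsto\<close>).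

  Second, after enlarging the coefficient space there is a unitary operator \<open>U\<close> with
  \<open>U (v h) = w h\<close> for all \<open>h\<close> (\<open>unitary_between\<close>). Let \<open>P\<close> be the projection onto the first component
  of the pair and \<open>P' = 1 - P\<close>. Comparing components of \<open>v\<close> and \<open>w\<close> gives
  \<open>U (v (R\<^sub>p h)) = P' (v h) + P (v (R\<^sub>p R\<^sub>q h))\<close> and \<open>v (R\<^sub>q h) = P U (v h) + P' U (v (R\<^sub>p R\<^sub>q h))\<close>,
  which are the coefficientwise intertwining relations for
  \<open>\<Phi>\<^sub>p = (P' + z\<^sub>p P) U\<close> and \<open>\<Phi>\<^sub>q = U\<^sup>* (P + z\<^sub>p P')\<close>.
  These pencils are inner and both of their products are \<open>z\<^sub>p\<close>, as in the
  Berger-Coburn-Lebow description of commuting isometries with a given product.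

  The coefficient space is the whole space of square-summable sequences in \<open>H\<close>. It is
  isomorphic to the orthogonal sum of two copies of itself, which provides room for the pair
  \<open>(d\<^sub>q h, d\<^sub>p h)\<close> and for the enlargement that makes \<open>U\<close> unitary.
\<close>

section \<open>Bounded operators on complex Hilbert spaces\<close>

lemma scaleC_one [simp]: "1 *\<^sub>C x = (x::'a::complex_inner)"
  using scaleC_of_real[of 1 x] by simp

lemma scaleC_zero_left [simp]: "0 *\<^sub>C x = (0::'a::complex_inner)"
  using scaleC_of_real[of 0 x] by simp

lemma scaleC_zero_right [simp]: "c *\<^sub>C (0::'a::complex_inner) = 0"
  using scaleC_add_right[of c 0 0] by simp

lemma scaleC_scaleR: "c *\<^sub>C (r *\<^sub>R x) = r *\<^sub>R (c *\<^sub>C (x::'a::complex_inner))"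
  by (simp add: scaleC_of_real[symmetric] scaleC_scaleC mult.commute)

lemma bounded_linear_scaleC_right: "bounded_linear (\<lambda>x::'a::complex_inner. c *\<^sub>C x)"
  by (rule bounded_linear_intro[where K = "cmod c"])
     (auto simp: scaleC_add_right scaleC_scaleR norm_scaleC mult.commute)

lemma cinner_add_right: "cinner x (y + z) = cinner x y + cinner (x::'a::complex_inner) z"
  by (metis cinner_add_left cinner_commute complex_cnj_add)

lemma cinner_scaleC_right: "cinner x (c *\<^sub>C y) = cnj c * cinner (x::'a::complex_inner) y"
  by (metis cinner_commute cinner_scaleC_left complex_cnj_mult)

lemma cinner_zero_left [simp]: "cinner 0 (x::'a::complex_inner) = 0"
  using cinner_add_left[of 0 0 x] by simp

lemma cinner_zero_right [simp]: "cinner (x::'a::complex_inner) 0 = 0"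
  using cinner_add_right[of x 0 0] by simp

lemma cinner_minus_left: "cinner (- x) y = - cinner x (y::'a::complex_inner)"
  using cinner_add_left[of x "- x" y] by (simp add: add_eq_0_iff)

lemma cinner_minus_right: "cinner x (- y) = - cinner x (y::'a::complex_inner)"
  using cinner_add_right[of x y "- y"] by (simp add: add_eq_0_iff)

lemma cinner_diff_left: "cinner (x - y) z = cinner x z - cinner y (z::'a::complex_inner)"
  using cinner_add_left[of x "- y" z] by (simp add: cinner_minus_left)

lemma cinner_diff_right: "cinner z (x - y) = cinner z x - cinner (z::'a::complex_inner) y"
  using cinner_add_right[of z x "- y"] by (simp add: cinner_minus_right)

lemma cinner_scaleR_left: "cinner (r *\<^sub>R x) y = r * cinner x (y::'a::complex_inner)"
  by (simp add: scaleC_of_real[symmetric] cinner_scaleC_left)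

lemma cinner_scaleR_right: "cinner x (r *\<^sub>R y) = r * cinner x (y::'a::complex_inner)"
  by (simp add: scaleC_of_real[symmetric] cinner_scaleC_right)

lemma Im_cinner: "Im (cinner x y) = inner ((- \<i>) *\<^sub>C x) (y::'a::complex_inner)"
  by (simp add: Re_cinner[symmetric] cinner_scaleC_left)

lemma cinner_eqI:
  assumes "\<And>x. cinner x u = cinner x (v::'a::complex_inner)"
  shows "u = v"
proof -
  have "cinner (u - v) (u - v) = 0"
    using assms by (simp add: cinner_diff_right)
  then show ?thesis by (simp add: cinner_self)
qed

lemma norm_cinner_le: "cmod (cinner x y) \<le> norm x * norm (y::'a::complex_inner)"
proof -
  define c where "c = cnj (sgn (cinner x y))"
  have c: "cmod c \<le> 1" by (simp add: c_def norm_sgn)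
  have "c * cinner x y = cmod (cinner x y)"
    by (cases "cinner x y = 0")
       (auto simp: c_def sgn_eq complex_norm_square[symmetric] power2_eq_square
         mult.commute[of "cnj _"])
  then have "cmod (cinner x y) = inner (c *\<^sub>C x) y"
    by (metis Re_cinner Re_complex_of_real cinner_scaleC_left)
  also have "\<dots> \<le> norm (c *\<^sub>C x) * norm y" by (rule norm_cauchy_schwarz)
  also have "\<dots> \<le> norm x * norm y"
    using c by (simp add: norm_scaleC mult_left_le_one_le mult_right_mono)
  finally show ?thesis .
qed

lemma bounded_linear_cinner_left: "bounded_linear (\<lambda>x. cinner x (y::'a::complex_inner))"
  by (rule bounded_linear_intro[where K = "norm y"])
     (auto simp: cinner_add_left cinner_scaleR_left norm_cinner_le scaleR_conv_of_real)

definition bounded_clinear :: "('a::complex_inner \<Rightarrow> 'b::complex_inner) \<Rightarrow> bool" where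
  "bounded_clinear f \<longleftrightarrow> (\<forall>x y. f (x + y) = f x + f y) \<and> (\<forall>c x. f (c *\<^sub>C x) = c *\<^sub>C f x) \<and>
     (\<exists>C. \<forall>x. norm (f x) \<le> C * norm x)"

lemma bounded_ops_UNIV: "A \<in> bounded_ops UNIV \<longleftrightarrow> bounded_clinear A"
  by (simp add: bounded_ops_def bounded_clinear_def)

lemma bounded_clinear_add: "bounded_clinear f \<Longrightarrow> f (x + y) = f x + f y"
  and bounded_clinear_scaleC: "bounded_clinear f \<Longrightarrow> f (c *\<^sub>C x) = c *\<^sub>C f x"
  by (simp_all add: bounded_clinear_def)

lemma bounded_clinearI:
  assumes "\<And>x y. f (x + y) = f x + f y" "\<And>c x. f (c *\<^sub>C x) = c *\<^sub>C f x"
    "\<And>x. norm (f x) \<le> C * norm x"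
  shows "bounded_clinear f"
  using assms unfolding bounded_clinear_def by blast

lemma bounded_clinear_bounded_linear:
  assumes "bounded_clinear f"
  shows "bounded_linear f"
proof -
  obtain C where "\<And>x. norm (f x) \<le> C * norm x"
    using assms by (auto simp: bounded_clinear_def)
  with assms show ?thesis
    by (intro bounded_linear_intro[where K = C])
       (simp_all add: bounded_clinear_add bounded_clinear_scaleC scaleC_of_real[symmetric] mult.commute)
qed

lemma bounded_clinear_zero: "bounded_clinear f \<Longrightarrow> f 0 = 0"
  by (metis bounded_clinear_bounded_linear linear_simps(3))

lemma bounded_clinear_diff: "bounded_clinear f \<Longrightarrow> f (x - y) = f x - f y"
  by (metis bounded_clinear_bounded_linear linear_simps(2))

lemma bounded_clinear_minus: "bounded_clinear f \<Longrightarrow> f (- x) = - f x"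
  by (metis bounded_clinear_zero bounded_clinear_diff diff_0)

lemma bounded_clinear_comp:
  assumes "bounded_clinear f" "bounded_clinear g"
  shows "bounded_clinear (\<lambda>x. f (g x))"
proof -
  have "bounded_linear (\<lambda>x. f (g x))"
    using assms by (intro bounded_linear_compose[of f g] bounded_clinear_bounded_linear)
  then obtain C where "\<And>x. norm (f (g x)) \<le> norm x * C"
    using bounded_linear.bounded by blast
  with assms show ?thesis
    by (intro bounded_clinearI[where C = C])
       (auto simp: bounded_clinear_add bounded_clinear_scaleC mult.commute)
qed

lemma bounded_clinear_plus:
  assumes "bounded_clinear f" "bounded_clinear g"
  shows "bounded_clinear (\<lambda>x. f x + g x)"
proof -
  have "bounded_linear (\<lambda>x. f x + g x)"
    using assms by (intro bounded_linear_add bounded_clinear_bounded_linear)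
  then obtain C where "\<And>x. norm (f x + g x) \<le> norm x * C"
    using bounded_linear.bounded by blast
  with assms show ?thesis
    by (intro bounded_clinearI[where C = C])
       (auto simp: bounded_clinear_add bounded_clinear_scaleC scaleC_add_right mult.commute)
qed

lemma bounded_clinear_ident: "bounded_clinear (\<lambda>x. x)"
  by (rule bounded_clinearI[where C = 1]) auto

lemma bounded_clinear_const_zero: "bounded_clinear (\<lambda>x. 0)"
  by (rule bounded_clinearI[where C = 1]) auto

lemma bounded_clinear_scaleC_right: "bounded_clinear (\<lambda>x. c *\<^sub>C x)"
  by (rule bounded_clinearI[where C = "cmod c"])
     (auto simp: scaleC_add_right scaleC_scaleC norm_scaleC mult.commute)

lemma bounded_clinear_scaleR: "bounded_clinear f \<Longrightarrow> bounded_clinear (\<lambda>x. r *\<^sub>R f x)"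
  using bounded_clinear_comp[OF bounded_clinear_scaleC_right[of "complex_of_real r"], of f]
  by (simp add: scaleC_of_real)

lemma bounded_clinear_minus_fun:
  assumes "bounded_clinear f" "bounded_clinear g"
  shows "bounded_clinear (\<lambda>x. f x - g x)"
  using bounded_clinear_plus[OF assms(1) bounded_clinear_scaleR[OF assms(2), of "-1"]] by simp

lemma bounded_clinear_sum:
  assumes "finite I" "\<And>i. i \<in> I \<Longrightarrow> bounded_clinear (f i)"
  shows "bounded_clinear (\<lambda>x. \<Sum>i\<in>I. f i x)"
  using assms
  by (induction I rule: finite_induct)
     (auto intro: bounded_clinear_plus bounded_clinear_const_zero)

text \<open>
  Polarization; the imaginary part is the real part at \<open>-\<i> h\<close>.
\<close>

lemma cinner_eq_of_norm_eq:
  fixes v :: "'a::complex_inner \<Rightarrow> 'b::complex_inner" and w :: "'a \<Rightarrow> 'c::complex_inner"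
  assumes v: "bounded_clinear v" and w: "bounded_clinear w"
    and eq: "\<And>h. norm (v h) = norm (w h)"
  shows "cinner (v h) (v g) = cinner (w h) (w g)"
proof -
  have re: "inner (v h) (v g) = inner (w h) (w g)" for h g
    using eq[of "h + g"] eq[of h] eq[of g]
    by (simp add: bounded_clinear_add[OF v] bounded_clinear_add[OF w] norm_eq_sqrt_inner
        inner_add_left inner_add_right inner_commute)
  show ?thesis
    by (rule complex_eqI)
       (use re[of h g] re[of "(- \<i>) *\<^sub>C h" g] in \<open>simp_all add: Re_cinner Im_cinner
         bounded_clinear_scaleC[OF v] bounded_clinear_scaleC[OF w]\<close>)
qed

text \<open>
  A form of the Riesz representation theorem in which the functional lives on the domain of a
  linear map \<open>v\<close> and is bounded by the seminorm \<open>norm (v h)\<close>. With \<open>v\<close> the identity it gives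
  adjoints; in general it inverts \<open>v\<close> in the weak sense, which is how the operator carrying
  \<open>v h\<close> to \<open>w h\<close> is found below. The representing vector is the limit of \<open>v h\<^sub>n\<close> along a
  minimizing sequence of \<open>norm (v h)^2 - 2 Re (\<phi> h)\<close>, Cauchy by the parallelogram law.
\<close>

lemma riesz_along_map:
  fixes v :: "'a::complex_inner \<Rightarrow> 'e::chilbert_space" and \<phi> :: "'a \<Rightarrow> complex"
  assumes v: "bounded_clinear v"
    and add: "\<And>g h. \<phi> (g + h) = \<phi> g + \<phi> h"
    and scale: "\<And>c h. \<phi> (c *\<^sub>C h) = c * \<phi> h"
    and bound: "\<And>h. cmod (\<phi> h) \<le> C * norm (v h)"
  obtains u where "u \<in> closure (range v)" and "\<And>h. \<phi> h = cinner (v h) u"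
proof -
  define J where "J h = (norm (v h))\<^sup>2 - 2 * Re (\<phi> h)" for h
  have vR: "v (r *\<^sub>R h) = r *\<^sub>R v h" for r h
    using bounded_clinear_scaleC[OF v, of "complex_of_real r" h] by (simp add: scaleC_of_real)
  have pR: "\<phi> (r *\<^sub>R h) = r * \<phi> h" for r h
    using scale[of "complex_of_real r" h] by (simp add: scaleC_of_real)
  have bdd: "bdd_below (range J)"
  proof (rule bdd_belowI2)
    fix h
    have "Re (\<phi> h) \<le> C * norm (v h)"
      using bound[of h] complex_Re_le_cmod[of "\<phi> h"] by linarith
    moreover have "0 \<le> (norm (v h) - C)\<^sup>2" by simp
    ultimately show "- (C\<^sup>2) \<le> J h"
      unfolding J_def power2_diff by (simp add: mult.commute mult.left_commute)
  qed
  define m where "m = Inf (range J)"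
  have mle: "m \<le> J h" for h unfolding m_def by (rule cINF_lower[OF bdd]) simp
  have "\<exists>h. J h < m + inverse (real (Suc k))" for k
  proof -
    have "Inf (range J) < m + inverse (real (Suc k))" by (simp add: m_def)
    then show ?thesis using cInf_less_iff[OF _ bdd] by auto
  qed
  then obtain h where h: "\<And>k. J (h k) < m + inverse (real (Suc k))" by metis
  have Jlim: "(\<lambda>k. J (h k)) \<longlonglongrightarrow> m"
  proof (rule real_tendsto_sandwich)
    show "\<forall>\<^sub>F k in sequentially. m \<le> J (h k)" using mle by simp
    show "\<forall>\<^sub>F k in sequentially. J (h k) \<le> m + inverse (real (Suc k))"
      using h by (simp add: less_imp_le)
    show "(\<lambda>k. m + inverse (real (Suc k))) \<longlonglongrightarrow> m"
      using tendsto_add[OF tendsto_const LIMSEQ_inverse_real_of_nat] by simp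
  qed simp
  have para: "(norm (v f - v g))\<^sup>2 \<le> 2 * (J f - m) + 2 * (J g - m)" for f g
  proof -
    have "4 * J ((1/2) *\<^sub>R (f + g)) = (norm (v f + v g))\<^sup>2 - 4 * Re (\<phi> f) - 4 * Re (\<phi> g)"
      by (simp add: J_def vR pR add bounded_clinear_add[OF v] power_mult_distrib)
         (simp add: field_simps)
    moreover have "(norm (v f - v g))\<^sup>2 + (norm (v f + v g))\<^sup>2 = 2 * (norm (v f))\<^sup>2 + 2 * (norm (v g))\<^sup>2"
      by (simp add: power2_norm_eq_inner inner_add_left inner_add_right inner_diff_left
          inner_diff_right inner_commute)
    moreover have "m \<le> J ((1/2) *\<^sub>R (f + g))" by (rule mle)
    moreover have "J f = (norm (v f))\<^sup>2 - 2 * Re (\<phi> f)" "J g = (norm (v g))\<^sup>2 - 2 * Re (\<phi> g)"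
      by (simp_all add: J_def)
    ultimately show ?thesis by argo
  qed
  have "Cauchy (\<lambda>k. v (h k))"
  proof (rule CauchyI)
    fix e :: real assume e: "0 < e"
    then have "\<forall>\<^sub>F k in sequentially. J (h k) < m + e\<^sup>2/4"
      by (intro order_tendstoD(2)[OF Jlim]) simp
    then obtain M where M: "\<And>k. k \<ge> M \<Longrightarrow> J (h k) < m + e\<^sup>2/4"
      using eventually_sequentially by auto
    have "norm (v (h k) - v (h l)) < e" if "k \<ge> M" "l \<ge> M" for k l
    proof (rule power2_less_imp_less)
      show "(norm (v (h k) - v (h l)))\<^sup>2 < e\<^sup>2"
        using para[of "h k" "h l"] M[OF that(1)] M[OF that(2)] by simp
    qed (use e in simp)
    then show "\<exists>M. \<forall>k\<ge>M. \<forall>l\<ge>M. norm (v (h k) - v (h l)) < e" by blast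
  qed
  then obtain u where u: "(\<lambda>k. v (h k)) \<longlonglongrightarrow> u"
    using Cauchy_convergent_iff convergent_def by blast
  have re: "inner (v g) u = Re (\<phi> g)" for g
  proof -
    define a b where "a = (norm (v g))\<^sup>2" and "b = inner u (v g) - Re (\<phi> g)"
    have quad: "0 \<le> t\<^sup>2 * a + 2 * t * b" for t
    proof -
      have "m \<le> J (h k) + (t\<^sup>2 * a + 2 * t * (inner (v (h k)) (v g) - Re (\<phi> g)))" for k
      proof -
        have "J (h k + t *\<^sub>R g) = J (h k) + (t\<^sup>2 * a + 2 * t * (inner (v (h k)) (v g) - Re (\<phi> g)))"
          unfolding J_def a_def vR pR add bounded_clinear_add[OF v] power2_norm_eq_inner
          by (simp add: inner_add_left inner_add_right inner_commute algebra_simps power2_eq_square)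
        then show ?thesis using mle[of "h k + t *\<^sub>R g"] by simp
      qed
      moreover have "(\<lambda>k. J (h k) + (t\<^sup>2 * a + 2 * t * (inner (v (h k)) (v g) - Re (\<phi> g))))
          \<longlonglongrightarrow> m + (t\<^sup>2 * a + 2 * t * b)"
        unfolding b_def by (intro tendsto_intros Jlim u)
      ultimately have "m \<le> m + (t\<^sup>2 * a + 2 * t * b)"
        using LIMSEQ_le_const by blast
      then show ?thesis by simp
    qed
    have a0: "a \<ge> 0" by (simp add: a_def)
    define t where "t = - b / (a + 1)"
    have bt: "b = - (t * (a + 1))" using a0 by (simp add: t_def)
    have "0 \<le> - (t\<^sup>2 * (a + 2))"
      using quad[of t] unfolding bt by (simp add: algebra_simps power2_eq_square)
    then have "t = 0" using a0 by (simp add: mult_le_0_iff)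
    then have "b = 0" using bt by simp
    then show ?thesis by (simp add: b_def inner_commute)
  qed
  show thesis
  proof (rule that)
    show "u \<in> closure (range v)"
      unfolding closure_sequential by (intro exI[of _ "\<lambda>k. v (h k)"]) (simp add: u)
    fix g
    show "\<phi> g = cinner (v g) u"
    proof (rule complex_eqI)
      show "Re (\<phi> g) = Re (cinner (v g) u)" by (simp add: re Re_cinner)
      show "Im (\<phi> g) = Im (cinner (v g) u)"
        using re[of "(- \<i>) *\<^sub>C g"] by (simp add: scale bounded_clinear_scaleC[OF v] Im_cinner)
    qed
  qed
qed

lemma cadjoint:
  fixes A :: "'h::chilbert_space \<Rightarrow> 'h"
  assumes A: "bounded_clinear A"
  shows "cinner (A x) y = cinner x (cadjoint A y)"
proof -
  obtain C where C: "\<And>x. norm (A x) \<le> C * norm x"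
    using A by (auto simp: bounded_clinear_def)
  obtain u where u: "\<And>x. cinner (A x) y = cinner x u"
  proof (rule riesz_along_map[OF bounded_clinear_ident, of "\<lambda>x. cinner (A x) y" "C * norm y"])
    fix h
    have "cmod (cinner (A h) y) \<le> norm (A h) * norm y" by (rule norm_cinner_le)
    also have "\<dots> \<le> C * norm h * norm y" by (intro mult_right_mono C) simp
    finally show "cmod (cinner (A h) y) \<le> C * norm y * norm h" by (simp add: algebra_simps)
  qed (auto simp: bounded_clinear_add[OF A] bounded_clinear_scaleC[OF A] cinner_add_left
      cinner_scaleC_left)
  have "cadjoint A y = u"
    unfolding cadjoint_def adjoint_on_def
  proof (rule the_equality)
    fix u' assume "u' \<in> UNIV \<and> (\<forall>x\<in>UNIV. cinner (A x) y = cinner x u')"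
    then have "cinner x u' = cinner x u" for x using u[of x] by (metis UNIV_I)
    then show "u' = u" by (rule cinner_eqI)
  next
    show "u \<in> UNIV \<and> (\<forall>x\<in>UNIV. cinner (A x) y = cinner x u)" using u by blast
  qed
  then show ?thesis using u[of x] by argo
qed

lemma cadjoint': "bounded_clinear A \<Longrightarrow> cinner (cadjoint A x) y = cinner x (A y)"
  unfolding cinner_commute[of "cadjoint A x" y] cinner_commute[of x "A y"] by (simp add: cadjoint)

lemma bounded_clinear_of_adjoint:
  fixes A :: "'a::complex_inner \<Rightarrow> 'b::complex_inner"
  assumes adj: "\<And>x y. cinner (A x) y = cinner x (B y)" and C: "\<And>x. norm (A x) \<le> C * norm x"
    and nonneg: "0 \<le> C"
  shows "bounded_clinear B" and "norm (B y) \<le> C * norm y"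
proof -
  show bd: "norm (B y) \<le> C * norm y" for y
  proof (cases "B y = 0")
    case True
    then show ?thesis using nonneg by simp
  next
    case False
    have "complex_of_real ((norm (B y))\<^sup>2) = cinner (A (B y)) y"
      by (simp add: cinner_self adj)
    then have "(norm (B y))\<^sup>2 = cmod (cinner (A (B y)) y)"
      by (metis abs_power2 norm_of_real)
    also have "\<dots> \<le> norm (A (B y)) * norm y" by (rule norm_cinner_le)
    also have "\<dots> \<le> C * norm (B y) * norm y" by (intro mult_right_mono C) simp
    finally show ?thesis using False by (simp add: power2_eq_square)
  qed
  show "bounded_clinear B"
    by (rule bounded_clinearI[OF _ _ bd]; rule cinner_eqI)
       (simp_all add: adj[symmetric] cinner_add_right cinner_scaleC_right)
qed

section \<open>Factorization of positive operators\<close>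

lemma positive_imp_selfadjoint:
  fixes S :: "'h::complex_inner \<Rightarrow> 'h"
  assumes S: "bounded_clinear S" and pos: "\<And>h. Im (cinner (S h) h) = 0"
  shows "cinner (S x) y = cinner x (S y)"
proof -
  have sym: "Im (cinner (S x) y) + Im (cinner (S y) x) = 0" for x y
    using pos[of "x + y"] pos[of x] pos[of y]
    by (simp add: bounded_clinear_add[OF S] cinner_add_left cinner_add_right)
  have im: "Im (cinner (S y) x) = - Im (cinner x (S y))" for x y
    by (subst cinner_commute) simp
  have re: "Re (cinner (S y) x) = Re (cinner x (S y))" for x y
    by (subst cinner_commute) simp
  show ?thesis
  proof (rule complex_eqI)
    show "Im (cinner (S x) y) = Im (cinner x (S y))"
      using sym[of x y] im[of y x] by simp
    show "Re (cinner (S x) y) = Re (cinner x (S y))"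
      using sym[of x "\<i> *\<^sub>C y"] re[of y x]
      by (simp add: bounded_clinear_scaleC[OF S] cinner_scaleC_left cinner_scaleC_right)
  qed
qed

definition positive_contraction :: "('h::complex_inner \<Rightarrow> 'h) \<Rightarrow> bool" where
  "positive_contraction S \<longleftrightarrow> bounded_clinear S \<and> (\<forall>x y. cinner (S x) y = cinner x (S y)) \<and>
     (\<forall>h. 0 \<le> inner (S h) h \<and> inner (S h) h \<le> (norm h)\<^sup>2)"

lemma selfadjoint_inner: "(\<And>x y. cinner (S x) y = cinner x (S y)) \<Longrightarrow> inner (S x) y = inner x (S y)"
  by (metis Re_cinner)

text \<open>
  Positivity at the vector \<open>h - S h\<close>; the bound \<open>S \<le> 1\<close> controls the cubic term. This is what
  keeps \<open>S - S\<^sup>2\<close> positive.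
\<close>

lemma positive_contraction_norm_le:
  assumes "positive_contraction S"
  shows "(norm (S h))\<^sup>2 \<le> inner (S h) h"
proof -
  have S: "bounded_clinear S" and sa: "\<And>x y. inner (S x) y = inner x (S y)"
    and pos: "\<And>h. 0 \<le> inner (S h) h" and le: "\<And>h. inner (S h) h \<le> (norm h)\<^sup>2"
    using assms by (auto simp: positive_contraction_def intro: selfadjoint_inner)
  have "0 \<le> inner (S (h - S h)) (h - S h)" by (rule pos)
  also have "\<dots> = inner (S h) h - 2 * (norm (S h))\<^sup>2 + inner (S (S h)) (S h)"
    using sa[of "S h" h] by (simp add: bounded_clinear_diff[OF S] inner_diff_left inner_diff_right power2_norm_eq_inner inner_commute)
  also have "\<dots> \<le> inner (S h) h - (norm (S h))\<^sup>2"
    using le[of "S h"] by simp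
  finally show ?thesis by simp
qed

lemma positive_contraction_step:
  assumes "positive_contraction S"
  shows "positive_contraction (\<lambda>h. S h - S (S h))"
proof -
  have S: "bounded_clinear S" and sa: "\<And>x y. cinner (S x) y = cinner x (S y)"
    and pos: "\<And>h. 0 \<le> inner (S h) h" and le: "\<And>h. inner (S h) h \<le> (norm h)\<^sup>2"
    using assms by (auto simp: positive_contraction_def)
  have SS: "inner (S (S h)) h = (norm (S h))\<^sup>2" for h
    using sa by (metis Re_cinner power2_norm_eq_inner)
  have "0 \<le> inner (S h - S (S h)) h \<and> inner (S h - S (S h)) h \<le> (norm h)\<^sup>2" for h
    using positive_contraction_norm_le[OF assms, of h] le[of h]
    by (simp add: inner_diff_left SS) (smt (verit) zero_le_power2)
  moreover have "bounded_clinear (\<lambda>h. S h - S (S h))"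
    by (intro bounded_clinear_minus_fun bounded_clinear_comp[of S S] S)
  ultimately show ?thesis
    by (simp add: positive_contraction_def cinner_diff_left cinner_diff_right sa)
qed

text \<open>
  Squares are peeled off greedily: with \<open>S\<^sub>0 = S\<close> and \<open>S\<^sub>i\<^sub>+\<^sub>1 = S\<^sub>i - S\<^sub>i\<^sup>2\<close> the partial sums of
  \<open>norm (S\<^sub>i h)^2\<close> are \<open>inner (S h) h - inner (S\<^sub>N h) h\<close>. They are bounded, so \<open>S\<^sub>N h\<close> tends to \<open>0\<close> and the
  series sums to \<open>inner (S h) h\<close>. The sequence \<open>d h = (S\<^sub>0 h, S\<^sub>1 h, \<dots>)\<close> thus plays the role of
  the square root of \<open>S\<close> applied to \<open>h\<close>.
\<close>

lemma positive_contraction_factor: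
  fixes S :: "'h::complex_inner \<Rightarrow> 'h"
  assumes "positive_contraction S"
  obtains d :: "'h \<Rightarrow> 'h ell2" where "bounded_clinear d" "\<And>h. (norm (d h))\<^sup>2 = inner (S h) h"
proof -
  define s where "s i = ((\<lambda>R h. R h - R (R h)) ^^ i) S" for i
  have s0: "s 0 = S" and sSuc: "s (Suc i) h = s i h - s i (s i h)" for i h
    by (simp_all add: s_def)
  have pc: "positive_contraction (s i)" for i
  proof (induction i)
    case (Suc i)
    then show ?case
      using positive_contraction_step[OF Suc] sSuc[of i, abs_def] by simp
  qed (simp add: s0 assms)
  have lin: "bounded_clinear (s i)" for i using pc by (simp add: positive_contraction_def)
  have sa: "inner (s i (s i h)) h = (norm (s i h))\<^sup>2" for i h
    using pc[of i] by (metis Re_cinner power2_norm_eq_inner positive_contraction_def)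
  have part: "(\<Sum>i<N. (norm (s i h))\<^sup>2) = inner (S h) h - inner (s N h) h" for N h
    by (induction N) (simp_all add: s0 sSuc inner_diff_left sa)
  have summ: "summable (\<lambda>i. (norm (s i h))\<^sup>2)" for h
  proof (rule summableI_nonneg_bounded[where x = "inner (S h) h"])
    show "(\<Sum>i<N. (norm (s i h))\<^sup>2) \<le> inner (S h) h" for N
      using part[of h N] pc[of N] by (simp add: positive_contraction_def)
  qed simp
  have lim: "(\<lambda>N. inner (s N h) h) \<longlonglongrightarrow> 0" for h
  proof -
    have "(\<lambda>N. (norm (s N h))\<^sup>2) \<longlonglongrightarrow> 0" by (rule summable_LIMSEQ_zero[OF summ])
    then have "(\<lambda>N. sqrt ((norm (s N h))\<^sup>2)) \<longlonglongrightarrow> sqrt 0" by (rule tendsto_real_sqrt)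
    then have "(\<lambda>N. s N h) \<longlonglongrightarrow> 0" by (simp add: tendsto_norm_zero_iff)
    then have "(\<lambda>N. inner (s N h) h) \<longlonglongrightarrow> inner 0 h" by (intro tendsto_intros)
    then show ?thesis by simp
  qed
  have "(\<lambda>N. \<Sum>i<N. (norm (s i h))\<^sup>2) \<longlonglongrightarrow> inner (S h) h - 0" for h
    unfolding part by (intro tendsto_intros lim)
  then have sum: "(\<Sum>i. (norm (s i h))\<^sup>2) = inner (S h) h" for h
    by (metis diff_zero sums_def sums_unique)
  define d where "d h = Abs_ell2 (\<lambda>i. s i h)" for h
  have nth: "ell2_nth (d h) i = s i h" for h i
    unfolding d_def by (subst Abs_ell2_inverse) (simp_all add: summ)
  have norm: "(norm (d h))\<^sup>2 = inner (S h) h" for h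
    by (simp add: ell2_power2_norm nth sum)
  have "bounded_clinear d"
  proof (rule bounded_clinearI[where C = 1])
    show "d (x + y) = d x + d y" for x y
      by (rule ell2_eqI) (simp add: nth plus_ell2.rep_eq bounded_clinear_add[OF lin])
    show "d (c *\<^sub>C x) = c *\<^sub>C d x" for c x
      by (rule ell2_eqI) (simp add: nth scaleC_ell2.rep_eq bounded_clinear_scaleC[OF lin])
    have "(norm (d x))\<^sup>2 \<le> (norm x)\<^sup>2" for x
      using assms by (simp add: norm positive_contraction_def)
    then show "norm (d x) \<le> 1 * norm x" for x
      using power2_le_imp_le[of "norm (d x)" "norm x"] by simp
  qed
  with norm that show thesis by blast
qed

lemma positive_op_factor:
  fixes S :: "'h::chilbert_space \<Rightarrow> 'h"
  assumes S: "bounded_clinear S" and pos: "positive_op S"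
  obtains d :: "'h \<Rightarrow> 'h ell2" where "bounded_clinear d" "\<And>h. (norm (d h))\<^sup>2 = inner (S h) h"
proof -
  have im: "Im (cinner (S h) h) = 0" and re: "0 \<le> inner (S h) h" for h
    using pos by (auto simp: positive_op_def complex_nonneg_Reals_iff Re_cinner[symmetric])
  obtain C where C: "0 < C" "\<And>x. norm (S x) \<le> norm x * C"
    using bounded_linear.pos_bounded[OF bounded_clinear_bounded_linear[OF S]] by blast
  have "inner (S h) h \<le> C * (norm h)\<^sup>2" for h
  proof -
    have "inner (S h) h \<le> norm (S h) * norm h" by (rule norm_cauchy_schwarz)
    also have "\<dots> \<le> norm h * C * norm h" by (intro mult_right_mono C) simp
    finally show ?thesis by (simp add: power2_eq_square algebra_simps)
  qed
  with C have "positive_contraction (\<lambda>h. (1 / C) *\<^sub>R S h)"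
    using re positive_imp_selfadjoint[OF S im] bounded_clinear_scaleR[OF S]
    by (simp add: positive_contraction_def cinner_scaleR_left cinner_scaleR_right field_simps)
  then obtain d :: "'h \<Rightarrow> 'h ell2" where d: "bounded_clinear d"
      "\<And>h. (norm (d h))\<^sup>2 = inner ((1 / C) *\<^sub>R S h) h"
    using positive_contraction_factor by blast
  show thesis
  proof (rule that)
    show "bounded_clinear (\<lambda>h. sqrt C *\<^sub>R d h)" by (rule bounded_clinear_scaleR[OF d(1)])
    show "(norm (sqrt C *\<^sub>R d h))\<^sup>2 = inner (S h) h" for h
      using C by (simp add: power_mult_distrib d(2))
  qed
qed

section \<open>Extending an isometry to a unitary operator\<close>

text \<open>
  Splitting a sequence into its even and odd entries identifies the sequence space with the
  orthogonal sum of two copies of itself. The two embeddings and their adjoints satisfy the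
  Cuntz relations, which lets operators on the sum be written as block matrices.
\<close>

lift_definition even_in :: "'a::complex_inner ell2 \<Rightarrow> 'a ell2"
  is "\<lambda>x i. if even i then x (i div 2) else 0"
proof -
  fix x :: "nat \<Rightarrow> 'a" assume "summable (\<lambda>i. (norm (x i))\<^sup>2)"
  then have "summable (\<lambda>i. if even i then (norm (x (i div 2)))\<^sup>2 else 0)"
    by (rule sums_summable[OF sums_if[OF sums_zero summable_sums]])
  moreover have "(\<lambda>i. (norm (if even i then x (i div 2) else 0))\<^sup>2) =
      (\<lambda>i. if even i then (norm (x (i div 2)))\<^sup>2 else 0)" by auto
  ultimately show "summable (\<lambda>i. (norm (if even i then x (i div 2) else 0))\<^sup>2)" by simp
qed

lift_definition odd_in :: "'a::complex_inner ell2 \<Rightarrow> 'a ell2"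
  is "\<lambda>x i. if even i then 0 else x ((i - 1) div 2)"
proof -
  fix x :: "nat \<Rightarrow> 'a" assume "summable (\<lambda>i. (norm (x i))\<^sup>2)"
  then have "summable (\<lambda>i. if even i then 0 else (norm (x ((i - 1) div 2)))\<^sup>2)"
    by (rule sums_summable[OF sums_if[OF summable_sums sums_zero]])
  moreover have "(\<lambda>i. (norm (if even i then 0 else x ((i - 1) div 2)))\<^sup>2) =
      (\<lambda>i. if even i then 0 else (norm (x ((i - 1) div 2)))\<^sup>2)" by auto
  ultimately show "summable (\<lambda>i. (norm (if even i then 0 else x ((i - 1) div 2)))\<^sup>2)" by simp
qed

lift_definition even_out :: "'a::complex_inner ell2 \<Rightarrow> 'a ell2" is "\<lambda>x i. x (2 * i)"
proof -
  fix x :: "nat \<Rightarrow> 'a" assume "summable (\<lambda>i. (norm (x i))\<^sup>2)"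
  from summable_reindex[OF this, of "\<lambda>i. 2 * i"]
  show "summable (\<lambda>i. (norm (x (2 * i)))\<^sup>2)" by (simp add: o_def inj_def)
qed

lift_definition odd_out :: "'a::complex_inner ell2 \<Rightarrow> 'a ell2" is "\<lambda>x i. x (2 * i + 1)"
proof -
  fix x :: "nat \<Rightarrow> 'a" assume "summable (\<lambda>i. (norm (x i))\<^sup>2)"
  from summable_reindex[OF this, of "\<lambda>i. 2 * i + 1"]
  show "summable (\<lambda>i. (norm (x (2 * i + 1)))\<^sup>2)" by (simp add: o_def inj_def)
qed

lemma even_out_even_in [simp]: "even_out (even_in x) = x"
  and odd_out_odd_in [simp]: "odd_out (odd_in x) = x"
  and even_out_odd_in [simp]: "even_out (odd_in x) = 0"
  and odd_out_even_in [simp]: "odd_out (even_in x) = 0"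
  by (rule ell2_eqI, simp add: even_out.rep_eq odd_out.rep_eq even_in.rep_eq odd_in.rep_eq
      zero_ell2.rep_eq)+

lemma even_odd_split: "even_in (even_out x) + odd_in (odd_out x) = x"
proof (rule ell2_eqI)
  fix i show "ell2_nth (even_in (even_out x) + odd_in (odd_out x)) i = ell2_nth x i"
    by (cases "even i") (auto simp: plus_ell2.rep_eq even_out.rep_eq odd_out.rep_eq
        even_in.rep_eq odd_in.rep_eq)
qed

lemma cinner_even_in: "cinner (even_in x) y = cinner x (even_out y)"
proof -
  have "(\<lambda>i. cinner (ell2_nth x i) (ell2_nth y (2 * i))) sums cinner x (even_out y)"
    using summable_sums[OF summable_cinner_ell2[of x "even_out y"]]
    by (simp add: cinner_ell2_def even_out.rep_eq)
  then have "(\<lambda>i. cinner (ell2_nth (even_in x) (2 * i)) (ell2_nth y (2 * i))) sums cinner x (even_out y)"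
    by (simp add: even_in.rep_eq)
  then have "(\<lambda>i. cinner (ell2_nth (even_in x) i) (ell2_nth y i)) sums cinner x (even_out y)"
    by (subst (asm) sums_mono_reindex[where g = "\<lambda>i. 2 * i"])
       (auto simp: strict_mono_def even_in.rep_eq elim!: evenE)
  then show ?thesis
    by (simp add: cinner_ell2_def sums_iff)
qed

lemma cinner_odd_in: "cinner (odd_in x) y = cinner x (odd_out y)"
proof -
  have "(\<lambda>i. cinner (ell2_nth x i) (ell2_nth y (2 * i + 1))) sums cinner x (odd_out y)"
    using summable_sums[OF summable_cinner_ell2[of x "odd_out y"]]
    by (simp add: cinner_ell2_def odd_out.rep_eq)
  then have "(\<lambda>i. cinner (ell2_nth (odd_in x) (2 * i + 1)) (ell2_nth y (2 * i + 1))) sums cinner x (odd_out y)"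
    by (simp add: odd_in.rep_eq)
  then have "(\<lambda>i. cinner (ell2_nth (odd_in x) i) (ell2_nth y i)) sums cinner x (odd_out y)"
    by (subst (asm) sums_mono_reindex[where g = "\<lambda>i. 2 * i + 1"])
       (auto simp: strict_mono_def odd_in.rep_eq elim!: oddE)
  then show ?thesis
    by (simp add: cinner_ell2_def sums_iff)
qed

lemma norm_isometry_of_left_inverse:
  assumes "\<And>x y. cinner (A x) y = cinner x (B y)" and "\<And>x. B (A x) = x"
  shows "norm (A x) = norm (x :: 'a::complex_inner)"
proof -
  have "cinner (A x) (A x) = cinner x x" by (simp add: assms)
  then show ?thesis by (simp add: cinner_self del: of_real_power)
qed

lemma bounded_clinear_even_in: "bounded_clinear even_in"
proof (rule bounded_clinearI[where C = 1])
  show "norm (even_in x) \<le> 1 * norm x" for x :: "'a ell2"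
    using norm_isometry_of_left_inverse[of even_in even_out x] by (simp add: cinner_even_in)
qed (rule ell2_eqI, simp add: even_in.rep_eq plus_ell2.rep_eq scaleC_ell2.rep_eq)+

lemma bounded_clinear_odd_in: "bounded_clinear odd_in"
proof (rule bounded_clinearI[where C = 1])
  show "norm (odd_in x) \<le> 1 * norm x" for x :: "'a ell2"
    using norm_isometry_of_left_inverse[of odd_in odd_out x] by (simp add: cinner_odd_in)
qed (rule ell2_eqI, simp add: odd_in.rep_eq plus_ell2.rep_eq scaleC_ell2.rep_eq)+

lemma norm_even_in: "norm (even_in x) = norm x"
  by (rule norm_isometry_of_left_inverse[of even_in even_out]) (simp_all add: cinner_even_in)

lemma norm_odd_in: "norm (odd_in x) = norm x"
  by (rule norm_isometry_of_left_inverse[of odd_in odd_out]) (simp_all add: cinner_odd_in)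

lemma bounded_clinear_even_out: "bounded_clinear even_out"
  by (rule bounded_clinear_of_adjoint(1)[of even_in even_out 1])
     (simp_all add: cinner_even_in norm_even_in)

lemma bounded_clinear_odd_out: "bounded_clinear odd_out"
  by (rule bounded_clinear_of_adjoint(1)[of odd_in odd_out 1])
     (simp_all add: cinner_odd_in norm_odd_in)

lemmas half_linear =
  bounded_clinear_add[OF bounded_clinear_even_in] bounded_clinear_add[OF bounded_clinear_odd_in]
  bounded_clinear_add[OF bounded_clinear_even_out] bounded_clinear_add[OF bounded_clinear_odd_out]
  bounded_clinear_diff[OF bounded_clinear_even_in] bounded_clinear_diff[OF bounded_clinear_odd_in]
  bounded_clinear_diff[OF bounded_clinear_even_out] bounded_clinear_diff[OF bounded_clinear_odd_out]
  bounded_clinear_scaleC[OF bounded_clinear_even_in] bounded_clinear_scaleC[OF bounded_clinear_odd_in]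
  bounded_clinear_scaleC[OF bounded_clinear_even_out] bounded_clinear_scaleC[OF bounded_clinear_odd_out]
  bounded_clinear_zero[OF bounded_clinear_even_in] bounded_clinear_zero[OF bounded_clinear_odd_in]
  bounded_clinear_zero[OF bounded_clinear_even_out] bounded_clinear_zero[OF bounded_clinear_odd_out]

lemma norm_even_plus_odd: "(norm (even_in x + odd_in y))\<^sup>2 = (norm x)\<^sup>2 + (norm y)\<^sup>2"
proof -
  have "complex_of_real ((norm (even_in x + odd_in y))\<^sup>2) = complex_of_real ((norm x)\<^sup>2 + (norm y)\<^sup>2)"
    unfolding cinner_self[symmetric] of_real_add
    by (simp add: cinner_even_in cinner_odd_in cinner_add_left half_linear)
  then show ?thesis using of_real_eq_iff by blast
qed

text \<open>
  Two maps with equal norms differ by a partial isometry \<open>A\<close> whose adjoint \<open>B\<close> undoes it: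
  \<open>B y\<close> represents the functional \<open>v h \<mapsto> cinner (w h) y\<close> inside the closure of the range of
  \<open>v\<close>. Additivity of \<open>B\<close> rests on the fact that a vector of the double annihilator \<open>D\<close> of
  that range is determined by its inner products with the range.
\<close>

lemma partial_isometry_between:
  fixes v w :: "'a::complex_inner \<Rightarrow> 'e::chilbert_space"
  assumes v: "bounded_clinear v" and w: "bounded_clinear w"
    and eq: "\<And>h. norm (v h) = norm (w h)"
  obtains A B where "bounded_clinear A" "bounded_clinear B"
    "\<And>x y. cinner (A x) y = cinner x (B y)"
    "\<And>h. A (v h) = w h" "\<And>h. B (w h) = v h"
    "\<And>x. A (B (A x)) = A x" "\<And>x. B (A (B x)) = B x"
proof -
  define D where "D = {u. \<forall>z. (\<forall>h. cinner (v h) z = 0) \<longrightarrow> cinner u z = 0}"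
  have closD: "u \<in> D" if u: "u \<in> closure (range v)" for u
    unfolding D_def
  proof (intro CollectI allI impI)
    fix z assume z: "\<forall>h. cinner (v h) z = 0"
    have "closed {x. cinner x z = 0}"
      by (intro closed_Collect_eq continuous_intros linear_continuous_on bounded_linear_cinner_left)
    then have "closure (range v) \<subseteq> {x. cinner x z = 0}"
      using z by (intro closure_minimal) auto
    then show "cinner u z = 0" using u by auto
  qed
  have uniq: "u = u'" if "u \<in> D" "u' \<in> D" "\<And>h. cinner (v h) u = cinner (v h) u'" for u u'
  proof -
    have "\<forall>h. cinner (v h) (u - u') = 0" using that(3) by (simp add: cinner_diff_right)
    then have "cinner u (u - u') = 0" "cinner u' (u - u') = 0"
      using that(1,2) by (auto simp: D_def)
    then have "cinner (u - u') (u - u') = 0" by (simp add: cinner_diff_left)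
    then show ?thesis by (simp add: cinner_self)
  qed
  have "\<exists>u. u \<in> closure (range v) \<and> (\<forall>h. cinner (w h) y = cinner (v h) u)" for y
  proof -
    obtain u where "u \<in> closure (range v)" "\<And>h. cinner (w h) y = cinner (v h) u"
      by (rule riesz_along_map[OF v, of "\<lambda>h. cinner (w h) y" "norm y"])
         (simp_all add: bounded_clinear_add[OF w] bounded_clinear_scaleC[OF w] cinner_add_left
           cinner_scaleC_left eq norm_cinner_le mult.commute[of "norm y"])
    then show ?thesis by blast
  qed
  then obtain B where Bcl: "\<And>y. B y \<in> closure (range v)"
    and B: "\<And>y h. cinner (v h) (B y) = cinner (w h) y" by metis
  have BD: "B y \<in> D" for y by (rule closD[OF Bcl])
  have Bbound: "norm (B y) \<le> norm y" for y
  proof -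
    have "closed {x. cmod (cinner x (B y)) \<le> norm x * norm y}"
      by (intro closed_Collect_le continuous_intros linear_continuous_on bounded_linear_cinner_left)
    then have "closure (range v) \<subseteq> {x. cmod (cinner x (B y)) \<le> norm x * norm y}"
      by (intro closure_minimal) (auto simp: B eq norm_cinner_le)
    then have "cmod (cinner (B y) (B y)) \<le> norm (B y) * norm y" using Bcl by blast
    then have "norm (B y) * norm (B y) \<le> norm (B y) * norm y"
      by (simp add: cinner_self norm_power power2_eq_square norm_mult)
    then show ?thesis by (cases "B y = 0") simp_all
  qed
  have Blin: "bounded_clinear B"
  proof (rule bounded_clinearI[where C = 1])
    show "B (x + y) = B x + B y" for x y
    proof (rule uniq[OF BD])
      show "B x + B y \<in> D" using BD[of x] BD[of y] by (simp add: D_def cinner_add_left)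
    qed (simp add: cinner_add_right B)
    show "B (c *\<^sub>C x) = c *\<^sub>C B x" for c x
    proof (rule uniq[OF BD])
      show "c *\<^sub>C B x \<in> D" using BD[of x] by (simp add: D_def cinner_scaleC_left)
    qed (simp add: cinner_scaleC_right B)
  qed (simp add: Bbound)
  define A where "A = cadjoint B"
  have adj: "cinner (A x) y = cinner x (B y)" for x y
    unfolding A_def by (rule cadjoint'[OF Blin])
  have Alin: "bounded_clinear A"
    by (rule bounded_clinear_of_adjoint(1)[of B A 1])
       (simp_all add: A_def cadjoint[OF Blin] Bbound)
  have Av: "A (v h) = w h" for h
  proof (rule cinner_eqI)
    show "cinner x (A (v h)) = cinner x (w h)" for x
      by (simp add: A_def cadjoint[OF Blin, symmetric])
         (metis B cinner_commute)
  qed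
  have Bw: "B (w g) = v g" for g
  proof (rule uniq[OF BD])
    show "v g \<in> D" by (rule closD[OF subsetD[OF closure_subset rangeI]])
    show "cinner (v h) (B (w g)) = cinner (v h) (v g)" for h
      by (simp add: B cinner_eq_of_norm_eq[OF v w eq])
  qed
  have BAB: "B (A (B y)) = B y" for y
  proof -
    have "closed {u. B (A u) = u}"
      by (intro closed_Collect_eq continuous_intros linear_continuous_on
          bounded_clinear_bounded_linear bounded_clinear_comp[OF Blin Alin])
    then have "closure (range v) \<subseteq> {u. B (A u) = u}"
      by (intro closure_minimal) (auto simp: Av Bw)
    then show ?thesis using Bcl by blast
  qed
  have ABA: "A (B (A x)) = A x" for x
  proof (rule cinner_eqI)
    show "cinner y (A (B (A x))) = cinner y (A x)" for y
      unfolding A_def cadjoint[OF Blin, symmetric]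
      by (metis A_def BAB cadjoint[OF Blin] cadjoint'[OF Blin])
  qed
  show thesis
    by (rule that[OF Alin Blin adj Av Bw ABA BAB])
qed

text \<open>
  The partial isometry \<open>A\<close> taking \<open>v h\<close> to \<open>w h\<close> need not extend to a unitary operator on the
  same space, but on two copies of it the Halmos block matrix with rows \<open>A, 1 - A A\<^sup>*\<close> and
  \<open>1 - A\<^sup>* A, - A\<^sup>*\<close> is unitary and still takes \<open>v h\<close> to \<open>w h\<close> in the first copy.
\<close>

lemma unitary_between:
  fixes v w :: "'a::complex_inner \<Rightarrow> 'h::chilbert_space ell2"
  assumes v: "bounded_clinear v" and w: "bounded_clinear w"
    and eq: "\<And>h. norm (v h) = norm (w h)"
  obtains U V :: "'h ell2 \<Rightarrow> 'h ell2" where "bounded_clinear U" "bounded_clinear V"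
    "\<And>x y. cinner (U x) y = cinner x (V y)" "\<And>x. U (V x) = x" "\<And>x. V (U x) = x"
    "\<And>h. U (even_in (v h)) = even_in (w h)"
proof -
  obtain A B where A: "bounded_clinear A" and B: "bounded_clinear B"
    and adj: "\<And>x y. cinner (A x) y = cinner x (B y)"
    and Av: "\<And>h. A (v h) = w h" and Bw: "\<And>h. B (w h) = v h"
    and ABA: "\<And>x. A (B (A x)) = A x" and BAB: "\<And>x. B (A (B x)) = B x"
    by (rule partial_isometry_between[OF v w eq]) blast
  have adj': "cinner (B x) y = cinner x (A y)" for x y
    by (metis adj cinner_commute)
  note lin = bounded_clinear_add[OF A] bounded_clinear_add[OF B] bounded_clinear_diff[OF A]
    bounded_clinear_diff[OF B] bounded_clinear_scaleC[OF A] bounded_clinear_scaleC[OF B]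
    bounded_clinear_zero[OF A] bounded_clinear_zero[OF B]
    bounded_clinear_minus[OF A] bounded_clinear_minus[OF B]
  define M where "M A B x = even_in (A (even_out x) + (odd_out x - A (B (odd_out x)))) +
      odd_in ((even_out x - B (A (even_out x))) - B (odd_out x))"
    for A B :: "'h ell2 \<Rightarrow> 'h ell2" and x
  have Mlin: "bounded_clinear (M A B)" if "bounded_clinear A" "bounded_clinear B" for A B
    unfolding M_def
    by (intro bounded_clinear_plus bounded_clinear_minus_fun bounded_clinear_even_out
        bounded_clinear_odd_out
        bounded_clinear_comp[OF bounded_clinear_even_in] bounded_clinear_comp[OF bounded_clinear_odd_in]
        bounded_clinear_comp[OF that(1)] bounded_clinear_comp[OF that(2)])
  have MM: "M A B (M B A x) = x" "M B A (M A B x) = x" for x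
    using even_odd_split[of x] by (simp_all add: M_def half_linear lin ABA BAB)
  show thesis
  proof (rule that[of "M A B" "M B A"])
    show "cinner (M A B x) y = cinner x (M B A y)" for x y
    proof -
      have "cinner x z = cinner (even_out x) (even_out z) + cinner (odd_out x) (odd_out z)" for z
        by (subst even_odd_split[of x, symmetric])
           (simp only: cinner_add_left cinner_even_in cinner_odd_in)
      then show ?thesis
        by (simp add: M_def half_linear cinner_add_left cinner_even_in cinner_odd_in
            cinner_add_right cinner_diff_left cinner_diff_right adj adj')
    qed
    show "M A B (even_in (v h)) = even_in (w h)" for h
      by (simp add: M_def half_linear lin Av Bw)
  qed (use MM Mlin[OF A B] Mlin[OF B A] in auto)
qed

section \<open>Iterated differences of quadratic forms\<close>

text \<open>
  On quadratic forms, the map \<open>X \<mapsto> X - T X T\<^sup>*\<close> on operators is the difference along \<open>R = T\<^sup>*\<close>. The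
  form of the inverse Szego kernel is the iterated difference of \<open>(norm h)^2\<close> along all \<open>R\<^sub>i\<close>, so
  the algebra of these operators is carried out on scalar functions.
\<close>

definition diff_along :: "('h \<Rightarrow> 'h) \<Rightarrow> ('h \<Rightarrow> real) \<Rightarrow> 'h \<Rightarrow> real" where
  "diff_along R \<phi> h = \<phi> h - \<phi> (R h)"

definition pairwise_commuting :: "('h \<Rightarrow> 'h) set \<Rightarrow> bool" where
  "pairwise_commuting F \<longleftrightarrow> (\<forall>f\<in>F. \<forall>g\<in>F. \<forall>h. f (g h) = g (f h))"

lemma pairwise_commutingD: "pairwise_commuting F \<Longrightarrow> f \<in> F \<Longrightarrow> g \<in> F \<Longrightarrow> f (g h) = g (f h)"
  by (auto simp: pairwise_commuting_def)

lemma pairwise_commuting_subset: "pairwise_commuting F \<Longrightarrow> G \<subseteq> F \<Longrightarrow> pairwise_commuting G"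
  by (auto simp: pairwise_commuting_def)

lemma fold_diff_along_diff:
  "fold diff_along Rs (\<lambda>h. \<phi> h - \<psi> h) h = fold diff_along Rs \<phi> h - fold diff_along Rs \<psi> h"
proof (induction Rs arbitrary: \<phi> \<psi>)
  case (Cons R Rs)
  have "diff_along R (\<lambda>h. \<phi> h - \<psi> h) = (\<lambda>h. diff_along R \<phi> h - diff_along R \<psi> h)"
    by (auto simp: diff_along_def)
  then show ?case by (simp add: Cons.IH)
qed simp

lemma fold_diff_along_sum:
  "fold diff_along Rs (\<lambda>h. \<Sum>j\<in>J. \<phi> j h) h = (\<Sum>j\<in>J. fold diff_along Rs (\<phi> j) h)"
proof (induction Rs arbitrary: \<phi>)
  case (Cons R Rs)
  have "diff_along R (\<lambda>h. \<Sum>j\<in>J. \<phi> j h) = (\<lambda>h. \<Sum>j\<in>J. diff_along R (\<phi> j) h)"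
    by (auto simp: diff_along_def sum_subtractf)
  then show ?case by (simp add: Cons.IH)
qed simp

lemma fold_diff_along_comp:
  assumes "\<And>R h. R \<in> set Rs \<Longrightarrow> Q (R h) = R (Q h)"
  shows "fold diff_along Rs (\<lambda>h. \<phi> (Q h)) h = fold diff_along Rs \<phi> (Q h)"
  using assms
proof (induction Rs arbitrary: \<phi>)
  case (Cons R Rs)
  have "diff_along R (\<lambda>h. \<phi> (Q h)) = (\<lambda>h. diff_along R \<phi> (Q h))"
    using Cons.prems by (auto simp: diff_along_def)
  then show ?case using Cons by simp
qed simp

lemma fold_diff_along_Cons:
  "fold diff_along (R # Rs) \<phi> h = fold diff_along Rs \<phi> h - fold diff_along Rs (\<lambda>h. \<phi> (R h)) h"
  using fold_diff_along_diff[of Rs \<phi> "\<lambda>h. \<phi> (R h)" h] by (simp add: diff_along_def[abs_def])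

lemma fold_diff_along_permute:
  assumes "pairwise_commuting (set Rs)" and "mset Rs = mset Rs'"
  shows "fold diff_along Rs = fold diff_along Rs'"
proof (rule fold_multiset_equiv[OF _ assms(2)])
  fix P Q assume "P \<in> set Rs" "Q \<in> set Rs"
  then have "P (Q h) = Q (P h)" for h
    using assms(1) by (simp add: pairwise_commuting_def)
  then show "diff_along P \<circ> diff_along Q = diff_along Q \<circ> diff_along P"
    by (auto simp: diff_along_def fun_eq_iff)
qed

lemma sum_PiE_insert:
  assumes "x \<notin> S"
  shows "sum f (PiE (insert x S) B) = (\<Sum>y\<in>B x. \<Sum>g\<in>PiE S B. f (g(x := y)))"
  unfolding PiE_insert_eq sum.cartesian_product
  by (subst sum.reindex[OF inj_combinator[OF assms]]) (simp add: o_def case_prod_beta')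

text \<open>
  Monomials in a tuple of maps over any list of indices, so that induction on the list applies.
\<close>

definition powers :: "nat list \<Rightarrow> (nat \<Rightarrow> 'h \<Rightarrow> 'h) \<Rightarrow> (nat \<Rightarrow> nat) \<Rightarrow> 'h \<Rightarrow> 'h" where
  "powers xs R k = foldr (\<lambda>i A. (R i ^^ k i) \<circ> A) xs id"

lemma powers_Nil [simp]: "powers [] R k h = h"
  and powers_Cons [simp]: "powers (x # xs) R k h = (R x ^^ k x) (powers xs R k h)"
  by (simp_all add: powers_def)

lemma tuple_power_eq: "tuple_power m R k = powers [1..<Suc m] R k"
  by (simp add: tuple_power_def powers_def)

lemma powers_cong: "(\<And>i. i \<in> set xs \<Longrightarrow> k i = l i) \<Longrightarrow> powers xs R k h = powers xs R l h"
  by (induction xs) auto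

lemma funpow_commute: "(\<And>h. f (g h) = g (f h)) \<Longrightarrow> (f ^^ j) (g h) = g ((f ^^ j) h)"
  by (induction j) auto

lemma powers_commute:
  assumes "\<And>i h. i \<in> set xs \<Longrightarrow> Q (R i h) = R i (Q h)"
  shows "Q (powers xs R k h) = powers xs R k (Q h)"
  using assms
proof (induction xs)
  case (Cons x xs)
  have "(R x ^^ j) (Q g) = Q ((R x ^^ j) g)" for j g
    by (rule funpow_commute) (simp add: Cons.prems)
  then show ?case using Cons by (metis list.set_intros(2) powers_Cons)
qed simp

lemma powers_step:
  assumes "pairwise_commuting (R ` set xs)" "distinct xs" "i \<in> set xs"
  shows "powers xs R (k(i := Suc (k i))) h = powers xs R k (R i h)"
  using assms
proof (induction xs)
  case (Cons x xs)
  have comm: "R j (R l h) = R l (R j h)" if "j \<in> set (x # xs)" "l \<in> set (x # xs)" for j l h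
    using Cons.prems(1) that by (auto simp: pairwise_commuting_def)
  have IH: "powers xs R (k(i := Suc (k i))) h = powers xs R k (R i h)" if "i \<in> set xs"
    using Cons.prems that by (intro Cons.IH) (auto intro: pairwise_commuting_subset)
  show ?case
  proof (cases "i = x")
    case True
    then have "powers xs R (k(i := Suc (k i))) h = powers xs R k h"
      using Cons.prems by (intro powers_cong) auto
    moreover have "R x (powers xs R k h) = powers xs R k (R x h)"
      by (rule powers_commute) (use comm in auto)
    ultimately show ?thesis using True by (simp add: funpow_swap1 fun_upd_def)
  next
    case False
    then show ?thesis using IH Cons.prems by (simp add: fun_upd_def)
  qed
qed simp

text \<open>Expanding the product of the factors "identity minus composition with \<open>R i\<close>".\<close>

lemma signed_sum_eq_fold_diff_along:
  assumes "distinct xs"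
  shows "(\<Sum>k\<in>PiE (set xs) (\<lambda>_. {0, 1}). (-1) ^ (\<Sum>i\<in>set xs. k i) * \<phi> (powers xs R k h)) =
    fold diff_along (map R xs) \<phi> h"
  using assms
proof (induction xs arbitrary: \<phi>)
  case (Cons x xs)
  then have x: "x \<notin> set xs" by simp
  have sm: "(\<Sum>i\<in>set xs. (g(x := y)) i) = (\<Sum>i\<in>set xs. g i)" for g :: "nat \<Rightarrow> nat" and y
    using x by (intro sum.cong) auto
  have pw: "powers xs R (g(x := y)) h = powers xs R g h" for g y
    using x by (intro powers_cong) auto
  have IH: "(\<Sum>k\<in>PiE (set xs) (\<lambda>_. {0, 1}). (-1) ^ (\<Sum>i\<in>set xs. k i) * \<psi> (powers xs R k h)) =
    fold diff_along (map R xs) \<psi> h" for \<psi>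
    using Cons by simp
  show ?case
    unfolding list.map fold_diff_along_Cons IH[symmetric] list.set sum_PiE_insert[OF x] powers_Cons pw
      sum.insert[OF finite_set x] fun_upd_same sm
    by (simp add: sum_negf)
qed simp

text \<open>
  Telescoping over a box of multi-indices turns each difference along \<open>R i\<close> into the difference
  along its \<open>N\<close>-th power.
\<close>

lemma sum_box_fold_diff_along:
  assumes "distinct xs" and "pairwise_commuting (R ` set xs)"
  shows "(\<Sum>k\<in>PiE (set xs) (\<lambda>_. {..<N}). fold diff_along (map R xs) \<phi> (powers xs R k h)) =
    fold diff_along (map (\<lambda>i. R i ^^ N) xs) \<phi> h"
  using assms
proof (induction xs arbitrary: \<phi>)
  case (Cons x xs)
  then have x: "x \<notin> set xs" by simp
  have pw: "powers xs R (g(x := y)) h = powers xs R g h" for g y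
    using x by (intro powers_cong) auto
  have comm: "R x (R i g) = R i (R x g)" if "i \<in> set xs" for i g
    by (rule pairwise_commutingD[OF Cons.prems(2)]) (use that in simp_all)
  have shift: "fold diff_along (map R xs) \<psi> ((R x ^^ j) g) =
      fold diff_along (map R xs) (\<lambda>h. \<psi> ((R x ^^ j) h)) g" for \<psi> j g
    by (rule fold_diff_along_comp[symmetric]) (auto simp: comm intro!: funpow_commute)
  have tele: "diff_along (R x ^^ N) \<phi> = (\<lambda>g. \<Sum>j<N. diff_along (R x) \<phi> ((R x ^^ j) g))"
  proof
    show "diff_along (R x ^^ N) \<phi> g = (\<Sum>j<N. diff_along (R x) \<phi> ((R x ^^ j) g))" for g
      by (induction N) (simp_all add: diff_along_def)
  qed
  have "(\<Sum>k\<in>PiE (set (x # xs)) (\<lambda>_. {..<N}). fold diff_along (map R (x # xs)) \<phi> (powers (x # xs) R k h))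
    = (\<Sum>j<N. \<Sum>k\<in>PiE (set xs) (\<lambda>_. {..<N}).
        fold diff_along (map R xs) (diff_along (R x) \<phi>) ((R x ^^ j) (powers xs R k h)))"
    using x by (simp add: sum_PiE_insert pw)
  also have "\<dots> = (\<Sum>k\<in>PiE (set xs) (\<lambda>_. {..<N}). \<Sum>j<N.
        fold diff_along (map R xs) (\<lambda>h. diff_along (R x) \<phi> ((R x ^^ j) h)) (powers xs R k h))"
    unfolding shift by (rule sum.swap)
  also have "\<dots> = (\<Sum>k\<in>PiE (set xs) (\<lambda>_. {..<N}).
        fold diff_along (map R xs) (diff_along (R x ^^ N) \<phi>) (powers xs R k h))"
    by (simp only: tele fold_diff_along_sum)
  also have "\<dots> = fold diff_along (map (\<lambda>i. R i ^^ N) xs) (diff_along (R x ^^ N) \<phi>) h"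
    using Cons.prems by (intro Cons.IH) (auto intro: pairwise_commuting_subset)
  finally show ?case by simp
qed simp

lemma abs_fold_diff_along_le:
  fixes Rs :: "('h::real_normed_vector \<Rightarrow> 'h) list"
  assumes "\<And>R h. R \<in> set Rs \<Longrightarrow> norm (R h) \<le> norm h"
    and "\<And>h. \<bar>\<phi> h\<bar> \<le> c * (norm h)\<^sup>2" "0 \<le> c"
  shows "\<bar>fold diff_along Rs \<phi> h\<bar> \<le> 2 ^ length Rs * c * (norm h)\<^sup>2"
  using assms
proof (induction Rs arbitrary: \<phi> c)
  case (Cons R Rs)
  have "\<bar>diff_along R \<phi> g\<bar> \<le> (2 * c) * (norm g)\<^sup>2" for g
  proof -
    have "\<bar>diff_along R \<phi> g\<bar> \<le> \<bar>\<phi> g\<bar> + \<bar>\<phi> (R g)\<bar>" by (simp add: diff_along_def)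
    also have "\<dots> \<le> c * (norm g)\<^sup>2 + c * (norm (R g))\<^sup>2" using Cons.prems(2) add_mono by blast
    also have "\<dots> \<le> c * (norm g)\<^sup>2 + c * (norm g)\<^sup>2"
      using Cons.prems(1,3) by (intro add_left_mono mult_left_mono power_mono) auto
    finally show ?thesis by simp
  qed
  then have "\<bar>fold diff_along Rs (diff_along R \<phi>) h\<bar> \<le> 2 ^ length Rs * (2 * c) * (norm h)\<^sup>2"
    using Cons.prems by (intro Cons.IH) auto
  then show ?case by (simp add: mult.commute mult.left_commute)
qed simp

lemma norm_funpow_le:
  fixes f :: "'h::real_normed_vector \<Rightarrow> 'h"
  shows "(\<And>h. norm (f h) \<le> norm h) \<Longrightarrow> norm ((f ^^ j) h) \<le> norm h"
proof (induction j)
  case (Suc j)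
  have "norm (f ((f ^^ j) h)) \<le> norm ((f ^^ j) h)" by (rule Suc.prems)
  then show ?case using order_trans[OF _ Suc.IH[OF Suc.prems]] by simp
qed simp

text \<open>
  Purity enters here: every term of the expanded difference along \<open>N\<close>-th powers, other than
  \<open>(norm h)^2\<close> itself, contains some \<open>R i ^^ N\<close> and tends to \<open>0\<close>.
\<close>

lemma fold_diff_along_powers_tendsto:
  fixes R :: "nat \<Rightarrow> 'h::real_normed_vector \<Rightarrow> 'h"
  assumes comm: "pairwise_commuting (R ` set xs)"
    and contr: "\<And>i h. i \<in> set xs \<Longrightarrow> norm (R i h) \<le> norm h"
    and pure: "\<And>i h. i \<in> set xs \<Longrightarrow> (\<lambda>N. norm ((R i ^^ N) h)) \<longlonglongrightarrow> 0"
  shows "(\<lambda>N. fold diff_along (map (\<lambda>i. R i ^^ N) xs) (\<lambda>h. (norm h)\<^sup>2) h) \<longlonglongrightarrow> (norm h)\<^sup>2"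
  using assms
proof (induction xs)
  case (Cons x xs)
  let ?F = "\<lambda>N. fold diff_along (map (\<lambda>i. R i ^^ N) xs) (\<lambda>h. (norm h)\<^sup>2)"
  have split: "fold diff_along (map (\<lambda>i. R i ^^ N) (x # xs)) (\<lambda>h. (norm h)\<^sup>2) h =
      ?F N h - ?F N ((R x ^^ N) h)" for N
  proof -
    have "(R x ^^ N) ((R i ^^ N) g) = (R i ^^ N) ((R x ^^ N) g)" if "i \<in> set xs" for i g
    proof -
      have "R x (R i h) = R i (R x h)" for h
        by (rule pairwise_commutingD[OF Cons.prems(1)]) (use that in simp_all)
      then have "(R x ^^ N) (R i h) = R i ((R x ^^ N) h)" for h
        by (rule funpow_commute)
      then show ?thesis by (rule funpow_commute[symmetric, OF sym])
    qed
    then have "fold diff_along (map (\<lambda>i. R i ^^ N) xs) (\<lambda>h. (norm ((R x ^^ N) h))\<^sup>2) h =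
        ?F N ((R x ^^ N) h)"
      by (intro fold_diff_along_comp) auto
    then show ?thesis by (simp only: list.map fold_diff_along_Cons)
  qed
  have IH: "(\<lambda>N. ?F N h) \<longlonglongrightarrow> (norm h)\<^sup>2"
    using Cons.prems by (intro Cons.IH) (auto intro: pairwise_commuting_subset)
  have bound: "\<bar>?F N g\<bar> \<le> 2 ^ length xs * (norm g)\<^sup>2" for N g
  proof -
    have "norm (Q h) \<le> norm h" if Q: "Q \<in> set (map (\<lambda>i. R i ^^ N) xs)" for Q h
    proof -
      obtain i where "i \<in> set xs" "Q = R i ^^ N" using Q by auto
      then show ?thesis using Cons.prems(2) by (auto intro!: norm_funpow_le)
    qed
    then have "\<bar>?F N g\<bar> \<le> 2 ^ length (map (\<lambda>i. R i ^^ N) xs) * 1 * (norm g)\<^sup>2"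
      by (intro abs_fold_diff_along_le) auto
    then show ?thesis by simp
  qed
  have "(\<lambda>N. 2 ^ length xs * (norm ((R x ^^ N) h))\<^sup>2) \<longlonglongrightarrow> 2 ^ length xs * 0\<^sup>2"
    by (intro tendsto_intros Cons.prems(3)) simp
  then have null: "(\<lambda>N. 2 ^ length xs * (norm ((R x ^^ N) h))\<^sup>2) \<longlonglongrightarrow> 0" by simp
  have "(\<lambda>N. ?F N ((R x ^^ N) h)) \<longlonglongrightarrow> 0"
    by (rule Lim_null_comparison[OF _ null]) (simp add: bound)
  with IH have "(\<lambda>N. ?F N h - ?F N ((R x ^^ N) h)) \<longlonglongrightarrow> (norm h)\<^sup>2 - 0"
    by (rule tendsto_diff)
  then show ?case by (simp only: split diff_zero)
qed simp

lemma cinner_powers: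
  fixes T :: "nat \<Rightarrow> 'h::chilbert_space \<Rightarrow> 'h"
  assumes "\<And>i. i \<in> set xs \<Longrightarrow> bounded_clinear (T i)"
    and "pairwise_commuting ((\<lambda>i. cadjoint (T i)) ` set xs)"
  shows "cinner (powers xs T k x) y = cinner x (powers xs (\<lambda>i. cadjoint (T i)) k y)"
  using assms
proof (induction xs arbitrary: y)
  case (Cons a xs)
  have pw: "cinner ((T a ^^ j) x) y = cinner x ((cadjoint (T a) ^^ j) y)" for j x y
    using Cons.prems(1)
    by (induction j arbitrary: x y) (simp_all add: cadjoint funpow_swap1)
  have comm: "(cadjoint (T a) ^^ j) (powers xs (\<lambda>i. cadjoint (T i)) k y) =
      powers xs (\<lambda>i. cadjoint (T i)) k ((cadjoint (T a) ^^ j) y)" for j y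
  proof (rule funpow_commute)
    show "cadjoint (T a) (powers xs (\<lambda>i. cadjoint (T i)) k h) =
        powers xs (\<lambda>i. cadjoint (T i)) k (cadjoint (T a) h)" for h
      by (rule powers_commute, rule pairwise_commutingD[OF Cons.prems(2)]) simp_all
  qed
  have "pairwise_commuting ((\<lambda>i. cadjoint (T i)) ` set xs)"
    by (rule pairwise_commuting_subset[OF Cons.prems(2)]) auto
  with Cons show ?case by (simp add: pw comm)
qed simp

lemma bounded_clinear_funpow:
  fixes f :: "'h::complex_inner \<Rightarrow> 'h"
  assumes "bounded_clinear f"
  shows "bounded_clinear (f ^^ j)"
proof (induction j)
  case 0 then show ?case using bounded_clinear_ident by (simp add: id_def)
next
  case (Suc j) then show ?case
    using bounded_clinear_comp[OF assms Suc.IH] by (simp add: o_def)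
qed

lemma bounded_clinear_powers:
  fixes R :: "nat \<Rightarrow> 'h::complex_inner \<Rightarrow> 'h"
  assumes "\<And>i. i \<in> set xs \<Longrightarrow> bounded_clinear (R i)"
  shows "bounded_clinear (powers xs R k)"
  using assms
proof (induction xs)
  case Nil show ?case using bounded_clinear_ident by (simp add: powers_def id_def)
next
  case (Cons x xs)
  have "bounded_clinear (R x)" "bounded_clinear (powers xs R k)" using Cons by simp_all
  from bounded_clinear_comp[OF bounded_clinear_funpow[OF this(1)] this(2), of "k x"]
  show ?case by (simp add: powers_def o_def)
qed

lemma cadjoint_commute:
  assumes "bounded_clinear A" "bounded_clinear B" "\<And>x. A (B x) = B (A x)"
  shows "cadjoint A (cadjoint B y) = cadjoint B (cadjoint A y)"
  by (rule cinner_eqI) (simp add: cadjoint[symmetric] assms)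

lemma commuting_contractionsD:
  assumes "T \<in> commuting_contractions m" "i \<in> {1..m}"
  shows "bounded_clinear (T i)" "norm (T i h) \<le> norm h"
    "bounded_clinear (cadjoint (T i))" "norm (cadjoint (T i) h) \<le> norm h"
proof -
  show lin: "bounded_clinear (T i)"
    using assms by (auto simp: commuting_contractions_def bounded_ops_UNIV)
  have le: "norm (T i h) \<le> norm h" for h
  proof -
    have "norm (T i h) \<le> onorm (T i) * norm h"
      by (rule onorm[OF bounded_clinear_bounded_linear[OF lin]])
    also have "\<dots> \<le> 1 * norm h"
      using assms by (intro mult_right_mono) (auto simp: commuting_contractions_def)
    finally show ?thesis by simp
  qed
  then show "norm (T i h) \<le> norm h" .
  show "bounded_clinear (cadjoint (T i))" "norm (cadjoint (T i) h) \<le> norm h"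
    using bounded_clinear_of_adjoint[of "T i" "cadjoint (T i)" 1, OF cadjoint[OF lin]] le
    by auto
qed

lemma commuting_contractions_adjoint_commute:
  assumes "T \<in> commuting_contractions m" "i \<in> {1..m}" "j \<in> {1..m}"
  shows "cadjoint (T i) (cadjoint (T j) h) = cadjoint (T j) (cadjoint (T i) h)"
proof (rule cadjoint_commute)
  show "T i (T j x) = T j (T i x)" for x
    using assms unfolding commuting_contractions_def fun_eq_iff o_def by blast
qed (use commuting_contractionsD[OF assms(1)] assms in auto)

lemma szego_inverse_form:
  assumes T: "T \<in> commuting_contractions m"
  shows "bounded_clinear (szego_inverse m T)"
    and "inner (szego_inverse m T h) h =
      fold diff_along (map (\<lambda>i. cadjoint (T i)) [1..<Suc m]) (\<lambda>h. (norm h)\<^sup>2) h"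
proof -
  let ?R = "\<lambda>i. cadjoint (T i)" and ?xs = "[1..<Suc m]"
  have set: "set ?xs = {1..m}" by auto
  have lin: "bounded_clinear (T i)" "bounded_clinear (?R i)" if "i \<in> set ?xs" for i
    using commuting_contractionsD[OF T] that set by auto
  have comm: "pairwise_commuting (?R ` set ?xs)"
    using commuting_contractions_adjoint_commute[OF T] by (auto simp: set pairwise_commuting_def)
  have fin: "finite (PiE {1..m} (\<lambda>_. {0, 1::nat}))" by (intro finite_PiE) auto
  show "bounded_clinear (szego_inverse m T)"
    unfolding szego_inverse_def[abs_def] tuple_power_eq
    by (intro bounded_clinear_sum[OF fin] bounded_clinear_scaleR
        bounded_clinear_comp[OF bounded_clinear_powers bounded_clinear_powers] lin)
  have "inner (szego_inverse m T h) h = (\<Sum>k\<in>PiE {1..m} (\<lambda>_. {0, 1}).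
      (-1) ^ (\<Sum>i=1..m. k i) * (norm (powers ?xs ?R k h))\<^sup>2)"
    unfolding szego_inverse_def inner_sum_left
  proof (rule sum.cong[OF refl])
    fix k
    have "inner (powers ?xs T k (powers ?xs ?R k h)) h = (norm (powers ?xs ?R k h))\<^sup>2"
      using cinner_powers[OF lin(1) comm] by (metis Re_cinner power2_norm_eq_inner)
    then show "inner ((-1) ^ (\<Sum>i=1..m. k i) *\<^sub>R tuple_power m T k (tuple_power m ?R k h)) h =
        (-1) ^ (\<Sum>i=1..m. k i) * (norm (powers ?xs ?R k h))\<^sup>2"
      by (simp add: tuple_power_eq)
  qed
  also have "\<dots> = fold diff_along (map ?R ?xs) (\<lambda>h. (norm h)\<^sup>2) h"
    using signed_sum_eq_fold_diff_along[of ?xs "\<lambda>h. (norm h)\<^sup>2" ?R h] by (simp only: set distinct_upt)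
  finally show "inner (szego_inverse m T h) h = fold diff_along (map ?R ?xs) (\<lambda>h. (norm h)\<^sup>2) h" .
qed

instance chilbert_space \<subseteq> banach ..

section \<open>Power series and the Hardy space\<close>

lemma finite_subset_box:
  assumes I: "finite I" and F: "finite F" "F \<subseteq> PiE I (\<lambda>_. UNIV :: nat set)"
  obtains N where "F \<subseteq> PiE I (\<lambda>_. {..<N})"
proof -
  have "finite (\<Union>k\<in>F. k ` I)" using I F by auto
  then obtain N where N: "\<forall>j\<in>(\<Union>k\<in>F. k ` I). j < N"
    unfolding finite_nat_set_iff_bounded by (rule exE)
  show thesis
  proof (rule that, rule subsetI)
    fix k assume k: "k \<in> F"
    then have "k \<in> PiE I (\<lambda>_. UNIV)" using F(2) by blast
    then show "k \<in> PiE I (\<lambda>_. {..<N})"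
      using N k by (auto simp: PiE_iff)
  qed
qed

lemma box_sums_summable:
  fixes f :: "('i \<Rightarrow> nat) \<Rightarrow> real"
  assumes I: "finite I" and nonneg: "\<And>k. 0 \<le> f k"
    and bound: "\<And>N. sum f (PiE I (\<lambda>_. {..<N})) \<le> C"
  shows "f summable_on PiE I (\<lambda>_. UNIV)"
proof (rule nonneg_bounded_partial_sums_imp_summable_on)
  show "\<forall>\<^sub>F F in finite_subsets_at_top (PiE I (\<lambda>_. UNIV)). sum f F \<le> C"
  proof (rule eventually_finite_subsets_at_top_weakI)
    fix F assume F: "finite F" "F \<subseteq> PiE I (\<lambda>_. UNIV :: nat set)"
    then obtain N where N: "F \<subseteq> PiE I (\<lambda>_. {..<N})" using finite_subset_box[OF I] by blast
    have "sum f F \<le> sum f (PiE I (\<lambda>_. {..<N}))"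
      using N I nonneg by (intro sum_mono2 finite_PiE) auto
    then show "sum f F \<le> C" using bound[of N] by linarith
  qed
qed (rule nonneg)

text \<open>Boxes exhaust the multi-indices, and every finite set of multi-indices lies in a box.\<close>

lemma has_sum_of_box_sums:
  fixes f :: "('i \<Rightarrow> nat) \<Rightarrow> real"
  assumes I: "finite I" and nonneg: "\<And>k. 0 \<le> f k"
    and lim: "(\<lambda>N. sum f (PiE I (\<lambda>_. {..<N}))) \<longlonglongrightarrow> L"
  shows "(f has_sum L) (PiE I (\<lambda>_. UNIV))"
proof -
  obtain C where "\<And>N. norm (sum f (PiE I (\<lambda>_. {..<N}))) \<le> C"
    using convergent_imp_Bseq[OF convergentI[OF lim]] by (auto simp: Bseq_def)
  then have "sum f (PiE I (\<lambda>_. {..<N})) \<le> C" for N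
    using order_trans[OF abs_ge_self] by auto
  then have "f summable_on PiE I (\<lambda>_. UNIV)"
    by (rule box_sums_summable[OF I nonneg])
  then obtain S where S: "(f has_sum S) (PiE I (\<lambda>_. UNIV))" by (auto simp: summable_on_def)
  have "filterlim (\<lambda>N. PiE I (\<lambda>_. {..<N})) (finite_subsets_at_top (PiE I (\<lambda>_. UNIV))) sequentially"
    unfolding filterlim_finite_subsets_at_top
  proof (intro allI impI)
    fix F assume "finite F \<and> F \<subseteq> PiE I (\<lambda>_. UNIV :: nat set)"
    then obtain N where N: "F \<subseteq> PiE I (\<lambda>_. {..<N})" using finite_subset_box[OF I] by blast
    have "finite (PiE I (\<lambda>_. {..<M})) \<and> F \<subseteq> PiE I (\<lambda>_. {..<M}) \<and>
        PiE I (\<lambda>_. {..<M}) \<subseteq> PiE I (\<lambda>_. UNIV)" if "N \<le> M" for M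
    proof (intro conjI)
      have "PiE I (\<lambda>_. {..<N}) \<subseteq> PiE I (\<lambda>_. {..<M})" using that by (intro PiE_mono) auto
      then show "F \<subseteq> PiE I (\<lambda>_. {..<M})" using N by blast
      show "finite (PiE I (\<lambda>_. {..<M}))" using I by (intro finite_PiE) auto
      show "PiE I (\<lambda>_. {..<M}) \<subseteq> PiE I (\<lambda>_. UNIV)" by (intro PiE_mono) auto
    qed
    then show "\<forall>\<^sub>F M in sequentially. finite (PiE I (\<lambda>_. {..<M})) \<and> F \<subseteq> PiE I (\<lambda>_. {..<M}) \<and>
        PiE I (\<lambda>_. {..<M}) \<subseteq> PiE I (\<lambda>_. UNIV)"
      by (auto simp: eventually_sequentially)
  qed
  from filterlim_compose[OF S[unfolded has_sum_def] this]
  have "(\<lambda>N. sum f (PiE I (\<lambda>_. {..<N}))) \<longlonglongrightarrow> S" .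
  with lim have "S = L" by (rule LIMSEQ_unique[rotated])
  with S show ?thesis by simp
qed

lemma power_series_zero_one_variable:
  fixes b :: "nat \<Rightarrow> complex"
  assumes "\<And>t. norm t < 1 \<Longrightarrow> (\<lambda>n. t ^ n * b n) sums 0"
  shows "b n = 0"
proof -
  define f where "f = Abs_fps b"
  have sums: "(\<lambda>n. fps_nth f n * t ^ n) sums 0" if "norm t < 1" for t
    using assms[OF that] by (simp add: f_def mult.commute)
  have "ereal (1/2) \<le> fps_conv_radius f"
    unfolding fps_conv_radius_def
    using conv_radius_geI[of "fps_nth f" "1/2"] sums[of "1/2"] by (auto simp: sums_iff)
  then have rad: "fps_conv_radius f > 0"
    by (rule less_le_trans[rotated]) simp
  have "f = 0"
  proof (rule eval_fps_eqD[OF rad])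
    show "fps_conv_radius (0::complex fps) > 0" by simp
    have "\<forall>\<^sub>F t in nhds (0::complex). t \<in> ball 0 1" by (rule eventually_nhds_in_open) auto
    then show "\<forall>\<^sub>F t in nhds 0. eval_fps f t = eval_fps 0 t"
      by eventually_elim (use sums in \<open>auto simp: eval_fps_def sums_iff\<close>)
  qed
  then have "fps_nth f n = 0" by simp
  then show ?thesis by (simp add: f_def)
qed

text \<open>
  Induction on the number of variables. Sorted by powers of one variable \<open>t\<close>, the series is a
  power series in \<open>t\<close> whose coefficients are power series in the remaining variables; the
  identity theorem in \<open>t\<close> makes each of them vanish.
\<close>

lemma power_series_zero:
  fixes c :: "('i \<Rightarrow> nat) \<Rightarrow> complex"
  assumes "finite I"
    and "\<And>z. z \<in> PiE I (\<lambda>_. ball 0 1) \<Longrightarrow>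
      ((\<lambda>k. (\<Prod>i\<in>I. z i ^ k i) * c k) has_sum 0) (PiE I (\<lambda>_. UNIV))"
    and "k \<in> PiE I (\<lambda>_. UNIV)"
  shows "c k = 0"
  using assms
proof (induction I arbitrary: c k rule: finite_induct)
  case empty
  from empty.prems(1)[of "\<lambda>_. undefined"]
  have "((\<lambda>k. c k) has_sum 0) {\<lambda>_. undefined}" by simp
  then have "c (\<lambda>_. undefined) = 0"
    using has_sum_unique has_sum_finite[of "{\<lambda>_. undefined}" c] by fastforce
  then show ?case using empty by simp
next
  case (insert i I)
  define M where "M z g = (\<Prod>j\<in>I. z j ^ g j)" for z :: "'i \<Rightarrow> complex" and g :: "'i \<Rightarrow> nat"
  have double: "((\<lambda>(y, g). t ^ y * (M z g * c (g(i := y)))) has_sum 0) (UNIV \<times> PiE I (\<lambda>_. UNIV))"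
    if z: "z \<in> PiE I (\<lambda>_. ball 0 1)" and t: "norm t < 1" for z t
  proof -
    have "z(i := t) \<in> PiE (insert i I) (\<lambda>_. ball 0 1)"
      using z t by (auto simp: PiE_iff extensional_def)
    from insert.prems(1)[OF this]
    have "((\<lambda>k. (\<Prod>j\<in>insert i I. (z(i := t)) j ^ k j) * c k) has_sum 0)
        ((\<lambda>(y, g). g(i := y)) ` (UNIV \<times> PiE I (\<lambda>_. UNIV)))"
      by (simp only: PiE_insert_eq)
    then have "((\<lambda>k. (\<Prod>j\<in>insert i I. (z(i := t)) j ^ k j) * c k) \<circ> (\<lambda>(y, g). g(i := y)) has_sum 0)
        (UNIV \<times> PiE I (\<lambda>_. UNIV))"
      by (subst (asm) has_sum_reindex) (rule inj_combinator, fact insert.hyps, simp)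
    moreover have "(\<Prod>j\<in>I. (z(i := t)) j ^ (g(i := y)) j) = M z g" for g y
      unfolding M_def using insert.hyps by (intro prod.cong) auto
    ultimately show ?thesis
      using insert.hyps by (simp add: o_def case_prod_beta' mult.assoc del: fun_upd_apply)
        (simp add: fun_upd_same)
  qed
  have summ: "(\<lambda>g. M z g * c (g(i := y))) summable_on PiE I (\<lambda>_. UNIV)"
    if z: "z \<in> PiE I (\<lambda>_. ball 0 1)" for z y
  proof -
    have "(\<lambda>g. (1/2) ^ y * (M z g * c (g(i := y)))) summable_on PiE I (\<lambda>_. UNIV)"
      using summable_on_SigmaD1[of "\<lambda>y g. (1/2) ^ y * (M z g * c (g(i := y)))" UNIV _ y]
        double[OF z, of "1/2"] by (auto simp: summable_on_def)
    then show ?thesis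
      by (subst (asm) summable_on_cmult_right') auto
  qed
  have zero: "(\<Sum>\<^sub>\<infinity>g\<in>PiE I (\<lambda>_. UNIV). M z g * c (g(i := y))) = 0"
    if z: "z \<in> PiE I (\<lambda>_. ball 0 1)" for z y
  proof (rule power_series_zero_one_variable)
    fix t :: complex assume t: "norm t < 1"
    have "((\<lambda>y. t ^ y * (\<Sum>\<^sub>\<infinity>g\<in>PiE I (\<lambda>_. UNIV). M z g * c (g(i := y)))) has_sum 0) UNIV"
    proof (rule has_sum_SigmaD[OF double[OF z t]])
      show "((\<lambda>g. case (y, g) of (y, g) \<Rightarrow> t ^ y * (M z g * c (g(i := y)))) has_sum
          t ^ y * (\<Sum>\<^sub>\<infinity>g\<in>PiE I (\<lambda>_. UNIV). M z g * c (g(i := y)))) (PiE I (\<lambda>_. UNIV))" for y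
        using has_sum_cmult_right[OF has_sum_infsum[OF summ[OF z]]] by simp
    qed
    then show "(\<lambda>y. t ^ y * (\<Sum>\<^sub>\<infinity>g\<in>PiE I (\<lambda>_. UNIV). M z g * c (g(i := y)))) sums 0"
      by (rule has_sum_imp_sums)
  qed
  obtain g y where g: "g \<in> PiE I (\<lambda>_. UNIV)" and k: "k = g(i := y)"
    using insert.prems(2) by (auto simp: PiE_insert_eq)
  have "c (g(i := y)) = 0"
  proof (rule insert.IH[OF _ g])
    fix z :: "'i \<Rightarrow> complex" assume z: "z \<in> PiE I (\<lambda>_. ball 0 1)"
    show "((\<lambda>g. (\<Prod>j\<in>I. z j ^ g j) * c (g(i := y))) has_sum 0) (PiE I (\<lambda>_. UNIV))"
      using has_sum_infsum[OF summ[OF z, of y]] zero[OF z, of y] by (simp add: M_def)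
  qed
  then show ?case by (simp only: k)
qed

text \<open>Pairing with a fixed vector reduces uniqueness to scalar coefficients.\<close>

lemma has_coeffs_unique:
  fixes a b :: "(nat \<Rightarrow> nat) \<Rightarrow> 'e::chilbert_space"
  assumes a: "has_coeffs m f a" and b: "has_coeffs m f b" and k: "k \<in> multi_indices m"
  shows "a k = b k"
proof (rule cinner_eqI)
  fix x :: 'e
  define c where "c k = cinner (a k) x - cinner (b k) x" for k
  have "c k = 0"
  proof (rule power_series_zero[of "{1..m}" c])
    fix z :: "nat \<Rightarrow> complex" assume z: "z \<in> PiE {1..m} (\<lambda>_. ball 0 1)"
    have lin: "((\<lambda>k. monom_at m z k * cinner (d k) x) has_sum cinner (f z) x) (multi_indices m)"
      if "has_coeffs m f d" for d
    proof -
      have "((\<lambda>k. monom_at m z k *\<^sub>C d k) has_sum f z) (multi_indices m)"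
        using that z by (auto simp: has_coeffs_def polydisc_def)
      from has_sum_bounded_linear[OF bounded_linear_cinner_left this, of x]
      show ?thesis by (simp add: cinner_scaleC_left)
    qed
    have "((\<lambda>k. monom_at m z k * cinner (a k) x + - (monom_at m z k * cinner (b k) x)) has_sum
        cinner (f z) x + - cinner (f z) x) (multi_indices m)"
      by (intro has_sum_add has_sum_uminusI lin a b)
    then show "((\<lambda>k. (\<Prod>i\<in>{1..m}. z i ^ k i) * c k) has_sum 0) (PiE {1..m} (\<lambda>_. UNIV))"
      by (simp add: c_def monom_at_def multi_indices_def algebra_simps)
  qed (use k in \<open>simp_all add: multi_indices_def\<close>)
  then have "cinner (a k) x = cinner (b k) x" by (simp add: c_def)
  then show "cinner x (a k) = cinner x (b k)" by (metis cinner_commute)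
qed

lemma has_coeffs_cong:
  "(\<And>k. k \<in> multi_indices m \<Longrightarrow> a k = b k) \<Longrightarrow> has_coeffs m f a = has_coeffs m f b"
  unfolding has_coeffs_def by (intro ball_cong refl has_sum_cong) auto

lemma coeffs_of_eq:
  fixes a :: "(nat \<Rightarrow> nat) \<Rightarrow> 'e::chilbert_space"
  assumes a: "has_coeffs m f a" and k: "k \<in> multi_indices m"
  shows "coeffs_of m f k = a k"
proof -
  have "coeffs_of m f = restrict a (multi_indices m)"
    unfolding coeffs_of_def
  proof (rule the_equality)
    show "restrict a (multi_indices m) \<in> extensional (multi_indices m) \<and>
        has_coeffs m f (restrict a (multi_indices m))"
      using a by (simp add: has_coeffs_cong[of m "restrict a (multi_indices m)" a])
    fix b assume b: "b \<in> extensional (multi_indices m) \<and> has_coeffs m f b"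
    then have "b k = a k" if "k \<in> multi_indices m" for k
      using has_coeffs_unique[OF _ a that] by blast
    then show "b = restrict a (multi_indices m)"
      using b by (intro extensionalityI[of b "multi_indices m"]) auto
  qed
  then show ?thesis using k by simp
qed

abbreviation square_summable :: "nat \<Rightarrow> ((nat \<Rightarrow> nat) \<Rightarrow> 'e::chilbert_space) \<Rightarrow> bool" where
  "square_summable m a \<equiv> (\<lambda>k. (norm (a k))\<^sup>2) summable_on multi_indices m"

lemma hardyI:
  assumes "has_coeffs m f a" "square_summable m a" "\<And>z. z \<notin> polydisc m \<Longrightarrow> f z = 0"
  shows "f \<in> hardy UNIV m"
  using assms unfolding hardy_def by blast

lemma hardyD:
  assumes "f \<in> hardy UNIV m"
  shows "has_coeffs m f (coeffs_of m f)" "square_summable m (coeffs_of m f)"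
    "z \<notin> polydisc m \<Longrightarrow> f z = 0"
proof -
  obtain a where a: "has_coeffs m f a" "square_summable m a"
    using assms unfolding hardy_def by blast
  show "has_coeffs m f (coeffs_of m f)"
    using a(1) coeffs_of_eq[OF a(1)] by (simp add: has_coeffs_cong[of m "coeffs_of m f" a])
  show "square_summable m (coeffs_of m f)"
    using a(2) coeffs_of_eq[OF a(1)] by (subst summable_on_cong[of _ _ "\<lambda>k. (norm (a k))\<^sup>2"]) auto
  show "z \<notin> polydisc m \<Longrightarrow> f z = 0" using assms by (auto simp: hardy_def)
qed

lemma hardy_eqI:
  assumes f: "f \<in> hardy UNIV m" and g: "g \<in> hardy UNIV m"
    and eq: "\<And>k. k \<in> multi_indices m \<Longrightarrow> coeffs_of m f k = coeffs_of m g k"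
  shows "f = g"
proof
  fix z
  show "f z = g z"
  proof (cases "z \<in> polydisc m")
    case True
    have "has_coeffs m g (coeffs_of m f)"
      using hardyD(1)[OF g] has_coeffs_cong[of m "coeffs_of m f" "coeffs_of m g" g] eq by blast
    with hardyD(1)[OF f] True show ?thesis
      unfolding has_coeffs_def using has_sum_unique by blast
  qed (use hardyD(3)[OF f] hardyD(3)[OF g] in simp)
qed

lemma summable_norm_monom:
  assumes "z \<in> polydisc m"
  shows "(\<lambda>k. (cmod (monom_at m z k))\<^sup>2) summable_on multi_indices m"
  unfolding multi_indices_def
proof (rule box_sums_summable[where C = "\<Prod>i=1..m. 1 / (1 - (cmod (z i))\<^sup>2)"])
  fix N
  have z: "(cmod (z i))\<^sup>2 < 1" if "i \<in> {1..m}" for i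
    using assms that by (auto simp: polydisc_def PiE_iff power_less_one_iff abs_square_less_1)
  have "(\<Sum>k\<in>PiE {1..m} (\<lambda>_. {..<N}). (cmod (monom_at m z k))\<^sup>2) =
      (\<Sum>k\<in>PiE {1..m} (\<lambda>_. {..<N}). \<Prod>i=1..m. ((cmod (z i))\<^sup>2) ^ k i)"
    unfolding monom_at_def
    by (simp add: prod_norm[symmetric] norm_power prod_power_distrib power_mult[symmetric] mult.commute)
  also have "\<dots> = (\<Prod>i=1..m. \<Sum>j<N. ((cmod (z i))\<^sup>2) ^ j)"
    by (rule prod_sum_PiE[symmetric]) auto
  also have "\<dots> \<le> (\<Prod>i=1..m. 1 / (1 - (cmod (z i))\<^sup>2))"
  proof (rule prod_mono, rule conjI)
    fix i assume i: "i \<in> {1..m}"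
    show "0 \<le> (\<Sum>j<N. ((cmod (z i))\<^sup>2) ^ j)" by (intro sum_nonneg) auto
    have "(\<Sum>j<N. ((cmod (z i))\<^sup>2) ^ j) \<le> (\<Sum>j. ((cmod (z i))\<^sup>2) ^ j)"
      using z[OF i] by (intro sum_le_suminf summable_geometric) auto
    then show "(\<Sum>j<N. ((cmod (z i))\<^sup>2) ^ j) \<le> 1 / (1 - (cmod (z i))\<^sup>2)"
      using z[OF i] by (subst (asm) suminf_geometric) auto
  qed
  finally show "(\<Sum>k\<in>PiE {1..m} (\<lambda>_. {..<N}). (cmod (monom_at m z k))\<^sup>2) \<le>
      (\<Prod>i=1..m. 1 / (1 - (cmod (z i))\<^sup>2))" .
qed simp_all

definition series :: "nat \<Rightarrow> ((nat \<Rightarrow> nat) \<Rightarrow> 'e::chilbert_space) \<Rightarrow> (nat \<Rightarrow> complex) \<Rightarrow> 'e" where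
  "series m a z = (if z \<in> polydisc m then \<Sum>\<^sub>\<infinity>k\<in>multi_indices m. monom_at m z k *\<^sub>C a k else 0)"

lemma has_coeffs_series:
  assumes "square_summable m a"
  shows "has_coeffs m (series m a) a"
  unfolding has_coeffs_def
proof
  fix z assume z: "z \<in> polydisc m"
  have "(\<lambda>k. norm (monom_at m z k *\<^sub>C a k)) summable_on multi_indices m"
  proof (rule summable_on_comparison_test[OF summable_on_add[OF summable_norm_monom[OF z] assms]])
    fix k
    have "0 \<le> (cmod (monom_at m z k) - norm (a k))\<^sup>2" by simp
    moreover have "0 \<le> cmod (monom_at m z k) * norm (a k)" by simp
    ultimately show "norm (monom_at m z k *\<^sub>C a k) \<le> (cmod (monom_at m z k))\<^sup>2 + (norm (a k))\<^sup>2"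
      unfolding power2_diff norm_scaleC by linarith
  qed simp
  then show "((\<lambda>k. monom_at m z k *\<^sub>C a k) has_sum series m a z) (multi_indices m)"
    using z by (simp add: series_def abs_summable_summable)
qed

lemma series_hardy: "square_summable m a \<Longrightarrow> series m a \<in> hardy UNIV m"
  by (rule hardyI[OF has_coeffs_series]) (auto simp: series_def)

lemma coeffs_of_series:
  "square_summable m a \<Longrightarrow> k \<in> multi_indices m \<Longrightarrow> coeffs_of m (series m a) k = a k"
  by (rule coeffs_of_eq[OF has_coeffs_series])

lemma square_summable_plus:
  assumes "square_summable m a" "square_summable m b"
  shows "square_summable m (\<lambda>k. a k + b k)"
proof (rule summable_on_comparison_test)
  show "(\<lambda>k. 2 * ((norm (a k))\<^sup>2 + (norm (b k))\<^sup>2)) summable_on multi_indices m"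
    by (intro summable_on_cmult_right summable_on_add assms)
  fix k
  have "(norm (a k + b k))\<^sup>2 \<le> (norm (a k) + norm (b k))\<^sup>2"
    by (simp add: norm_triangle_ineq power_mono)
  moreover have "0 \<le> (norm (a k) - norm (b k))\<^sup>2" by simp
  ultimately show "(norm (a k + b k))\<^sup>2 \<le> 2 * ((norm (a k))\<^sup>2 + (norm (b k))\<^sup>2)"
    by (simp add: power2_diff power2_sum)
qed simp

lemma square_summable_linear:
  assumes "square_summable m a" "bounded_clinear A"
  shows "square_summable m (\<lambda>k. A (a k))"
proof -
  obtain C where C: "0 < C" "\<And>x. norm (A x) \<le> norm x * C"
    using bounded_linear.pos_bounded[OF bounded_clinear_bounded_linear[OF assms(2)]] by blast
  show ?thesis
  proof (rule summable_on_comparison_test)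
    show "(\<lambda>k. C\<^sup>2 * (norm (a k))\<^sup>2) summable_on multi_indices m"
      by (intro summable_on_cmult_right assms)
    fix k
    have "(norm (A (a k)))\<^sup>2 \<le> (norm (a k) * C)\<^sup>2" using C(2) by (intro power_mono) auto
    then show "(norm (A (a k)))\<^sup>2 \<le> C\<^sup>2 * (norm (a k))\<^sup>2"
      by (simp add: power_mult_distrib mult.commute)
  qed simp
qed

lemma summable_cinner_coeffs:
  assumes "square_summable m a" "square_summable m b"
  shows "(\<lambda>k. cinner (a k) (b k)) summable_on multi_indices m"
proof -
  have "(\<lambda>k. norm (cinner (a k) (b k))) summable_on multi_indices m"
    by (rule summable_on_comparison_test[OF summable_on_add[OF assms]])
       (simp_all add: cmod_cinner_le)
  then show ?thesis by (rule abs_summable_summable)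
qed

section \<open>Operator pencils on the Hardy space\<close>

lemma bij_betw_raise:
  assumes "i \<in> {1..m}"
  shows "bij_betw (\<lambda>k. k(i := Suc (k i))) (multi_indices m) {k \<in> multi_indices m. k i \<noteq> 0}"
  by (rule bij_betw_byWitness[where f' = "\<lambda>k. k(i := k i - 1)"])
     (use assms in \<open>auto simp: multi_indices_def PiE_iff extensional_def\<close>)

text \<open>
  On coefficients, multiplication by \<open>z\<^sub>i\<close> is the shift in the \<open>i\<close>-th index, with the value \<open>0\<close> where
  the shifted index would be negative.
\<close>

lemma has_sum_shift:
  fixes g :: "(nat \<Rightarrow> nat) \<Rightarrow> 'b::{topological_comm_monoid_add}"
  assumes i: "i \<in> {1..m}" and g: "(g has_sum S) (multi_indices m)"
  shows "((\<lambda>k. if k i = 0 then 0 else g (k(i := k i - 1))) has_sum S) (multi_indices m)"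
proof -
  let ?h = "\<lambda>k. if k i = 0 then 0 else g (k(i := k i - 1))"
  have "((\<lambda>k. ?h (k(i := Suc (k i)))) has_sum S) (multi_indices m)"
    using g by simp
  then have "(?h has_sum S) {k \<in> multi_indices m. k i \<noteq> 0}"
    by (subst (asm) has_sum_reindex_bij_betw[OF bij_betw_raise[OF i]])
  then show ?thesis
    by (subst (asm) has_sum_cong_neutral[where T = "multi_indices m" and g = ?h]) auto
qed

lemma monom_at_raise:
  assumes "i \<in> {1..m}"
  shows "monom_at m z (k(i := Suc (k i))) = z i * monom_at m z k"
proof -
  have "(\<Prod>j\<in>{1..m} - {i}. z j ^ (k(i := Suc (k i))) j) = (\<Prod>j\<in>{1..m} - {i}. z j ^ k j)"
    by (intro prod.cong) auto
  then show ?thesis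
    using assms by (simp add: monom_at_def prod.remove[of _ i] mult.assoc)
qed

definition pencil :: "nat \<Rightarrow> ('e \<Rightarrow> 'e) \<Rightarrow> ('e \<Rightarrow> 'e) \<Rightarrow> (nat \<Rightarrow> complex) \<Rightarrow> 'e::chilbert_space \<Rightarrow> 'e" where
  "pencil i A B z x = A x + z i *\<^sub>C B x"

definition pencil_coeffs where
  "pencil_coeffs i A B a k = A (a k) + (if k i = 0 then 0 else B (a (k(i := k i - 1))))"

lemma has_coeffs_pencil:
  assumes i: "i \<in> {1..m}" and A: "bounded_clinear A" and B: "bounded_clinear B"
    and f: "has_coeffs m f a"
  shows "has_coeffs m (mult_op m (pencil i A B) f) (pencil_coeffs i A B a)"
  unfolding has_coeffs_def
proof
  fix z assume z: "z \<in> polydisc m"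
  have fz: "((\<lambda>k. monom_at m z k *\<^sub>C a k) has_sum f z) (multi_indices m)"
    using f z by (simp add: has_coeffs_def)
  have Az: "((\<lambda>k. monom_at m z k *\<^sub>C A (a k)) has_sum A (f z)) (multi_indices m)"
    using has_sum_bounded_linear[OF bounded_clinear_bounded_linear[OF A] fz]
    by (simp add: bounded_clinear_scaleC[OF A])
  have "((\<lambda>k. z i *\<^sub>C monom_at m z k *\<^sub>C B (a k)) has_sum z i *\<^sub>C B (f z)) (multi_indices m)"
    using has_sum_bounded_linear[OF bounded_linear_scaleC_right
        has_sum_bounded_linear[OF bounded_clinear_bounded_linear[OF B] fz], of "z i"]
    by (simp add: bounded_clinear_scaleC[OF B])
  from has_sum_shift[OF i this]
  have "((\<lambda>k. monom_at m z k *\<^sub>C (if k i = 0 then 0 else B (a (k(i := k i - 1))))) has_sum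
      z i *\<^sub>C B (f z)) (multi_indices m)"
  proof (rule has_sum_cong[THEN iffD1, rotated])
    fix k
    show "(if k i = 0 then 0 else z i *\<^sub>C monom_at m z (k(i := k i - 1)) *\<^sub>C B (a (k(i := k i - 1)))) =
        monom_at m z k *\<^sub>C (if k i = 0 then 0 else B (a (k(i := k i - 1))))"
    proof (cases "k i = 0")
      case False
      then have "k(i := Suc (k i - 1)) = k" by (simp add: fun_upd_idem)
      then have "monom_at m z k = z i * monom_at m z (k(i := k i - 1))"
        using monom_at_raise[OF i, of z "k(i := k i - 1)"] by simp
      with False show ?thesis by (simp add: scaleC_scaleC)
    qed simp
  qed
  from has_sum_add[OF Az this]
  show "((\<lambda>k. monom_at m z k *\<^sub>C pencil_coeffs i A B a k) has_sum mult_op m (pencil i A B) f z)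
      (multi_indices m)"
    using z by (simp add: pencil_coeffs_def scaleC_add_right mult_op_def pencil_def)
qed

text \<open>
  In operator form: \<open>A\<^sup>* A + B\<^sup>* B = 1\<close> and \<open>A\<^sup>* B = 0\<close>, the condition for \<open>A + z B\<close> to be isometric
  on the unit circle and hence for multiplication by the pencil to be isometric.
\<close>

definition isometric_pair :: "('e::chilbert_space \<Rightarrow> 'e) \<Rightarrow> ('e \<Rightarrow> 'e) \<Rightarrow> bool" where
  "isometric_pair A B \<longleftrightarrow> bounded_clinear A \<and> bounded_clinear B \<and>
     (\<forall>x y. (norm (A x + B y))\<^sup>2 = (norm (A x))\<^sup>2 + (norm (B y))\<^sup>2) \<and>
     (\<forall>x. (norm (A x))\<^sup>2 + (norm (B x))\<^sup>2 = (norm x)\<^sup>2)"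

lemma has_sum_norm_pencil_coeffs:
  assumes i: "i \<in> {1..m}" and AB: "isometric_pair A B" and a: "square_summable m a"
  shows "((\<lambda>k. (norm (pencil_coeffs i A B a k))\<^sup>2) has_sum
    (\<Sum>\<^sub>\<infinity>k\<in>multi_indices m. (norm (a k))\<^sup>2)) (multi_indices m)"
proof -
  have lin: "bounded_clinear A" "bounded_clinear B"
    and orth: "\<And>x y. (norm (A x + B y))\<^sup>2 = (norm (A x))\<^sup>2 + (norm (B y))\<^sup>2"
    and iso: "\<And>x. (norm (A x))\<^sup>2 + (norm (B x))\<^sup>2 = (norm x)\<^sup>2"
    using AB by (auto simp: isometric_pair_def)
  obtain s where s: "((\<lambda>k. (norm (A (a k)))\<^sup>2) has_sum s) (multi_indices m)"
    using square_summable_linear[OF a lin(1)] by (auto simp: summable_on_def)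
  obtain t where t: "((\<lambda>k. (norm (B (a k)))\<^sup>2) has_sum t) (multi_indices m)"
    using square_summable_linear[OF a lin(2)] by (auto simp: summable_on_def)
  have "((\<lambda>k. (norm (a k))\<^sup>2) has_sum s + t) (multi_indices m)"
    using has_sum_add[OF s t] by (simp add: iso)
  then have st: "(\<Sum>\<^sub>\<infinity>k\<in>multi_indices m. (norm (a k))\<^sup>2) = s + t" by (rule infsumI)
  have "((\<lambda>k. (norm (A (a k)))\<^sup>2 + (if k i = 0 then 0 else (norm (B (a (k(i := k i - 1)))))\<^sup>2))
      has_sum s + t) (multi_indices m)"
    by (intro has_sum_add s has_sum_shift[OF i t])
  then show ?thesis
    unfolding st
  proof (rule has_sum_cong[THEN iffD1, rotated])
    fix k
    show "(norm (A (a k)))\<^sup>2 + (if k i = 0 then 0 else (norm (B (a (k(i := k i - 1)))))\<^sup>2) =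
        (norm (pencil_coeffs i A B a k))\<^sup>2"
      by (simp add: pencil_coeffs_def orth)
  qed
qed

lemma mult_pencil_hardy:
  assumes i: "i \<in> {1..m}" and AB: "isometric_pair A B" and f: "f \<in> hardy UNIV m"
  shows "mult_op m (pencil i A B) f \<in> hardy UNIV m"
    and "k \<in> multi_indices m \<Longrightarrow> coeffs_of m (mult_op m (pencil i A B) f) k =
      pencil_coeffs i A B (coeffs_of m f) k"
    and "hardy_norm m (mult_op m (pencil i A B) f) = hardy_norm m f"
proof -
  have lin: "bounded_clinear A" "bounded_clinear B" using AB by (auto simp: isometric_pair_def)
  note co = has_coeffs_pencil[OF i lin hardyD(1)[OF f]]
  note su = has_sum_norm_pencil_coeffs[OF i AB hardyD(2)[OF f]]
  show "mult_op m (pencil i A B) f \<in> hardy UNIV m"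
    by (rule hardyI[OF co]) (use su in \<open>auto simp: summable_on_def mult_op_def\<close>)
  show eq: "coeffs_of m (mult_op m (pencil i A B) f) k = pencil_coeffs i A B (coeffs_of m f) k"
    if "k \<in> multi_indices m" for k
    by (rule coeffs_of_eq[OF co that])
  have "(\<Sum>\<^sub>\<infinity>k\<in>multi_indices m. (norm (coeffs_of m (mult_op m (pencil i A B) f) k))\<^sup>2) =
      (\<Sum>\<^sub>\<infinity>k\<in>multi_indices m. (norm (pencil_coeffs i A B (coeffs_of m f) k))\<^sup>2)"
    by (intro infsum_cong) (simp add: eq)
  then show "hardy_norm m (mult_op m (pencil i A B) f) = hardy_norm m f"
    by (simp add: hardy_norm_def infsumI[OF su])
qed

lemma hardy_isometry_pencil:
  assumes i: "i \<in> {1..m}" and AB: "isometric_pair A B"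
  shows "hardy_isometry UNIV m (mult_op m (pencil i A B))"
proof -
  have lin: "bounded_clinear A" "bounded_clinear B" using AB by (auto simp: isometric_pair_def)
  show ?thesis
    unfolding hardy_isometry_def
    using mult_pencil_hardy[OF i AB]
    by (auto simp: fun_eq_iff mult_op_def pencil_def bounded_clinear_add[OF lin(1)]
        bounded_clinear_add[OF lin(2)] bounded_clinear_scaleC[OF lin(1)]
        bounded_clinear_scaleC[OF lin(2)] scaleC_add_right scaleC_scaleC mult.commute)
qed

text \<open>Functions with a single nonzero coefficient read off each coefficient.\<close>

lemma hardy_eqI_inner:
  assumes u: "u \<in> hardy UNIV m" and v: "v \<in> hardy UNIV m"
    and eq: "\<And>f. f \<in> hardy UNIV m \<Longrightarrow> hardy_inner m f u = hardy_inner m f v"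
  shows "u = v"
proof (rule hardy_eqI[OF u v], rule cinner_eqI)
  fix k and x :: 'a assume k: "k \<in> multi_indices m"
  define a where "a l = (if l = k then x else 0)" for l
  have "((\<lambda>l. (norm (a l))\<^sup>2) has_sum (norm x)\<^sup>2) (multi_indices m)"
    by (rule has_sum_finite_neutralI[where B = "{k}"]) (use k in \<open>auto simp: a_def\<close>)
  then have a: "square_summable m a" by (auto simp: summable_on_def)
  have "hardy_inner m (series m a) w = cinner x (coeffs_of m w k)" for w
  proof -
    have "hardy_inner m (series m a) w = (\<Sum>\<^sub>\<infinity>l\<in>multi_indices m. cinner (a l) (coeffs_of m w l))"
      unfolding hardy_inner_def by (intro infsum_cong) (simp add: coeffs_of_series[OF a])
    also have "\<dots> = cinner x (coeffs_of m w k)"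
      by (rule infsumI, rule has_sum_finite_neutralI[where B = "{k}"])
         (use k in \<open>auto simp: a_def\<close>)
    finally show ?thesis .
  qed
  then show "cinner x (coeffs_of m u k) = cinner x (coeffs_of m v k)"
    using eq[OF series_hardy[OF a]] by simp
qed

lemma square_summable_raise:
  assumes i: "i \<in> {1..m}" and b: "square_summable m b"
  shows "square_summable m (\<lambda>k. b (k(i := Suc (k i))))"
proof -
  have "(\<lambda>k. (norm (b k))\<^sup>2) summable_on {k \<in> multi_indices m. k i \<noteq> 0}"
    by (rule summable_on_subset[OF b]) auto
  then show ?thesis
    using summable_on_reindex_bij_betw[OF bij_betw_raise[OF i], of "\<lambda>k. (norm (b k))\<^sup>2"] by simp
qed

text \<open>
  Summation by parts: shifting the index in the terms with \<open>B\<close> moves multiplication by \<open>z\<^sub>i\<close> to the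
  other factor as the backward shift of coefficients.
\<close>

lemma hardy_adjoint_pencil:
  assumes i: "i \<in> {1..m}" and AB: "isometric_pair A B"
    and A': "bounded_clinear A'" "\<And>x y. cinner (A x) y = cinner x (A' y)"
    and B': "bounded_clinear B'" "\<And>x y. cinner (B x) y = cinner x (B' y)"
    and b: "square_summable m b"
  shows "hardy_adjoint UNIV m (mult_op m (pencil i A B)) (series m b) =
    series m (\<lambda>k. A' (b k) + B' (b (k(i := Suc (k i)))))"
proof -
  let ?M = "mult_op m (pencil i A B)"
  let ?u = "\<lambda>k. A' (b k) + B' (b (k(i := Suc (k i))))"
  note b' = square_summable_raise[OF i b]
  have u: "square_summable m ?u"
    by (intro square_summable_plus square_summable_linear[OF b A'(1)]
        square_summable_linear[OF b' B'(1)])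
  have adj: "hardy_inner m (?M f) (series m b) = hardy_inner m f (series m ?u)"
    if f: "f \<in> hardy UNIV m" for f
  proof -
    let ?a = "coeffs_of m f"
    note a = hardyD(2)[OF f]
    obtain s where s: "((\<lambda>k. cinner (?a k) (A' (b k))) has_sum s) (multi_indices m)"
      using summable_cinner_coeffs[OF a square_summable_linear[OF b A'(1)]]
      by (auto simp: summable_on_def)
    obtain t where t: "((\<lambda>k. cinner (?a k) (B' (b (k(i := Suc (k i)))))) has_sum t) (multi_indices m)"
      using summable_cinner_coeffs[OF a square_summable_linear[OF b' B'(1)]]
      by (auto simp: summable_on_def)
    have "hardy_inner m f (series m ?u) = (\<Sum>\<^sub>\<infinity>k\<in>multi_indices m. cinner (?a k) (?u k))"
      unfolding hardy_inner_def by (intro infsum_cong) (simp only: coeffs_of_series[OF u])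
    also have "\<dots> = s + t"
      using has_sum_add[OF s t] by (intro infsumI) (simp add: cinner_add_right)
    finally have right: "hardy_inner m f (series m ?u) = s + t" .
    have "hardy_inner m (?M f) (series m b) =
        (\<Sum>\<^sub>\<infinity>k\<in>multi_indices m. cinner (pencil_coeffs i A B ?a k) (b k))"
      unfolding hardy_inner_def
      by (intro infsum_cong) (simp only: coeffs_of_series[OF b] mult_pencil_hardy(2)[OF i AB f])
    also have "\<dots> = s + t"
    proof (rule infsumI, rule has_sum_cong[THEN iffD1, OF _ has_sum_add[OF s has_sum_shift[OF i t]]])
      fix k
      show "cinner (?a k) (A' (b k)) + (if k i = 0 then 0 else cinner (?a (k(i := k i - 1)))
          (B' (b ((k(i := k i - 1))(i := Suc ((k(i := k i - 1)) i)))))) =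
          cinner (pencil_coeffs i A B ?a k) (b k)"
        by (simp add: pencil_coeffs_def cinner_add_left A'(2) B'(2))
    qed
    finally show ?thesis using right by simp
  qed
  show ?thesis
    unfolding hardy_adjoint_def adjoint_on_def
  proof (rule the_equality)
    show "series m ?u \<in> hardy UNIV m \<and>
        (\<forall>f\<in>hardy UNIV m. hardy_inner m (?M f) (series m b) = hardy_inner m f (series m ?u))"
      using series_hardy[OF u] adj by blast
    fix w assume w: "w \<in> hardy UNIV m \<and>
        (\<forall>f\<in>hardy UNIV m. hardy_inner m (?M f) (series m b) = hardy_inner m f w)"
    show "w = series m ?u"
    proof (rule hardy_eqI_inner)
      show "hardy_inner m f w = hardy_inner m f (series m ?u)" if "f \<in> hardy UNIV m" for f
        using w adj[OF that] that by metis
    qed (use w series_hardy[OF u] in auto)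
  qed
qed

lemma onorm_on_zero: "onorm_on UNIV (\<lambda>x. 0) = 0"
  by (simp add: onorm_on_def)

lemma pencil_Hinfty:
  assumes i: "i \<in> {1..m}" and AB: "isometric_pair A B"
  shows "pencil i A B \<in> Hinfty UNIV m"
proof -
  have lin: "bounded_clinear A" "bounded_clinear B" using AB by (auto simp: isometric_pair_def)
  have le: "norm (A x) \<le> norm x" "norm (B x) \<le> norm x" for x
  proof -
    have "(norm (A x))\<^sup>2 + (norm (B x))\<^sup>2 = (norm x)\<^sup>2" using AB by (auto simp: isometric_pair_def)
    then have "(norm (A x))\<^sup>2 \<le> (norm x)\<^sup>2" "(norm (B x))\<^sup>2 \<le> (norm x)\<^sup>2"
      by (metis le_add_same_cancel1 zero_le_power2, metis le_add_same_cancel2 zero_le_power2)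
    then show "norm (A x) \<le> norm x" "norm (B x) \<le> norm x"
      by (auto intro: power2_le_imp_le)
  qed
  have ops: "pencil i A B z \<in> bounded_ops UNIV" for z
    unfolding bounded_ops_UNIV pencil_def[abs_def]
    by (rule bounded_clinear_plus[OF lin(1)
          bounded_clinear_comp[OF bounded_clinear_scaleC_right lin(2)]])
  have bound: "onorm_on UNIV (pencil i A B z) \<le> 2" if z: "z \<in> polydisc m" for z
    unfolding onorm_on_def
  proof (rule cSUP_least)
    fix x :: 'a
    have "cmod (z i) \<le> 1" using z i by (auto simp: polydisc_def PiE_iff less_imp_le)
    then have "cmod (z i) * norm (B x) \<le> 1 * norm x"
      using le(2) by (intro mult_mono) auto
    then have "norm (pencil i A B z x) \<le> 2 * norm x"
      using norm_triangle_ineq[of "A x" "z i *\<^sub>C B x"] le(1)[of x]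
      by (simp add: pencil_def norm_scaleC)
    then show "norm (pencil i A B z x) / norm x \<le> 2"
      by (cases "x = 0") (auto simp: divide_le_eq)
  qed simp
  \<comment> \<open>The pencil has coefficient \<open>A\<close> at the zero multi-index and \<open>B\<close> at the \<open>i\<close>-th unit multi-index.\<close>
  define k0 where "k0 = (\<lambda>j\<in>{1..m}. 0::nat)"
  define k1 where "k1 = k0(i := 1)"
  have k01: "k0 \<in> multi_indices m" "k1 \<in> multi_indices m" "k0 \<noteq> k1"
    using i by (auto simp: k0_def k1_def multi_indices_def fun_eq_iff)
  have mon: "monom_at m z k0 = 1" "monom_at m z k1 = z i" for z
  proof -
    show k0: "monom_at m z k0 = 1" by (simp add: monom_at_def k0_def)
    show "monom_at m z k1 = z i"
      using monom_at_raise[OF i, of z k0] i k0 by (simp add: k1_def k0_def)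
  qed
  define C where "C k = (if k = k0 then A else if k = k1 then B else (\<lambda>x. 0))" for k
  have Cops: "C k \<in> bounded_ops UNIV" for k
    by (simp add: C_def bounded_ops_UNIV lin bounded_clinear_const_zero)
  have conv: "((\<lambda>F. onorm_on UNIV (\<lambda>x. pencil i A B z x - (\<Sum>k\<in>F. monom_at m z k *\<^sub>C C k x))) \<longlongrightarrow> 0)
      (finite_subsets_at_top (multi_indices m))" for z
  proof (rule tendsto_eventually)
    have "onorm_on UNIV (\<lambda>x. pencil i A B z x - (\<Sum>k\<in>F. monom_at m z k *\<^sub>C C k x)) = 0"
      if F: "finite F" "{k0, k1} \<subseteq> F" for F
    proof -
      have "(\<Sum>k\<in>F. monom_at m z k *\<^sub>C C k x) = pencil i A B z x" for x
      proof -
        have "(\<Sum>k\<in>F. monom_at m z k *\<^sub>C C k x) = (\<Sum>k\<in>{k0, k1}. monom_at m z k *\<^sub>C C k x)"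
          using F by (intro sum.mono_neutral_right) (auto simp: C_def)
        then show ?thesis using k01 by (simp add: C_def mon pencil_def)
      qed
      then show ?thesis by (simp add: onorm_on_zero)
    qed
    then show "\<forall>\<^sub>F F in finite_subsets_at_top (multi_indices m).
        onorm_on UNIV (\<lambda>x. pencil i A B z x - (\<Sum>k\<in>F. monom_at m z k *\<^sub>C C k x)) = 0"
      unfolding eventually_finite_subsets_at_top using k01
      by (intro exI[of _ "{k0, k1}"]) auto
  qed
  show ?thesis
    unfolding Hinfty_def using ops bound Cops conv by blast
qed

lemma pencil_polynomial:
  assumes "isometric_pair A B"
  shows "polynomial_in_coord UNIV m i 1 (pencil i A B)"
  unfolding polynomial_in_coord_def
  by (rule exI[of _ "\<lambda>j. if j = 0 then A else B"])
     (use assms in \<open>auto simp: isometric_pair_def bounded_ops_UNIV pencil_def\<close>)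

lemma isometric_pair_coord: "isometric_pair (\<lambda>x. 0) (\<lambda>x. x)"
  by (simp add: isometric_pair_def bounded_clinear_ident bounded_clinear_const_zero)

lemma mult_coord_pencil: "mult_coord m i = mult_op m (pencil i (\<lambda>x. 0) (\<lambda>x. x))"
  by (simp add: mult_coord_def pencil_def[abs_def])

section \<open>The dilation\<close>

text \<open>
  Complementary orthogonal projections \<open>P\<close>, \<open>P'\<close> sandwiched between isometries give the pencils
  \<open>L (P + z P') M\<close>.
\<close>

lemma isometric_pair_orthogonal_split:
  assumes lin: "bounded_clinear P" "bounded_clinear P'"
    and split: "\<And>x. P x + P' x = x" and orth: "\<And>x y. cinner (P x) (P' y) = 0"
    and L: "bounded_clinear L" "\<And>x. norm (L x) = norm x"
    and M: "bounded_clinear M" "\<And>x. norm (M x) = norm x"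
  shows "isometric_pair (\<lambda>x. L (P (M x))) (\<lambda>x. L (P' (M x)))"
proof -
  have pyth: "(norm (P x + P' y))\<^sup>2 = (norm (P x))\<^sup>2 + (norm (P' y))\<^sup>2" for x y
  proof -
    have "inner (P x) (P' y) = 0" using arg_cong[OF orth[of x y], of Re] by (simp add: Re_cinner)
    then show ?thesis
      by (simp add: power2_norm_eq_inner inner_add_left inner_add_right inner_commute)
  qed
  show ?thesis
    unfolding isometric_pair_def
    using pyth split bounded_clinear_add[OF L(1), symmetric]
    by (auto simp: L(2) M(2) split intro!: bounded_clinear_comp[OF L(1)] bounded_clinear_comp[OF lin(1) M(1)]
        bounded_clinear_comp[OF lin(2) M(1)]) (metis M(2) split)
qed

lemma series_add:
  assumes "square_summable m a" "square_summable m b"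
  shows "series m (\<lambda>k. a k + b k) = (\<lambda>z. series m a z + series m b z)"
proof
  fix z
  show "series m (\<lambda>k. a k + b k) z = series m a z + series m b z"
  proof (cases "z \<in> polydisc m")
    case True
    have "((\<lambda>k. monom_at m z k *\<^sub>C a k + monom_at m z k *\<^sub>C b k) has_sum
        series m a z + series m b z) (multi_indices m)"
      using assms True has_coeffs_series[OF assms(1)] has_coeffs_series[OF assms(2)]
      by (intro has_sum_add) (auto simp: has_coeffs_def)
    from infsumI[OF this] True show ?thesis
      by (simp add: series_def scaleC_add_right)
  qed (simp add: series_def)
qed

lemma series_scaleC:
  assumes "square_summable m a"
  shows "series m (\<lambda>k. c *\<^sub>C a k) = (\<lambda>z. c *\<^sub>C series m a z)"
proof
  fix z
  show "series m (\<lambda>k. c *\<^sub>C a k) z = c *\<^sub>C series m a z"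
  proof (cases "z \<in> polydisc m")
    case True
    have "((\<lambda>k. monom_at m z k *\<^sub>C a k) has_sum series m a z) (multi_indices m)"
      using True has_coeffs_series[OF assms] by (simp add: has_coeffs_def)
    from infsumI[OF has_sum_bounded_linear[OF bounded_linear_scaleC_right this, of c]] True
    show ?thesis by (simp add: series_def scaleC_scaleC mult.commute)
  qed (simp add: series_def)
qed

text \<open>
  When \<open>R\<^sub>i\<close> is the adjoint of \<open>T\<^sub>i\<close> and \<open>W\<close> is the square root of the inverse Szego kernel, this is
  the canonical dilation map of a pure tuple \<open>T\<close>. Any \<open>W\<close> with the same quadratic form serves
  equally well, which leaves room to choose one adapted to \<open>T\<^sub>p\<close> and \<open>T\<^sub>q\<close>.
\<close>

definition hardy_embedding ::
  "nat \<Rightarrow> (nat \<Rightarrow> 'h \<Rightarrow> 'h) \<Rightarrow> ('h \<Rightarrow> 'e::chilbert_space) \<Rightarrow> 'h \<Rightarrow> (nat \<Rightarrow> complex) \<Rightarrow> 'e" where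
  "hardy_embedding m R W h = series m (\<lambda>k. W (powers [1..<Suc m] R k h))"

lemma isometry_hardy_embedding:
  fixes W :: "'h::chilbert_space \<Rightarrow> 'e::chilbert_space"
  assumes R: "\<And>i. i \<in> {1..m} \<Longrightarrow> bounded_clinear (R i)" and W: "bounded_clinear W"
    and sum: "\<And>h. ((\<lambda>k. (norm (W (powers [1..<Suc m] R k h)))\<^sup>2) has_sum (norm h)\<^sup>2) (multi_indices m)"
  shows "isometry_to_hardy UNIV m (hardy_embedding m R W)"
proof -
  have sq: "square_summable m (\<lambda>k. W (powers [1..<Suc m] R k h))" for h
    using sum[of h] by (auto simp: summable_on_def)
  have P: "bounded_clinear (powers [1..<Suc m] R k)" for k
    by (rule bounded_clinear_powers) (use R in auto)
  have norm: "hardy_norm m (hardy_embedding m R W h) = norm h" for h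
  proof -
    have "(\<Sum>\<^sub>\<infinity>k\<in>multi_indices m. (norm (coeffs_of m (hardy_embedding m R W h) k))\<^sup>2) =
        (\<Sum>\<^sub>\<infinity>k\<in>multi_indices m. (norm (W (powers [1..<Suc m] R k h)))\<^sup>2)"
      unfolding hardy_embedding_def by (intro infsum_cong) (simp only: coeffs_of_series[OF sq])
    also have "\<dots> = (norm h)\<^sup>2" by (rule infsumI[OF sum])
    finally show ?thesis by (simp add: hardy_norm_def)
  qed
  show ?thesis
    unfolding isometry_to_hardy_def
  proof (intro conjI allI)
    show "hardy_embedding m R W h \<in> hardy UNIV m" for h
      unfolding hardy_embedding_def by (rule series_hardy[OF sq])
    show "hardy_embedding m R W (h + g) = (\<lambda>z. hardy_embedding m R W h z + hardy_embedding m R W g z)"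
      for h g
      unfolding hardy_embedding_def series_add[OF sq sq, symmetric]
      by (simp only: bounded_clinear_add[OF P] bounded_clinear_add[OF W])
    show "hardy_embedding m R W (c *\<^sub>C h) = (\<lambda>z. c *\<^sub>C hardy_embedding m R W h z)" for c h
      unfolding hardy_embedding_def series_scaleC[OF sq, symmetric]
      by (simp only: bounded_clinear_scaleC[OF P] bounded_clinear_scaleC[OF W])
  qed (rule norm)
qed

text \<open>
  The \<open>k\<close>-th coefficients of both sides are \<open>W (Q g)\<close> and \<open>A' (W g) + B' (W (R i g))\<close> at
  \<open>g = R^k h\<close>, because \<open>Q\<close> and \<open>R i\<close> commute with the monomials.
\<close>

lemma hardy_embedding_intertwines:
  fixes W :: "'h::chilbert_space \<Rightarrow> 'e::chilbert_space"
  assumes i: "i \<in> {1..m}" and AB: "isometric_pair A B"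
    and A': "bounded_clinear A'" "\<And>x y. cinner (A x) y = cinner x (A' y)"
    and B': "bounded_clinear B'" "\<And>x y. cinner (B x) y = cinner x (B' y)"
    and sq: "square_summable m (\<lambda>k. W (powers [1..<Suc m] R k h))"
    and comm: "pairwise_commuting (insert Q (R ` {1..m}))"
    and W: "\<And>g. W (Q g) = A' (W g) + B' (W (R i g))"
  shows "hardy_embedding m R W (Q h) =
    hardy_adjoint UNIV m (mult_op m (pencil i A B)) (hardy_embedding m R W h)"
proof -
  let ?P = "powers [1..<Suc m] R"
  have set: "set [1..<Suc m] = {1..m}" by auto
  have Q: "Q (?P k h) = ?P k (Q h)" for k
    by (rule powers_commute, rule pairwise_commutingD[OF comm]) auto
  have RP: "R i (?P k h) = ?P k (R i h)" for k
    by (rule powers_commute, rule pairwise_commutingD[OF comm]) (use i in auto)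
  have step: "?P (k(i := Suc (k i))) h = R i (?P k h)" for k
    unfolding RP
  proof (rule powers_step)
    show "pairwise_commuting (R ` set [1..<Suc m])"
      unfolding set by (rule pairwise_commuting_subset[OF comm]) auto
  qed (use i in auto)
  show ?thesis
    unfolding hardy_embedding_def hardy_adjoint_pencil[OF i AB A' B' sq] step W[symmetric] Q ..
qed

lemma mult_op_commute:
  assumes "\<And>z x. z \<in> polydisc m \<Longrightarrow> \<Phi> z (\<Psi> z x) = \<Psi> z (\<Phi> z x)"
  shows "mult_op m \<Phi> (mult_op m \<Psi> f) = mult_op m \<Psi> (mult_op m \<Phi> f)"
  using assms by (auto simp: mult_op_def fun_eq_iff)

lemma funpow_comp_commute:
  assumes "\<And>h. f (g h) = g (f h)"
  shows "((\<lambda>h. f (g h)) ^^ N) h = (f ^^ N) ((g ^^ N) h)"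
proof (induction N)
  case (Suc N)
  have "g ((f ^^ N) k) = (f ^^ N) (g k)" for k
    by (rule funpow_commute[symmetric]) (rule assms)
  then show ?case by (simp add: Suc)
qed simp

text \<open>
  The tuple of length \<open>n - 1\<close> that is dilated to the coordinate multiplications: the product of
  the entries \<open>p\<close> and \<open>q\<close> takes the place \<open>p\<close>, and the entries after \<open>q\<close> move down.
\<close>

definition merge_entries :: "nat \<Rightarrow> nat \<Rightarrow> (nat \<Rightarrow> 'h \<Rightarrow> 'h) \<Rightarrow> nat \<Rightarrow> 'h \<Rightarrow> 'h" where
  "merge_entries p q R i =
     (if i = p then (\<lambda>h. R p (R q h)) else if i < q then R i else R (Suc i))"

definition entries_except :: "nat \<Rightarrow> nat \<Rightarrow> nat \<Rightarrow> (nat \<Rightarrow> 'b) \<Rightarrow> 'b list" where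
  "entries_except n p q R = map R [1..<p] @ map R [Suc p..<q] @ map R [Suc q..<Suc n]"

lemma upt_split3:
  assumes "1 \<le> p" "p < q" "q \<le> n"
  shows "[1..<q] = [1..<p] @ p # [Suc p..<q]" "[Suc p..<Suc n] = [Suc p..<q] @ q # [Suc q..<Suc n]"
    "[1..<n] = [1..<p] @ p # [Suc p..<q] @ [q..<n]"
proof -
  have a: "[a..<c] = [a..<b] @ [b..<c]" if "a \<le> b" "b \<le> c" for a b c :: nat
    using upt_add_eq_append[OF that(1), of "c - b"] that by simp
  have b: "[a..<c] = a # [Suc a..<c]" if "a < c" for a c :: nat
    using that by (rule upt_conv_Cons)
  show "[1..<q] = [1..<p] @ p # [Suc p..<q]"
    using a[of 1 p q] b[of p q] assms by simp
  show "[Suc p..<Suc n] = [Suc p..<q] @ q # [Suc q..<Suc n]"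
    using a[of "Suc p" q "Suc n"] b[of q "Suc n"] assms by simp
  show "[1..<n] = [1..<p] @ p # [Suc p..<q] @ [q..<n]"
    using a[of 1 p n] b[of p n] a[of "Suc p" q n] assms by simp
qed

lemma map_Suc_entries: "map (\<lambda>i. R (Suc i)) [a..<b] = map R [Suc a..<Suc b]"
  by (simp add: map_Suc_upt[symmetric] o_def del: map_Suc_upt upt_Suc)

text \<open>
  The three shortened tuples share the entries other than \<open>p\<close> and \<open>q\<close>. Their order is immaterial
  for iterated differences along commuting maps, so multisets suffice.
\<close>

lemma entries_mset:
  assumes "1 \<le> p" "p < q" "q \<le> n"
  shows "mset (map (\<lambda>i. f (remove_entry p T i)) [1..<n]) =
      mset (f (T q) # entries_except n p q (\<lambda>i. f (T i)))"
    and "mset (map (\<lambda>i. f (remove_entry q T i)) [1..<n]) =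
      mset (f (T p) # entries_except n p q (\<lambda>i. f (T i)))"
    and "mset (map (merge_entries p q R) [1..<n]) =
      mset ((\<lambda>h. R p (R q h)) # entries_except n p q R)"
proof -
  note split = upt_split3[OF assms]
  let ?R = "\<lambda>i. f (T i)"
  have "map (\<lambda>i. f (remove_entry p T i)) [1..<n] =
      map (\<lambda>i. f (remove_entry p T i)) [1..<p] @ map (\<lambda>i. f (remove_entry p T i)) [p..<n]"
    using upt_add_eq_append[of 1 p "n - p"] assms by simp
  also have "map (\<lambda>i. f (remove_entry p T i)) [1..<p] = map ?R [1..<p]"
    by (simp add: remove_entry_def)
  also have "map (\<lambda>i. f (remove_entry p T i)) [p..<n] = map (\<lambda>i. ?R (Suc i)) [p..<n]"
    by (simp add: remove_entry_def)
  finally show "mset (map (\<lambda>i. f (remove_entry p T i)) [1..<n]) = mset (f (T q) # entries_except n p q ?R)"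
    by (simp only: map_Suc_entries[of ?R] split(2) entries_except_def map_append list.map) simp
  have "map (\<lambda>i. f (remove_entry q T i)) [1..<n] =
      map (\<lambda>i. f (remove_entry q T i)) [1..<q] @ map (\<lambda>i. f (remove_entry q T i)) [q..<n]"
    using upt_add_eq_append[of 1 q "n - q"] assms by simp
  also have "map (\<lambda>i. f (remove_entry q T i)) [1..<q] = map ?R [1..<q]"
    by (simp add: remove_entry_def)
  also have "map (\<lambda>i. f (remove_entry q T i)) [q..<n] = map (\<lambda>i. ?R (Suc i)) [q..<n]"
    by (simp add: remove_entry_def)
  finally show "mset (map (\<lambda>i. f (remove_entry q T i)) [1..<n]) = mset (f (T p) # entries_except n p q ?R)"
    by (simp only: map_Suc_entries[of ?R] split(1) entries_except_def map_append list.map) simp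
  have "map (merge_entries p q R) [q..<n] = map (\<lambda>i. R (Suc i)) [q..<n]"
    using assms by (auto simp: merge_entries_def)
  moreover have "map (merge_entries p q R) [1..<p] = map R [1..<p]"
    "map (merge_entries p q R) [Suc p..<q] = map R [Suc p..<q]"
    "merge_entries p q R p = (\<lambda>h. R p (R q h))"
    using assms by (auto simp: merge_entries_def)
  ultimately show "mset (map (merge_entries p q R) [1..<n]) =
      mset ((\<lambda>h. R p (R q h)) # entries_except n p q R)"
    unfolding split(3) map_append list.map
    by (simp only: map_Suc_entries entries_except_def) simp
qed

theorem theorem5p3:
  fixes T :: "nat \<Rightarrow> 'h::chilbert_space \<Rightarrow> 'h"
    and n p q :: nat
  assumes "3 \<le> n" and "1 \<le> p" and "p < q" and "q \<le> n"
    and "T \<in> Tpq n p q"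
  shows "\<exists>(E :: 'h ell2 set) \<Pi>\<^sub>0 \<Phi>\<^sub>p \<Phi>\<^sub>q.
    closed_csubspace E \<and>
    isometry_to_hardy E (n - 1) \<Pi>\<^sub>0 \<and>
    (\<forall>i h. 1 \<le> i \<and> i < q \<and> i \<noteq> p \<longrightarrow>
       \<Pi>\<^sub>0 (cadjoint (T i) h) = hardy_adjoint E (n - 1) (mult_coord (n - 1) i) (\<Pi>\<^sub>0 h)) \<and>
    (\<forall>h. \<Pi>\<^sub>0 (cadjoint (T p) h) = hardy_adjoint E (n - 1) (mult_op (n - 1) \<Phi>\<^sub>p) (\<Pi>\<^sub>0 h)) \<and>
    (\<forall>h. \<Pi>\<^sub>0 (cadjoint (T q) h) = hardy_adjoint E (n - 1) (mult_op (n - 1) \<Phi>\<^sub>q) (\<Pi>\<^sub>0 h)) \<and>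
    (\<forall>i h. q < i \<and> i \<le> n \<longrightarrow>
       \<Pi>\<^sub>0 (cadjoint (T i) h) = hardy_adjoint E (n - 1) (mult_coord (n - 1) (i - 1)) (\<Pi>\<^sub>0 h)) \<and>
    \<Phi>\<^sub>p \<in> Hinfty E (n - 1) \<and> \<Phi>\<^sub>q \<in> Hinfty E (n - 1) \<and>
    inner_function E (n - 1) \<Phi>\<^sub>p \<and> inner_function E (n - 1) \<Phi>\<^sub>q \<and>
    polynomial_in_coord E (n - 1) p 1 \<Phi>\<^sub>p \<and> polynomial_in_coord E (n - 1) p 1 \<Phi>\<^sub>q \<and>
    (\<forall>z\<in>polydisc (n - 1). \<forall>x\<in>E.
       \<Phi>\<^sub>p z (\<Phi>\<^sub>q z x) = z p *\<^sub>C x \<and> \<Phi>\<^sub>q z (\<Phi>\<^sub>p z x) = z p *\<^sub>C x) \<and>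
    dilates_to_via E (n - 1) n T
      (\<lambda>i. if i = p then mult_op (n - 1) \<Phi>\<^sub>p
           else if i = q then mult_op (n - 1) \<Phi>\<^sub>q
           else if i < q then mult_coord (n - 1) i
           else mult_coord (n - 1) (i - 1))
      \<Pi>\<^sub>0"
proof -
  define m where "m = n - 1"
  have n: "Suc m = n" and m: "p \<in> {1..m}" using assms by (auto simp: m_def)
  have Tn: "T \<in> commuting_contractions n" using assms(5) by (simp add: Tpq_def)
  define R where "R i = cadjoint (T i)" for i
  define R' where "R' = merge_entries p q R"
  define L where "L = entries_except n p q R"
  have Rlin: "bounded_clinear (R i)" and Rle: "norm (R i h) \<le> norm h" if "i \<in> {1..n}" for i h
    using commuting_contractionsD[OF Tn that] by (simp_all add: R_def)
  have pq: "p \<in> {1..n}" "q \<in> {1..n}" using assms by auto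
  have Rcomm: "R i (R j h) = R j (R i h)" if "i \<in> {1..n}" "j \<in> {1..n}" for i j h
    unfolding R_def by (rule commuting_contractions_adjoint_commute[OF Tn that])
  define F where "F = insert (\<lambda>h. R p (R q h)) (R ` {1..n})"
  have comm: "pairwise_commuting F"
  proof -
    have "R i (R p (R q h)) = R p (R q (R i h))" if "i \<in> {1..n}" for i h
      using Rcomm[OF that pq(1)] Rcomm[OF that pq(2)] by simp
    then show ?thesis
      unfolding F_def pairwise_commuting_def using Rcomm by auto
  qed
  have LF: "set L \<subseteq> F" and R'F: "R' i \<in> F" if "i \<in> {1..m}" for i
    using assms that n by (auto simp: L_def entries_except_def F_def R'_def merge_entries_def)
  have RF: "R i \<in> F" if "i \<in> {1..n}" for i using that by (simp add: F_def)
  have LF: "set L \<subseteq> F" by (rule LF[OF m])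

  \<comment> \<open>\<open>G\<close> is the iterated difference along the entries other than \<open>p\<close> and \<open>q\<close>. One further difference
    along \<open>R q\<close>, \<open>R p\<close> or their composite gives the Szego forms of the three shortened tuples.\<close>
  define G where "G = fold diff_along L (\<lambda>h::'h. (norm h)\<^sup>2)"
  have foldL: "fold diff_along Rs (\<lambda>h. (norm h)\<^sup>2) h = G h - G (X h)"
    if "mset Rs = mset (X # L)" "X \<in> F" for Rs X h
  proof -
    have "set Rs \<subseteq> F" using LF that mset_eq_setD[OF that(1)] by auto
    then have "fold diff_along Rs = fold diff_along (X # L)"
      using fold_diff_along_permute[OF pairwise_commuting_subset[OF comm] that(1)] by blast
    moreover have "fold diff_along L (\<lambda>h. (norm (X h))\<^sup>2) h = G (X h)"
      unfolding G_def
      by (rule fold_diff_along_comp[of L X "\<lambda>h. (norm h)\<^sup>2"], rule pairwise_commutingD[OF comm that(2)])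
         (use LF in blast)
    ultimately show ?thesis by (simp only: fold_diff_along_Cons G_def[symmetric])
  qed
  have xs: "[1..<Suc m] = [1..<n]" by (simp only: n)
  have rp: "remove_entry p T \<in> commuting_contractions m" "positive_op (szego_inverse m (remove_entry p T))"
    and rq: "remove_entry q T \<in> commuting_contractions m" "positive_op (szego_inverse m (remove_entry q T))"
    and pure_p: "pure_tuple m (remove_entry p T)"
    using assms(5) by (simp_all add: Tpq_def szego_tuples_def m_def)
  note mset = entries_mset[OF assms(2-4)]
  have form_p: "inner (szego_inverse m (remove_entry p T) h) h = G h - G (R q h)" for h
    unfolding szego_inverse_form(2)[OF rp(1)] xs
    by (rule foldL) (use mset(1)[of cadjoint T] RF[OF pq(2)] in \<open>simp_all only: L_def R_def[abs_def]\<close>)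
  have form_q: "inner (szego_inverse m (remove_entry q T) h) h = G h - G (R p h)" for h
    unfolding szego_inverse_form(2)[OF rq(1)] xs
    by (rule foldL) (use mset(2)[of cadjoint T] RF[OF pq(1)] in \<open>simp_all only: L_def R_def[abs_def]\<close>)
  obtain dp :: "'h \<Rightarrow> 'h ell2" where dp: "bounded_clinear dp"
    "\<And>h. (norm (dp h))\<^sup>2 = G h - G (R q h)"
    using positive_op_factor[OF szego_inverse_form(1)[OF rp(1)] rp(2)] form_p by metis
  obtain dq :: "'h \<Rightarrow> 'h ell2" where dq: "bounded_clinear dq"
    "\<And>h. (norm (dq h))\<^sup>2 = G h - G (R p h)"
    using positive_op_factor[OF szego_inverse_form(1)[OF rq(1)] rq(2)] form_q by metis

  \<comment> \<open>The squared norms are \<open>(G h - G (R p h)) + (G (R p h) - G (R q (R p h)))\<close> and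
    \<open>(G (R q h) - G (R p (R q h))) + (G h - G (R q h))\<close>: two telescopings of the same difference.\<close>
  define v where "v h = even_in (dq h) + odd_in (dp (R p h))" for h
  define w where "w h = even_in (dq (R q h)) + odd_in (dp h)" for h
  have vlin: "bounded_clinear v" and wlin: "bounded_clinear w"
    unfolding v_def[abs_def] w_def[abs_def]
    by (intro bounded_clinear_plus bounded_clinear_comp[OF bounded_clinear_even_in]
        bounded_clinear_comp[OF bounded_clinear_odd_in] bounded_clinear_comp[OF dp(1)]
        bounded_clinear_comp[OF dq(1)] dp(1) dq(1) Rlin pq)+
  have norm_v: "(norm (v h))\<^sup>2 = G h - G (R p (R q h))" for h
    using Rcomm[OF pq, of h] by (simp add: v_def norm_even_plus_odd dp(2) dq(2))
  have norm_w: "(norm (w h))\<^sup>2 = G h - G (R p (R q h))" for h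
    by (simp add: w_def norm_even_plus_odd dp(2) dq(2))
  have vw: "norm (v h) = norm (w h)" for h
    by (rule power2_eq_imp_eq) (simp_all add: norm_v norm_w)
  obtain U V :: "'h ell2 \<Rightarrow> 'h ell2" where Ulin: "bounded_clinear U" and Vlin: "bounded_clinear V"
    and UVadj: "\<And>x y. cinner (U x) y = cinner x (V y)" and UV: "\<And>x. U (V x) = x"
    and VU: "\<And>x. V (U x) = x" and Uv: "\<And>h. U (even_in (v h)) = even_in (w h)"
    by (rule unitary_between[OF vlin wlin vw]) blast
  have VUadj: "cinner (V x) y = cinner x (U y)" for x y by (metis UVadj cinner_commute)
  have normU: "norm (U x) = norm x" for x
    by (rule norm_isometry_of_left_inverse[of U V, OF UVadj VU])
  have normV: "norm (V x) = norm x" for x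
    by (rule norm_isometry_of_left_inverse[of V U, OF VUadj UV])

  \<comment> \<open>The coefficient space splits into halves, the first of which holds the values of \<open>v\<close> and \<open>w\<close>;
    \<open>P\<close> projects onto the half of that half holding their first components.\<close>
  define P :: "'h ell2 \<Rightarrow> 'h ell2" where "P x = even_in (even_in (even_out (even_out x)))" for x
  define P' :: "'h ell2 \<Rightarrow> 'h ell2" where "P' x = x - P x" for x
  have Plin: "bounded_clinear P"
    unfolding P_def[abs_def]
    by (intro bounded_clinear_comp[OF bounded_clinear_even_in]
        bounded_clinear_comp[OF bounded_clinear_even_out] bounded_clinear_even_out)
  have P'lin: "bounded_clinear P'"
    unfolding P'_def[abs_def] by (rule bounded_clinear_minus_fun[OF bounded_clinear_ident Plin])
  have even_out_adj: "cinner x (even_in y) = cinner (even_out x) y" for x y :: "'h ell2"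
    by (metis cinner_even_in cinner_commute)
  have Padj: "cinner (P x) y = cinner x (P y)" for x y
    by (simp add: P_def cinner_even_in even_out_adj)
  have P'adj: "cinner (P' x) y = cinner x (P' y)" for x y
    by (simp add: P'_def cinner_diff_left cinner_diff_right Padj)
  have PP: "P (P x) = P x" for x by (simp add: P_def)
  have orth: "cinner (P x) (P' y) = 0" "cinner (P' y) (P x) = 0" for x y
    by (simp_all add: P'_def cinner_diff_left cinner_diff_right Padj PP)
  have PP': "P (P' x) = 0" "P' (P x) = 0" "P' (P' x) = P' x" "P x + P' x = x" "P' x + P x = x" for x
    by (simp_all add: P'_def PP bounded_clinear_diff[OF Plin])

  define \<Phi>p where "\<Phi>p = pencil p (\<lambda>x. P' (U x)) (\<lambda>x. P (U x))"
  define \<Phi>q where "\<Phi>q = pencil p (\<lambda>x. V (P x)) (\<lambda>x. V (P' x))"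
  have pair_p: "isometric_pair (\<lambda>x. P' (U x)) (\<lambda>x. P (U x))"
    by (rule isometric_pair_orthogonal_split[OF P'lin Plin PP'(5) orth(2) bounded_clinear_ident refl Ulin normU])
  have pair_q: "isometric_pair (\<lambda>x. V (P x)) (\<lambda>x. V (P' x))"
    by (rule isometric_pair_orthogonal_split[OF Plin P'lin PP'(4) orth(1) Vlin normV bounded_clinear_ident refl])
  have Plins: "P (x + y) = P x + P y" "P' (x + y) = P' x + P' y" "P (c *\<^sub>C x) = c *\<^sub>C P x"
    "P' (c *\<^sub>C x) = c *\<^sub>C P' x" for x y c
    by (simp_all add: bounded_clinear_add[OF Plin] bounded_clinear_add[OF P'lin]
        bounded_clinear_scaleC[OF Plin] bounded_clinear_scaleC[OF P'lin])
  have \<Phi>pq: "\<Phi>p z (\<Phi>q z x) = z p *\<^sub>C x" for z x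
  proof -
    have "\<Phi>p z (\<Phi>q z x) = z p *\<^sub>C P' x + z p *\<^sub>C P x"
      by (simp add: \<Phi>p_def \<Phi>q_def pencil_def bounded_clinear_add[OF Ulin]
          bounded_clinear_scaleC[OF Ulin] UV Plins PP PP')
    then show ?thesis by (simp add: scaleC_add_right[symmetric] PP')
  qed
  have \<Phi>qp: "\<Phi>q z (\<Phi>p z x) = z p *\<^sub>C x" for z x
  proof -
    have "\<Phi>q z (\<Phi>p z x) = V (z p *\<^sub>C P (U x) + z p *\<^sub>C P' (U x))"
      by (simp add: \<Phi>p_def \<Phi>q_def pencil_def bounded_clinear_add[OF Vlin]
          bounded_clinear_scaleC[OF Vlin] Plins PP PP' bounded_clinear_zero[OF Vlin])
    then show ?thesis
      by (simp add: scaleC_add_right[symmetric] PP' bounded_clinear_scaleC[OF Vlin] VU)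
  qed

  define W where "W h = even_in (v h)" for h
  have Wlin: "bounded_clinear W"
    unfolding W_def[abs_def] by (rule bounded_clinear_comp[OF bounded_clinear_even_in vlin])
  have UW: "U (W h) = even_in (w h)" for h by (simp only: W_def Uv)
  define J where "J = hardy_embedding m R' W"
  have R'comm: "pairwise_commuting (R' ` {1..m})"
    by (rule pairwise_commuting_subset[OF comm]) (use R'F in blast)
  have R'p: "R' p = (\<lambda>h. R p (R q h))" by (simp add: R'_def merge_entries_def)
  have R'cases: "i = p \<or> (\<exists>j\<in>{1..n}. j \<noteq> p \<and> R' i = R j)" if "i \<in> {1..m}" for i
  proof (cases "i < q")
    case True
    then show ?thesis using that n by (auto simp: R'_def merge_entries_def)
  next
    case False
    then have "Suc i \<in> {1..n}" "Suc i \<noteq> p" "R' i = R (Suc i)"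
      using that n assms by (auto simp: R'_def merge_entries_def)
    then show ?thesis by blast
  qed
  have R'lin: "bounded_clinear (R' i)" if "i \<in> {1..m}" for i
    using R'cases[OF that] Rlin bounded_clinear_comp[OF Rlin Rlin, OF pq] by (auto simp: R'p)
  have R'le: "norm (R' i h) \<le> norm h" if "i \<in> {1..m}" for i h
    using R'cases[OF that] Rle order_trans[OF Rle[OF pq(1)] Rle[OF pq(2)]] by (auto simp: R'p)
  have Rpure: "(\<lambda>N. norm ((R j ^^ N) h)) \<longlonglongrightarrow> 0" if "j \<in> {1..n}" "j \<noteq> p" for j h
  proof -
    define i where "i = (if j < p then j else j - 1)"
    have "i \<in> {1..m}" "remove_entry p T i = T j"
      using that m n assms by (auto simp: i_def remove_entry_def)
    then show ?thesis
      using pure_p unfolding pure_tuple_def R_def by metis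
  qed
  have R'pure: "(\<lambda>N. norm ((R' i ^^ N) h)) \<longlonglongrightarrow> 0" if i: "i \<in> {1..m}" for i h
  proof (cases "i = p")
    case True
    \<comment> \<open>The powers of \<open>R q\<close> tend to \<open>0\<close>, and \<open>R p\<close> is a contraction commuting with \<open>R q\<close>.\<close>
    have le: "norm ((R' p ^^ N) h) \<le> norm ((R q ^^ N) h)" for N
      unfolding R'p funpow_comp_commute[of "R p" "R q", OF Rcomm[OF pq]] by (rule norm_funpow_le[OF Rle[OF pq(1)]])
    show ?thesis
      unfolding True
      by (rule tendsto_sandwich[OF _ _ tendsto_const Rpure[OF pq(2), where h = h]])
         (use le assms in simp_all)
  next
    case False
    then show ?thesis using R'cases[OF i] Rpure by auto
  qed
  have sum: "((\<lambda>k. (norm (W (powers [1..<Suc m] R' k h)))\<^sup>2) has_sum (norm h)\<^sup>2) (multi_indices m)" for h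
    unfolding multi_indices_def
  proof (rule has_sum_of_box_sums)
    have set: "set [1..<Suc m] = {1..m}" by auto
    \<comment> \<open>The squared norm of \<open>W\<close> is the Szego form of the merged tuple.\<close>
    have "(norm (W g))\<^sup>2 = fold diff_along (map R' [1..<Suc m]) (\<lambda>h. (norm h)\<^sup>2) g" for g
    proof -
      have "fold diff_along (map R' [1..<Suc m]) (\<lambda>h. (norm h)\<^sup>2) g = G g - G (R p (R q g))"
        unfolding xs
        by (rule foldL) (use mset(3)[of R] in \<open>simp_all add: R'_def L_def F_def\<close>)
      then show ?thesis by (simp only: W_def norm_even_in norm_v)
    qed
    then have "(\<Sum>k\<in>PiE {1..m} (\<lambda>_. {..<N}). (norm (W (powers [1..<Suc m] R' k h)))\<^sup>2) =
        fold diff_along (map (\<lambda>i. R' i ^^ N) [1..<Suc m]) (\<lambda>h. (norm h)\<^sup>2) h" for N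
      using sum_box_fold_diff_along[where xs = "[1..<Suc m]" and R = R' and N = N and \<phi> = "\<lambda>h. (norm h)\<^sup>2" and h = h] R'comm
      by (simp only: set distinct_upt)
    moreover have "(\<lambda>N. fold diff_along (map (\<lambda>i. R' i ^^ N) [1..<Suc m]) (\<lambda>h. (norm h)\<^sup>2) h)
        \<longlonglongrightarrow> (norm h)\<^sup>2"
      by (rule fold_diff_along_powers_tendsto; unfold set; fact R'comm R'le R'pure)
    ultimately show "(\<lambda>N. \<Sum>k\<in>PiE {1..m} (\<lambda>_. {..<N}). (norm (W (powers [1..<Suc m] R' k h)))\<^sup>2)
        \<longlonglongrightarrow> (norm h)\<^sup>2"
      by simp
  qed simp_all
  have iso: "isometry_to_hardy UNIV m J"
    unfolding J_def by (rule isometry_hardy_embedding[OF R'lin Wlin sum])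
  have sq: "square_summable m (\<lambda>k. W (powers [1..<Suc m] R' k h))" for h
    using sum[of h] by (auto simp: summable_on_def)
  have comm': "pairwise_commuting (insert (R j) (R' ` {1..m}))" if "j \<in> {1..n}" for j
    by (rule pairwise_commuting_subset[OF comm]) (use that RF R'F in blast)

  have coord: "J (R j h) = hardy_adjoint UNIV m (mult_coord m i) (J h)"
    if "i \<in> {1..m}" "R' i = R j" "j \<in> {1..n}" for i j h
    unfolding mult_coord_pencil J_def
    by (rule hardy_embedding_intertwines[OF that(1) isometric_pair_coord bounded_clinear_const_zero _
          bounded_clinear_ident refl sq comm'[OF that(3)]]) (simp_all add: that(2))
  have entry_p: "J (R p h) = hardy_adjoint UNIV m (mult_op m \<Phi>p) (J h)" for h
    unfolding \<Phi>p_def J_def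
  proof (rule hardy_embedding_intertwines[where A' = "\<lambda>x. V (P' x)" and B' = "\<lambda>x. V (P x)",
        OF m pair_p _ _ _ _ sq comm'[OF pq(1)]])
    fix g
    \<comment> \<open>Both sides have components \<open>dq (R q (R p g))\<close> and \<open>dp (R p g)\<close>.\<close>
    have "U (W (R p g)) = P' (W g) + P (W (R p (R q g)))"
      using Rcomm[OF pq, of g] unfolding UW
      by (simp add: W_def w_def v_def P_def P'_def half_linear)
    then have "V (U (W (R p g))) = V (P' (W g) + P (W (R p (R q g))))" by simp
    then show "W (R p g) = V (P' (W g)) + V (P (W (R' p g)))"
      by (simp add: VU R'p bounded_clinear_add[OF Vlin])
  qed (simp_all add: bounded_clinear_comp[OF Vlin] Plin P'lin Padj P'adj UVadj)
  have entry_q: "J (R q h) = hardy_adjoint UNIV m (mult_op m \<Phi>q) (J h)" for h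
    unfolding \<Phi>q_def J_def
  proof (rule hardy_embedding_intertwines[where A' = "\<lambda>x. P (U x)" and B' = "\<lambda>x. P' (U x)",
        OF m pair_q _ _ _ _ sq comm'[OF pq(2)]])
    fix g
    \<comment> \<open>Both sides have components \<open>dq (R q g)\<close> and \<open>dp (R p (R q g))\<close>.\<close>
    show "W (R q g) = P (U (W g)) + P' (U (W (R' p g)))"
      unfolding UW by (simp add: W_def R'p w_def v_def P_def P'_def half_linear)
  qed (simp_all add: bounded_clinear_comp Ulin Plin P'lin Padj P'adj VUadj)
  have low: "J (R i h) = hardy_adjoint UNIV m (mult_coord m i) (J h)"
    if "1 \<le> i" "i < q" "i \<noteq> p" for i h
    by (rule coord) (use that assms n in \<open>auto simp: R'_def merge_entries_def\<close>)
  have high: "J (R i h) = hardy_adjoint UNIV m (mult_coord m (i - 1)) (J h)"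
    if "q < i" "i \<le> n" for i h
    by (rule coord) (use that assms n in \<open>auto simp: R'_def merge_entries_def\<close>)

  define S where "S i = (if i = p then \<Phi>p else if i = q then \<Phi>q
      else pencil (if i < q then i else i - 1) (\<lambda>x. 0) (\<lambda>x. x))" for i
  define Vs where "Vs = (\<lambda>i. if i = p then mult_op m \<Phi>p else if i = q then mult_op m \<Phi>q
      else if i < q then mult_coord m i else mult_coord m (i - 1))"
  have Vs: "Vs i = mult_op m (S i)" for i
    by (simp add: Vs_def S_def mult_coord_pencil)
  have isoV: "hardy_isometry UNIV m (Vs i)" if i: "i \<in> {1..n}" for i
  proof -
    have "(if i < q then i else i - 1) \<in> {1..m}" using i assms n by auto
    note coord_iso = hardy_isometry_pencil[OF this isometric_pair_coord]
    show ?thesis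
    proof (cases "i = p \<or> i = q")
      case True
      then show ?thesis
        using hardy_isometry_pencil[OF m pair_p] hardy_isometry_pencil[OF m pair_q]
        by (auto simp: Vs S_def \<Phi>p_def \<Phi>q_def)
    next
      case False
      then have "S i = pencil (if i < q then i else i - 1) (\<lambda>x. 0) (\<lambda>x. x)" by (simp add: S_def)
      then show ?thesis using coord_iso by (simp only: Vs)
    qed
  qed
  have Slin: "S i z (c *\<^sub>C x) = c *\<^sub>C S i z x" for i z c x
    by (simp add: S_def \<Phi>p_def \<Phi>q_def pencil_def Plins bounded_clinear_scaleC[OF Ulin]
        bounded_clinear_scaleC[OF Vlin] scaleC_add_right scaleC_scaleC mult.commute)
  have Sscalar: "S i z x = z (if i < q then i else i - 1) *\<^sub>C x" if "i \<noteq> p" "i \<noteq> q" for i z x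
    using that by (simp add: S_def pencil_def)
  have Scomm: "S i z (S j z x) = S j z (S i z x)" for i j z x
  proof (cases "i \<in> {p, q} \<and> j \<in> {p, q}")
    case True
    then show ?thesis by (auto simp: S_def \<Phi>pq \<Phi>qp)
  next
    case False
    then show ?thesis by (auto simp: Sscalar Slin)
  qed
  have dil: "dilates_to_via UNIV m n T Vs J"
    unfolding dilates_to_via_def commuting_hardy_isometries_def
  proof (intro conjI ballI allI)
    fix i h assume "i \<in> {1..n}"
    then show "J (cadjoint (T i) h) = hardy_adjoint UNIV m (Vs i) (J h)"
      using entry_p[of h] entry_q[of h] low[of i h] high[of i h] unfolding R_def Vs_def by auto
  next
    fix i j f show "Vs i (Vs j f) = Vs j (Vs i f)"
      unfolding Vs by (rule mult_op_commute) (rule Scomm)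
  qed (use isoV iso in auto)
  have H: "\<Phi>p \<in> Hinfty UNIV m" "\<Phi>q \<in> Hinfty UNIV m"
    unfolding \<Phi>p_def \<Phi>q_def by (rule pencil_Hinfty[OF m pair_p], rule pencil_Hinfty[OF m pair_q])
  have I: "inner_function UNIV m \<Phi>p" "inner_function UNIV m \<Phi>q"
    using H hardy_isometry_pencil[OF m pair_p] hardy_isometry_pencil[OF m pair_q]
    by (simp_all add: inner_function_def \<Phi>p_def \<Phi>q_def)
  have pol: "polynomial_in_coord UNIV m p 1 \<Phi>p" "polynomial_in_coord UNIV m p 1 \<Phi>q"
    unfolding \<Phi>p_def \<Phi>q_def by (rule pencil_polynomial[OF pair_p], rule pencil_polynomial[OF pair_q])
  show ?thesis
    unfolding m_def[symmetric]
  proof (intro exI conjI)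
    show "closed_csubspace (UNIV :: 'h ell2 set)" by (simp add: closed_csubspace_def)
    show "isometry_to_hardy UNIV m J" by (rule iso)
    show "dilates_to_via UNIV m n T (\<lambda>i. if i = p then mult_op m \<Phi>p else if i = q then mult_op m \<Phi>q
      else if i < q then mult_coord m i else mult_coord m (i - 1)) J"
      using dil unfolding Vs_def .
  qed (use low high entry_p entry_q H I pol \<Phi>pq \<Phi>qp in \<open>auto simp: R_def\<close>)
qed

end
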